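(* Let $\Delta$ be a hyperbolic profinite $F$-group, and denote by $m(\Delta)$ the minimal integer $k$ such that there exists a torsion-free open normal subgroup $H$ of $\Delta$ that contains $\Delta^{(k)}$. Then $\Delta^m$ is center-free for any $m\ge m(\Delta)+2$.
   Context: A profinite group $\Delta$ is a profinite $F$-group if it admits a topological presentation $$\Bigl\langle \alpha_1,\beta_1,\dots,\alpha_g,\beta_g,\gamma_1,\dots,\gamma_r,\delta_1,\dots,\delta_s\ \Bigm|\ \prod_{i=1}^g[\alpha_i,\beta_i]\prod_{j=1}^r\gamma_j\prod_{\ell=1}^s\delta_\ell=1,\ \delta_1^{n_1}=\cdots=\delta_s^{n_s}=1\Bigr\rangle$$ with integers $g,r,s\ge0$ and $n_i\ge2$; it is hyperbolic if $2-2g-r-\sum_{i=1}^s(1-\frac1{n_i})<0$. For a profinite group $G$, $G^{(0)}=G$, $G^{(m)}$ is the closure of $[G^{(m-1)},G^{(m-1)}]$ for $m\ge1$, and $G^m=G/G^{(m)}$ is the maximal $m$-step solvable quotient (so $\Delta^m=\Delta/\Delta^{(m)}$). Center-free means having trivial center. *)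

theory Defs
  imports "HOL-Algebra.Algebra" "HOL-Analysis.Analysis" "HOL-Library.Extended_Nat"
begin

section \<open>Profinite groups\<close>

locale profinite_group = group G
  for G :: "('a, 'b) monoid_scheme" (structure) and T :: "'a topology" +
  assumes topspace_eq: "topspace T = carrier G"
    and continuous_mult: "continuous_map (prod_topology T T) T (\<lambda>(x, y). x \<otimes> y)"
    and continuous_inv: "continuous_map T T (\<lambda>x. inv x)"
    and compact: "compact_space T"
    and Hausdorff: "Hausdorff_space T"
    and totally_disconnected:
      "\<And>x. x \<in> carrier G \<Longrightarrow> connected_component_of_set T x = {x}"

definition closed_normal_closure ::
    "('a, 'b) monoid_scheme \<Rightarrow> 'a topology \<Rightarrow> 'a set \<Rightarrow> 'a set" where
  "closed_normal_closure G T R = \<Inter>{N. N \<lhd> G \<and> closedin T N \<and> R \<subseteq> N}"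

section \<open>The free profinite group on a finite set\<close>

text \<open>
  The free profinite group on a finite set \<open>A\<close> is the profinite completion of the discrete
  free group on \<open>A\<close>.  It is realised here as the closure of the subgroup generated by the
  tautological tuples \<open>(f x)\<close>, \<open>x \<in> A\<close>, in the product of the discrete groups \<open>Q\<close>
  over all pairs of a finite group \<open>Q\<close> and a map \<open>f\<close> from \<open>A\<close> to \<open>Q\<close>; such pairs are
  the homomorphisms from the discrete free group on \<open>A\<close> to finite groups.  Up to isomorphism
  it suffices to let \<open>Q\<close> range over the finite groups whose elements are natural numbers.
\<close>

definition finite_targets :: "'x set \<Rightarrow> (nat monoid \<times> ('x \<Rightarrow> nat)) set" where
  "finite_targets A =
     {(Q, f). group Q \<and> finite (carrier Q) \<and> f \<in> A \<rightarrow>\<^sub>E carrier Q}"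

definition target_product :: "'x set \<Rightarrow> (nat monoid \<times> ('x \<Rightarrow> nat) \<Rightarrow> nat) monoid" where
  "target_product A = product_group (finite_targets A) fst"

definition target_topology :: "'x set \<Rightarrow> (nat monoid \<times> ('x \<Rightarrow> nat) \<Rightarrow> nat) topology" where
  "target_topology A =
     product_topology (\<lambda>i. discrete_topology (carrier (fst i))) (finite_targets A)"

definition free_gen :: "'x set \<Rightarrow> 'x \<Rightarrow> nat monoid \<times> ('x \<Rightarrow> nat) \<Rightarrow> nat" where
  "free_gen A x = (\<lambda>i\<in>finite_targets A. snd i x)"

definition free_profinite :: "'x set \<Rightarrow> (nat monoid \<times> ('x \<Rightarrow> nat) \<Rightarrow> nat) monoid" where
  "free_profinite A = (target_product A)
     \<lparr>carrier := target_topology A closure_of generate (target_product A) (free_gen A ` A)\<rparr>"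

definition free_profinite_topology ::
    "'x set \<Rightarrow> (nat monoid \<times> ('x \<Rightarrow> nat) \<Rightarrow> nat) topology" where
  "free_profinite_topology A = subtopology (target_topology A) (carrier (free_profinite A))"

text \<open>
  \<open>G\<close> has the topological presentation with finite generating set \<open>A\<close> and relators \<open>R\<close>
  (a set of elements of the free profinite group) when it is the quotient of the free
  profinite group on \<open>A\<close> by the closed normal subgroup generated by \<open>R\<close>.  A continuous
  surjection of compact Hausdorff spaces is a quotient map, so \<open>G\<close> then carries the
  quotient topology.
\<close>

definition has_topological_presentation ::
    "('a, 'b) monoid_scheme \<Rightarrow> 'a topology \<Rightarrow> 'x set
      \<Rightarrow> (nat monoid \<times> ('x \<Rightarrow> nat) \<Rightarrow> nat) set \<Rightarrow> bool" where
  "has_topological_presentation G T A R \<longleftrightarrow>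
     (\<exists>p. p \<in> hom (free_profinite A) G
        \<and> continuous_map (free_profinite_topology A) T p
        \<and> p ` carrier (free_profinite A) = carrier G
        \<and> kernel (free_profinite A) G p
            = closed_normal_closure (free_profinite A) (free_profinite_topology A) R)"

section \<open>Profinite \<open>F\<close>-groups\<close>

text \<open>All generators and exponents are indexed from \<open>0\<close>.\<close>

datatype F_gen = Gen_alpha nat | Gen_beta nat | Gen_gamma nat | Gen_delta nat

definition F_gens :: "nat \<Rightarrow> nat \<Rightarrow> nat \<Rightarrow> F_gen set" where
  "F_gens g r s = Gen_alpha ` {..<g} \<union> Gen_beta ` {..<g} \<union> Gen_gamma ` {..<r} \<union> Gen_delta ` {..<s}"

definition commutator :: "('a, 'b) monoid_scheme \<Rightarrow> 'a \<Rightarrow> 'a \<Rightarrow> 'a" where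
  "commutator G x y = x \<otimes>\<^bsub>G\<^esub> y \<otimes>\<^bsub>G\<^esub> inv\<^bsub>G\<^esub> x \<otimes>\<^bsub>G\<^esub> inv\<^bsub>G\<^esub> y"

definition ordered_prod :: "('a, 'b) monoid_scheme \<Rightarrow> nat \<Rightarrow> (nat \<Rightarrow> 'a) \<Rightarrow> 'a" where
  "ordered_prod G k f = foldr (\<lambda>i y. f i \<otimes>\<^bsub>G\<^esub> y) [0..<k] \<one>\<^bsub>G\<^esub>"

definition F_relators ::
    "('a, 'b) monoid_scheme \<Rightarrow> (F_gen \<Rightarrow> 'a) \<Rightarrow> nat \<Rightarrow> nat \<Rightarrow> nat \<Rightarrow> (nat \<Rightarrow> nat) \<Rightarrow> 'a set" where
  "F_relators G x g r s n =
     insert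
       (ordered_prod G g (\<lambda>i. commutator G (x (Gen_alpha i)) (x (Gen_beta i)))
          \<otimes>\<^bsub>G\<^esub> ordered_prod G r (\<lambda>j. x (Gen_gamma j))
          \<otimes>\<^bsub>G\<^esub> ordered_prod G s (\<lambda>l. x (Gen_delta l)))
       ((\<lambda>l. x (Gen_delta l) [^]\<^bsub>G\<^esub> n l) ` {..<s})"

definition has_F_presentation ::
    "('a, 'b) monoid_scheme \<Rightarrow> 'a topology \<Rightarrow> nat \<Rightarrow> nat \<Rightarrow> nat \<Rightarrow> (nat \<Rightarrow> nat) \<Rightarrow> bool" where
  "has_F_presentation G T g r s n \<longleftrightarrow>
     (\<forall>l<s. n l \<ge> 2) \<and>
     has_topological_presentation G T (F_gens g r s)
       (F_relators (free_profinite (F_gens g r s)) (free_gen (F_gens g r s)) g r s n)"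

definition profinite_F_group :: "('a, 'b) monoid_scheme \<Rightarrow> 'a topology \<Rightarrow> bool" where
  "profinite_F_group G T \<longleftrightarrow>
     profinite_group G T \<and> (\<exists>g r s n. has_F_presentation G T g r s n)"

definition hyperbolic_profinite_F_group :: "('a, 'b) monoid_scheme \<Rightarrow> 'a topology \<Rightarrow> bool" where
  "hyperbolic_profinite_F_group G T \<longleftrightarrow>
     profinite_F_group G T \<and>
     (\<exists>g r s n. has_F_presentation G T g r s n \<and>
        2 - 2 * real g - real r - (\<Sum>l<s. 1 - 1 / real (n l)) < 0)"

section \<open>Maximal \<open>m\<close>-step solvable quotients\<close>

text \<open>\<^term>\<open>derived G H\<close> is the abstract subgroup generated by the commutators of \<open>H\<close>.\<close>

primrec top_derived :: "('a, 'b) monoid_scheme \<Rightarrow> 'a topology \<Rightarrow> nat \<Rightarrow> 'a set" where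
  "top_derived G T 0 = carrier G"
| "top_derived G T (Suc m) = T closure_of derived G (top_derived G T m)"

definition max_solvable_quotient ::
    "('a, 'b) monoid_scheme \<Rightarrow> 'a topology \<Rightarrow> nat \<Rightarrow> 'a set monoid" where
  "max_solvable_quotient G T m = G Mod top_derived G T m"

definition torsion_free_on :: "('a, 'b) monoid_scheme \<Rightarrow> 'a set \<Rightarrow> bool" where
  "torsion_free_on G H \<longleftrightarrow>
     (\<forall>x\<in>H. \<forall>n::nat. n > 0 \<longrightarrow> x [^]\<^bsub>G\<^esub> n = \<one>\<^bsub>G\<^esub> \<longrightarrow> x = \<one>\<^bsub>G\<^esub>)"

text \<open>
  This is the invariant written \<open>m(\<Delta>)\<close>.  The infimum is taken in \<^typ>\<open>enat\<close>: it is the minimum if some \<open>k\<close> qualifies, and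
  \<open>\<infinity>\<close> if none does (for instance for a perfect triangle group).
\<close>

definition torsion_free_level :: "('a, 'b) monoid_scheme \<Rightarrow> 'a topology \<Rightarrow> enat" where
  "torsion_free_level G T = Inf {enat k | k. \<exists>H. H \<lhd> G \<and> openin T H \<and> torsion_free_on G H
                                  \<and> top_derived G T k \<subseteq> H}"

definition center :: "('a, 'b) monoid_scheme \<Rightarrow> 'a set" where
  "center G = {z \<in> carrier G. \<forall>x\<in>carrier G. z \<otimes>\<^bsub>G\<^esub> x = x \<otimes>\<^bsub>G\<^esub> z}"

definition center_free :: "('a, 'b) monoid_scheme \<Rightarrow> bool" where
  "center_free G \<longleftrightarrow> center G = {\<one>\<^bsub>G\<^esub>}"

end

theory Submission
  imports Defs "HOL-Library.Function_Algebras"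
begin

text \<open>
  For an open normal subgroup \<open>U\<close> with quotient \<open>Q\<close>, homomorphisms from \<open>U\<close> to an abelian group are, by
  Shapiro's lemma, crossed homomorphisms from \<open>\<Delta>\<close> to functions on \<open>Q\<close>, and these are the solutions of the
  linear equations given by the Fox derivatives of the relators.

  Let \<open>z\<close> be central modulo \<open>\<Delta>\<^bsup>(m)\<^esup>\<close>.  If \<open>z\<close> is not in \<open>\<Delta>\<^bsup>(m-1)\<^esup>\<close>, choose \<open>U\<close> containing \<open>\<Delta>\<^bsup>(m-1)\<^esup>\<close>, torsion-free,
  and not containing \<open>z\<close>.  Centrality makes every crossed homomorphism invariant under \<open>z\<close> on \<open>U\<close>, so those whose
  sums over the cosets of \<open>\<langle>z\<rangle>\<close> vanish are coboundaries.  Modulo a suitable integer, hyperbolicity yields more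
  such solutions of the Fox equations than there are coboundaries.

  If \<open>z\<close> is in \<open>\<Delta>\<^bsup>(m-1)\<^esup>\<close> but not in \<open>\<Delta>\<^bsup>(m)\<^esup>\<close>, some homomorphism to a finite abelian group on an open torsion-free \<open>U\<close>
  containing \<open>\<Delta>\<^bsup>(m-1)\<^esup>\<close> is nonzero at \<open>z\<close>.  The Fox equations have the right image for it to lift to free abelian
  coefficients.  The transfer from \<open>U\<close> to \<open>H\<close> multiplies the value at \<open>z\<close> by the index of \<open>U\<close> in \<open>H\<close> and kills the closed
  derived group of \<open>H\<close>, which contains \<open>z\<close> because \<open>m - 1 > m(\<Delta>)\<close>; hence the value is zero.
\<close>

section \<open>Fox calculus\<close>

text \<open>The obstacle is that the presentation only bounds the orders of the elliptic generators
  from above, while both the count and the lifting need these orders to be exactly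
  \<open>n l\<close> in the finite quotient \<open>Q\<close>. If one of them were smaller, the extra
  solutions of the Fox equations would force every finite quotient of \<Delta> below a suitable
  torsion-free subgroup to be cyclic; explicit crossed homomorphisms modulo 2 and modulo 3 exclude
  this.

  The modulus in the first half is one more than the order of the image of \<open>z\<close> in
  \<open>Q\<close>. Then -1 inverts that order, so that summing over cosets is, up to sign, a
  projection, and functions split into zero-sum and invariant ones. Cardinalities then take the
  place of dimensions.

  In the second half the surface relator must be given a prescribed value without disturbing the
  torsion relators. With a puncture every value is possible. Without one, exactly the sum over
  \<open>Q\<close> has to vanish: differences of translates produce all functions of sum zero, and
  for torsion-free coefficients the torsion relators force the sum in question to be zero.\<close>

primrec ev :: "('a, 'b) monoid_scheme \<Rightarrow> ('x \<Rightarrow> 'a) \<Rightarrow> (bool \<times> 'x) list \<Rightarrow> 'a" where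
  "ev G x [] = \<one>\<^bsub>G\<^esub>"
| "ev G x (t # w) = (if fst t then x (snd t) else inv\<^bsub>G\<^esub> x (snd t)) \<otimes>\<^bsub>G\<^esub> ev G x w"

text \<open>Functions on \<open>Q\<close> carry the left translation action \<open>(g \<cdot> f) q = f (g\<^sup>-\<^sup>1 q)\<close>; \<open>fox\<close> is the value on a
  word of the crossed homomorphism of the free group that takes the values \<open>y\<close> on the generators.\<close>

primrec fox :: "('q, 'd) monoid_scheme \<Rightarrow> ('x \<Rightarrow> 'q) \<Rightarrow> ('x \<Rightarrow> 'q \<Rightarrow> 'c::ab_group_add)
    \<Rightarrow> (bool \<times> 'x) list \<Rightarrow> 'q \<Rightarrow> 'c" where
  "fox Q \<xi> y [] = (\<lambda>q. 0)"
| "fox Q \<xi> y (t # w) = (\<lambda>q.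
     if fst t then y (snd t) q + fox Q \<xi> y w (inv\<^bsub>Q\<^esub> \<xi> (snd t) \<otimes>\<^bsub>Q\<^esub> q)
     else - y (snd t) (\<xi> (snd t) \<otimes>\<^bsub>Q\<^esub> q) + fox Q \<xi> y w (\<xi> (snd t) \<otimes>\<^bsub>Q\<^esub> q))"

text \<open>Coefficients are considered modulo such a subgroup. One set of lemmas then covers the
  integers modulo \<open>N\<close>, a free abelian group modulo a sublattice and, with
  \<open>UNIV\<close>, unrestricted values, without quotient types.\<close>

definition add_subgroup :: "'c::ab_group_add set \<Rightarrow> bool" where
  "add_subgroup L \<longleftrightarrow> 0 \<in> L \<and> (\<forall>x\<in>L. \<forall>y\<in>L. x - y \<in> L)"

lemma add_subgroupD:
  assumes "add_subgroup L"
  shows "0 \<in> L" "x \<in> L \<Longrightarrow> y \<in> L \<Longrightarrow> x - y \<in> L" "x \<in> L \<Longrightarrow> - x \<in> L"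
    "x \<in> L \<Longrightarrow> y \<in> L \<Longrightarrow> x + y \<in> L"
proof -
  show 0: "0 \<in> L" and d: "x \<in> L \<Longrightarrow> y \<in> L \<Longrightarrow> x - y \<in> L" for x y
    using assms by (auto simp: add_subgroup_def)
  show m: "x \<in> L \<Longrightarrow> - x \<in> L" for x
    using d[OF 0] by force
  show "x \<in> L \<Longrightarrow> y \<in> L \<Longrightarrow> x + y \<in> L"
    using d[of x "- y"] m by force
qed

lemma add_subgroup_sum:
  assumes "add_subgroup L" "\<And>i. i \<in> I \<Longrightarrow> f i \<in> L"
  shows "sum f I \<in> L"
  using assms(2)
  by (induction I rule: infinite_finite_induct) (auto intro: add_subgroupD[OF assms(1)])

lemma add_subgroup_diff_trans:
  assumes "add_subgroup L" "a - b \<in> L" "b - c \<in> L"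
  shows "a - c \<in> L"
  using add_subgroupD(4)[OF assms] by simp

lemma add_subgroup_UNIV: "add_subgroup UNIV"
  by (simp add: add_subgroup_def)

lemma add_subgroup_multiples: "add_subgroup {x::int. N dvd x}"
  by (simp add: add_subgroup_def)

context group
begin

lemma ev_closed [simp]:
  assumes "\<And>a. x a \<in> carrier G"
  shows "ev G x w \<in> carrier G"
  using assms by (induction w) auto

lemma ev_append:
  assumes "\<And>a. x a \<in> carrier G"
  shows "ev G x (u @ v) = ev G x u \<otimes> ev G x v"
  using assms by (induction u) (auto simp: m_assoc)

lemma ev_replicate:
  assumes "\<And>a. x a \<in> carrier G"
  shows "ev G x (replicate k (True, a)) = x a [^] k"
proof (induction k)
  case (Suc k)
  then show ?case using assms nat_pow_Suc2[of "x a" k] by simp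
qed simp

lemma ev_cong:
  assumes "\<And>t. t \<in> set w \<Longrightarrow> x (snd t) = x' (snd t)"
  shows "ev G x w = ev G x' w"
  using assms by (induction w) auto

lemma subgroup_ev:
  assumes "subgroup S G" "\<And>t. t \<in> set w \<Longrightarrow> x (snd t) \<in> S"
  shows "ev G x w \<in> S"
  using assms(2)
  by (induction w) (auto simp: subgroup.one_closed[OF assms(1)] subgroup.m_closed[OF assms(1)]
      subgroup.m_inv_closed[OF assms(1)])

end

lemma (in group_hom) hom_ev:
  assumes "\<And>a. x a \<in> carrier G"
  shows "h (ev G x w) = ev H (\<lambda>a. h (x a)) w"
  using assms by (induction w) auto

locale marked_group = group Q for Q :: "('q, 'd) monoid_scheme" (structure) +
  fixes \<xi> :: "'x \<Rightarrow> 'q"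
  assumes finite_Q: "finite (carrier Q)" and \<xi>_closed [simp]: "\<And>a. \<xi> a \<in> carrier Q"
begin

lemma inv_mult_assoc:
  "a \<in> carrier Q \<Longrightarrow> b \<in> carrier Q \<Longrightarrow> q \<in> carrier Q \<Longrightarrow>
    inv (a \<otimes> b) \<otimes> q = inv b \<otimes> (inv a \<otimes> q)"
  by (simp add: inv_mult_group m_assoc)

text \<open>This is the crossed homomorphism law on words: the contribution of the second factor is
  translated by the value of the first.\<close>

lemma fox_append:
  assumes "q \<in> carrier Q"
  shows "fox Q \<xi> y (u @ v) q = fox Q \<xi> y u q + fox Q \<xi> y v (inv (ev Q \<xi> u) \<otimes> q)"
  using assms
proof (induction u arbitrary: q)
  case (Cons t u)
  show ?case using Cons.prems
    by (auto simp: Cons.IH inv_mult_assoc add.assoc)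
qed simp

lemma fox_add: "fox Q \<xi> (\<lambda>a q. y a q + y' a q) w q = fox Q \<xi> y w q + fox Q \<xi> y' w q"
  by (induction w arbitrary: q) (simp_all add: algebra_simps)

lemma fox_diff: "fox Q \<xi> (\<lambda>a q. y a q - y' a q) w q = fox Q \<xi> y w q - fox Q \<xi> y' w q"
  by (induction w arbitrary: q) (simp_all add: algebra_simps)

lemma fox_zero: "(\<And>t q. t \<in> set w \<Longrightarrow> q \<in> carrier Q \<Longrightarrow> y (snd t) q = 0) \<Longrightarrow> q \<in> carrier Q
    \<Longrightarrow> fox Q \<xi> y w q = 0"
  by (induction w arbitrary: q) simp_all

lemma fox_sum: "fox Q \<xi> (\<lambda>a q. \<Sum>i\<in>I. y i a q) w q = (\<Sum>i\<in>I. fox Q \<xi> (y i) w q)"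
  by (induction w arbitrary: q) (simp_all add: sum.distrib sum_negf sum_subtractf)

lemma fox_mem:
  assumes "add_subgroup L" "\<And>t q. t \<in> set w \<Longrightarrow> q \<in> carrier Q \<Longrightarrow> y (snd t) q \<in> L" "q \<in> carrier Q"
  shows "fox Q \<xi> y w q \<in> L"
  using assms(2,3)
proof (induction w arbitrary: q)
  case (Cons t w)
  have "y (snd t) q \<in> L" if "q \<in> carrier Q" for q
    using Cons.prems(1)[of t] that by simp
  moreover have "fox Q \<xi> y w q \<in> L" if "q \<in> carrier Q" for q
    using Cons.prems(1) that by (intro Cons.IH) auto
  ultimately show ?case using Cons.prems(2)
    by (auto intro!: add_subgroupD(2,4)[OF assms(1)])
qed (simp add: add_subgroupD[OF assms(1)])

lemma fox_diff_mem:
  assumes "add_subgroup L" "\<And>t q. t \<in> set w \<Longrightarrow> q \<in> carrier Q \<Longrightarrow> y (snd t) q - y' (snd t) q \<in> L"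
    "q \<in> carrier Q"
  shows "fox Q \<xi> y w q - fox Q \<xi> y' w q \<in> L"
  using fox_mem[OF assms(1), of w "\<lambda>a q. y a q - y' a q" q] assms(2,3) by (simp add: fox_diff)

text \<open>\<open>fox\<close> involves only left translations, and these commute with right ones.
  Sums over the cosets \<open>q K\<close> therefore commute with Fox derivatives.\<close>

lemma fox_right:
  assumes "z \<in> carrier Q" "q \<in> carrier Q"
  shows "fox Q \<xi> (\<lambda>a q. y a (q \<otimes> z)) w q = fox Q \<xi> y w (q \<otimes> z)"
  using assms by (induction w arbitrary: q) (simp_all add: m_assoc)

text \<open>The derivative of the k-th power of a letter is 1 + a + ... + a^(k-1), the partial norm,
  applied to the value at that letter.\<close>

lemma fox_replicate:
  assumes "q \<in> carrier Q"
  shows "fox Q \<xi> y (replicate k (True, a)) q = (\<Sum>i<k. y a (inv (\<xi> a [^] i) \<otimes> q))"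
  using assms
proof (induction k arbitrary: q)
  case (Suc k)
  have "inv (\<xi> a [^] i) \<otimes> (inv \<xi> a \<otimes> q) = inv (\<xi> a [^] Suc i) \<otimes> q" for i
    using nat_pow_Suc2[of "\<xi> a" i] by (simp add: inv_mult_assoc Suc.prems)
  then show ?case using Suc by (simp add: sum.lessThan_Suc_shift del: nat_pow_Suc sum.lessThan_Suc)
qed simp

end

text \<open>The crossed homomorphism identity for functions on \<open>Q\<close>, required only up to
  \<open>L\<close>. Values stay in \<open>'c\<close>, so that a lift and its reduction have the same
  type and can be subtracted.\<close>

definition cocycle_mod :: "('a, 'b) monoid_scheme \<Rightarrow> ('q, 'd) monoid_scheme \<Rightarrow> ('a \<Rightarrow> 'q)
    \<Rightarrow> 'c::ab_group_add set \<Rightarrow> ('a \<Rightarrow> 'q \<Rightarrow> 'c) \<Rightarrow> bool" where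
  "cocycle_mod G Q \<psi> L D \<longleftrightarrow> (\<forall>g\<in>carrier G. \<forall>h\<in>carrier G. \<forall>q\<in>carrier Q.
     D (g \<otimes>\<^bsub>G\<^esub> h) q - D g q - D h (inv\<^bsub>Q\<^esub> \<psi> g \<otimes>\<^bsub>Q\<^esub> q) \<in> L)"

locale cocycle_context = group_hom G Q \<psi>
  for G :: "('a, 'b) monoid_scheme" (structure) and Q :: "('q, 'd) monoid_scheme" (structure)
    and \<psi> :: "'a \<Rightarrow> 'q" +
  fixes L :: "'c::ab_group_add set" and D :: "'a \<Rightarrow> 'q \<Rightarrow> 'c"
  assumes L: "add_subgroup L" and cocycle: "cocycle_mod G Q \<psi> L D"
begin

lemma D_mult:
  "g \<in> carrier G \<Longrightarrow> h \<in> carrier G \<Longrightarrow> q \<in> carrier Q \<Longrightarrow>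
    D (g \<otimes> h) q - (D g q + D h (inv\<^bsub>Q\<^esub> \<psi> g \<otimes>\<^bsub>Q\<^esub> q)) \<in> L"
  using cocycle by (simp add: cocycle_mod_def diff_diff_eq)

lemma D_one: "q \<in> carrier Q \<Longrightarrow> D \<one> q \<in> L"
  using D_mult[of \<one> \<one> q] add_subgroupD(3)[OF L, of "- D \<one> q"] by simp

lemma D_inv:
  assumes "g \<in> carrier G" "q \<in> carrier Q"
  shows "D (inv g) q + D g (\<psi> g \<otimes>\<^bsub>Q\<^esub> q) \<in> L"
proof -
  have "D (inv g \<otimes> g) q - (D (inv g) q + D g (inv\<^bsub>Q\<^esub> \<psi> (inv g) \<otimes>\<^bsub>Q\<^esub> q)) \<in> L"
    using assms by (intro D_mult) auto
  moreover have "D (inv g \<otimes> g) q \<in> L" using D_one assms by simp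
  ultimately have "D (inv g \<otimes> g) q - (D (inv g \<otimes> g) q - (D (inv g) q + D g (inv\<^bsub>Q\<^esub> \<psi> (inv g) \<otimes>\<^bsub>Q\<^esub> q))) \<in> L"
    using add_subgroupD(2)[OF L] by blast
  then show ?thesis using assms by (simp add: add.commute)
qed

text \<open>A crossed homomorphism is determined on words by its values on the letters, and
  \<open>fox\<close> computes the value. Applied to a relator, whose value in the group is trivial,
  this yields the Fox equations modulo \<open>L\<close>.\<close>

lemma D_word:
  assumes "\<And>a. x a \<in> carrier G" "q \<in> carrier Q"
  shows "D (ev G x w) q - fox Q (\<lambda>a. \<psi> (x a)) (\<lambda>a. D (x a)) w q \<in> L"
  using assms(2)
proof (induction w arbitrary: q)
  case Nil
  then show ?case using D_one by simp
next
  case (Cons t w)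
  let ?f = "fox Q (\<lambda>a. \<psi> (x a)) (\<lambda>a. D (x a)) w"
  let ?a = "x (snd t)" and ?e = "ev G x w"
  have c: "?a \<in> carrier G" "?e \<in> carrier G" using assms(1) by auto
  show ?case
  proof (cases "fst t")
    case True
    have "D (?a \<otimes> ?e) q - (D ?a q + D ?e (inv\<^bsub>Q\<^esub> \<psi> ?a \<otimes>\<^bsub>Q\<^esub> q)) \<in> L"
      using c Cons.prems by (intro D_mult)
    moreover have "D ?e (inv\<^bsub>Q\<^esub> \<psi> ?a \<otimes>\<^bsub>Q\<^esub> q) - ?f (inv\<^bsub>Q\<^esub> \<psi> ?a \<otimes>\<^bsub>Q\<^esub> q) \<in> L"
      using c Cons.prems by (intro Cons.IH) auto
    ultimately show ?thesis using True by (auto dest: add_subgroupD(4)[OF L] simp: algebra_simps)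
  next
    case False
    have 1: "D (inv ?a \<otimes> ?e) q - (D (inv ?a) q + D ?e (\<psi> ?a \<otimes>\<^bsub>Q\<^esub> q)) \<in> L"
      using c Cons.prems D_mult[of "inv ?a" ?e q] by (simp add: hom_inv)
    have 2: "D ?e (\<psi> ?a \<otimes>\<^bsub>Q\<^esub> q) - ?f (\<psi> ?a \<otimes>\<^bsub>Q\<^esub> q) \<in> L"
      using c Cons.prems by (intro Cons.IH) auto
    have 3: "D (inv ?a) q + D ?a (\<psi> ?a \<otimes>\<^bsub>Q\<^esub> q) \<in> L"
      using c Cons.prems by (intro D_inv) auto
    show ?thesis using False add_subgroupD(4)[OF L add_subgroupD(4)[OF L 1 2] 3]
      by (simp add: algebra_simps)
  qed
qed

end

section \<open>The relators of the presentation as words\<close>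

definition comm_word :: "nat \<Rightarrow> (bool \<times> F_gen) list" where
  "comm_word i = [(True, Gen_alpha i), (True, Gen_beta i), (False, Gen_alpha i), (False, Gen_beta i)]"

definition prod_word :: "nat \<Rightarrow> nat \<Rightarrow> nat \<Rightarrow> (bool \<times> F_gen) list" where
  "prod_word g r s = concat (map comm_word [0..<g]) @ map (\<lambda>j. (True, Gen_gamma j)) [0..<r]
     @ map (\<lambda>l. (True, Gen_delta l)) [0..<s]"

definition pow_word :: "(nat \<Rightarrow> nat) \<Rightarrow> nat \<Rightarrow> (bool \<times> F_gen) list" where
  "pow_word n l = replicate (n l) (True, Gen_delta l)"

definition F_words :: "nat \<Rightarrow> nat \<Rightarrow> nat \<Rightarrow> (nat \<Rightarrow> nat) \<Rightarrow> (bool \<times> F_gen) list set" where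
  "F_words g r s n = insert (prod_word g r s) (pow_word n ` {..<s})"

lemma snd_prod_word: "t \<in> set (prod_word g r s) \<Longrightarrow> snd t \<in> F_gens g r s"
  by (auto simp: prod_word_def comm_word_def F_gens_def)

lemma snd_F_words: "w \<in> F_words g r s n \<Longrightarrow> t \<in> set w \<Longrightarrow> snd t \<in> F_gens g r s"
  using snd_prod_word[of t g r s] by (auto simp: F_words_def pow_word_def F_gens_def)

lemma (in group) ordered_prod_ev:
  assumes "\<And>a. x a \<in> carrier G" "\<And>i. i < k \<Longrightarrow> f i = ev G x (w i)"
  shows "ordered_prod G k f = ev G x (concat (map w [0..<k]))"
proof -
  have "foldr (\<lambda>i y. f i \<otimes> y) l \<one> = ev G x (concat (map w l))"
    if "\<And>i. i \<in> set l \<Longrightarrow> f i = ev G x (w i)" for l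
    using that assms(1) by (induction l) (auto simp: ev_append)
  from this[of "[0..<k]"] show ?thesis using assms(2) by (simp add: ordered_prod_def)
qed

lemma (in group) F_relators_ev:
  assumes "\<And>a. x a \<in> carrier G"
  shows "F_relators G x g r s n = ev G x ` F_words g r s n"
proof -
  have c: "concat (map (\<lambda>j. [(True, h j)]) l) = map (\<lambda>j. (True, h j)) l" for h :: "nat \<Rightarrow> F_gen" and l
    by (induction l) auto
  have 1: "ordered_prod G g (\<lambda>i. commutator G (x (Gen_alpha i)) (x (Gen_beta i)))
     = ev G x (concat (map comm_word [0..<g]))"
    using assms by (intro ordered_prod_ev) (auto simp: commutator_def comm_word_def m_assoc)
  have 2: "ordered_prod G k (\<lambda>j. x (h j)) = ev G x (map (\<lambda>j. (True, h j)) [0..<k])"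
    for k :: nat and h :: "nat \<Rightarrow> F_gen"
    using ordered_prod_ev[where f = "\<lambda>j. x (h j)" and w = "\<lambda>j. [(True, h j)]" and k = k and x = x] assms
    by (simp add: c)
  show ?thesis
    unfolding F_relators_def F_words_def 1 2 prod_word_def pow_word_def
    using assms by (simp add: ev_append m_assoc ev_replicate image_image)
qed

section \<open>The free profinite group\<close>

lemma finite_targetsD:
  assumes "i \<in> finite_targets A"
  shows "group (fst i)" "finite (carrier (fst i))" "snd i \<in> A \<rightarrow>\<^sub>E carrier (fst i)"
  using assms by (auto simp: finite_targets_def)

lemma group_target_product: "group (target_product A)"
  by (simp add: target_product_def finite_targetsD)

lemma carrier_target_product: "carrier (target_product A) = (\<Pi>\<^sub>E i\<in>finite_targets A. carrier (fst i))"
  by (simp add: target_product_def)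

lemma topspace_target_topology: "topspace (target_topology A) = carrier (target_product A)"
  by (simp add: target_topology_def carrier_target_product)

lemma free_gen_closed: "a \<in> A \<Longrightarrow> free_gen A a \<in> carrier (target_product A)"
  using finite_targetsD(3) by (fastforce simp: carrier_target_product free_gen_def)

lemma openin_target_topologyD:
  assumes "openin (target_topology A) S" "u \<in> S"
  obtains J where "finite J" "J \<subseteq> finite_targets A"
    "\<And>v. v \<in> carrier (target_product A) \<Longrightarrow> (\<And>i. i \<in> J \<Longrightarrow> v i = u i) \<Longrightarrow> v \<in> S"
proof -
  obtain U where U: "finite {i \<in> finite_targets A. U i \<noteq> carrier (fst i)}"
      "u \<in> Pi\<^sub>E (finite_targets A) U" "Pi\<^sub>E (finite_targets A) U \<subseteq> S"
    using assms unfolding target_topology_def openin_product_topology_alt by auto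
  show ?thesis
  proof (rule that[OF U(1)])
    fix v assume v: "v \<in> carrier (target_product A)"
      "\<And>i. i \<in> {i \<in> finite_targets A. U i \<noteq> carrier (fst i)} \<Longrightarrow> v i = u i"
    have "v i \<in> U i" if "i \<in> finite_targets A" for i
      using v U(2) that by (cases "U i = carrier (fst i)") (auto simp: carrier_target_product)
    then have "v \<in> Pi\<^sub>E (finite_targets A) U" using v(1) by (auto simp: carrier_target_product PiE_iff)
    then show "v \<in> S" using U(3) by auto
  qed auto
qed

lemma openin_target_topologyI:
  assumes "S \<subseteq> carrier (target_product A)"
    "\<And>u. u \<in> S \<Longrightarrow> \<exists>J. finite J \<and> J \<subseteq> finite_targets A \<and>
      (\<forall>v\<in>carrier (target_product A). (\<forall>i\<in>J. v i = u i) \<longrightarrow> v \<in> S)"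
  shows "openin (target_topology A) S"
  unfolding target_topology_def openin_product_topology_alt
proof
  fix u assume u: "u \<in> S"
  then obtain J where J: "finite J" "J \<subseteq> finite_targets A"
      "\<forall>v\<in>carrier (target_product A). (\<forall>i\<in>J. v i = u i) \<longrightarrow> v \<in> S"
    using assms(2)[OF u] by auto
  let ?U = "\<lambda>i. if i \<in> J then {u i} else carrier (fst i)"
  have uc: "u \<in> carrier (target_product A)" using u assms(1) by auto
  show "\<exists>U. finite {i \<in> finite_targets A. U i \<noteq> topspace (discrete_topology (carrier (fst i)))} \<and>
      (\<forall>i\<in>finite_targets A. openin (discrete_topology (carrier (fst i))) (U i)) \<and>
      u \<in> Pi\<^sub>E (finite_targets A) U \<and> Pi\<^sub>E (finite_targets A) U \<subseteq> S"
  proof (intro exI[of _ ?U] conjI ballI)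
    show "finite {i \<in> finite_targets A. ?U i \<noteq> topspace (discrete_topology (carrier (fst i)))}"
      by (rule finite_subset[OF _ J(1)]) auto
    show "openin (discrete_topology (carrier (fst i))) (?U i)" if "i \<in> finite_targets A" for i
      using uc that by (auto simp: carrier_target_product PiE_iff)
    show "u \<in> Pi\<^sub>E (finite_targets A) ?U"
      using uc by (auto simp: carrier_target_product PiE_iff)
    show "Pi\<^sub>E (finite_targets A) ?U \<subseteq> S"
    proof
      fix v assume v: "v \<in> Pi\<^sub>E (finite_targets A) ?U"
      have eq: "v i = u i" if "i \<in> J" for i
      proof -
        have "v i \<in> ?U i" using v J(2) that by blast
        then show ?thesis using that by simp
      qed
      have "v i \<in> carrier (fst i)" if "i \<in> finite_targets A" for i
        using PiE_mem[OF v that] uc that by (auto simp: carrier_target_product PiE_iff split: if_splits)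
      then have "v \<in> carrier (target_product A)"
        using v by (auto simp: carrier_target_product PiE_iff)
      then show "v \<in> S" using J(3) eq by auto
    qed
  qed
qed

text \<open>The factors are discrete, so the cylinders that prescribe finitely many coordinates form
  a base. Lying in the closure means being approximated by the generated subgroup in each of
  them.\<close>

lemma in_free_profinite_iff:
  "u \<in> carrier (free_profinite A) \<longleftrightarrow> u \<in> carrier (target_product A) \<and>
    (\<forall>J. finite J \<longrightarrow> J \<subseteq> finite_targets A \<longrightarrow>
      (\<exists>v\<in>generate (target_product A) (free_gen A ` A). \<forall>i\<in>J. v i = u i))"
  (is "_ \<longleftrightarrow> ?u \<and> ?R")
proof
  interpret P: group "target_product A" by (rule group_target_product)
  have gc: "generate (target_product A) (free_gen A ` A) \<subseteq> carrier (target_product A)"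
    using free_gen_closed by (intro P.generate_incl) auto
  assume "u \<in> carrier (free_profinite A)"
  then have u: "u \<in> target_topology A closure_of generate (target_product A) (free_gen A ` A)"
    by (simp add: free_profinite_def)
  then have uc: "u \<in> carrier (target_product A)"
    by (simp add: in_closure_of topspace_target_topology)
  have ?R
  proof (intro allI impI)
    fix J assume J: "finite J" "J \<subseteq> finite_targets A"
    let ?S = "{v \<in> carrier (target_product A). \<forall>i\<in>J. v i = u i}"
    have "openin (target_topology A) ?S"
    proof (rule openin_target_topologyI)
      fix w assume "w \<in> ?S"
      with J show "\<exists>J. finite J \<and> J \<subseteq> finite_targets A \<and>
          (\<forall>v\<in>carrier (target_product A). (\<forall>i\<in>J. v i = w i) \<longrightarrow> v \<in> ?S)"
        by (intro exI[of _ J]) auto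
    qed auto
    moreover have "u \<in> ?S" using uc by simp
    ultimately show "\<exists>v\<in>generate (target_product A) (free_gen A ` A). \<forall>i\<in>J. v i = u i"
      using in_closure_of[THEN iffD1, OF u, THEN conjunct2, rule_format, of ?S] by auto
  qed
  with uc show "?u \<and> ?R" by simp
next
  assume *: "?u \<and> ?R"
  interpret P: group "target_product A" by (rule group_target_product)
  have gc: "generate (target_product A) (free_gen A ` A) \<subseteq> carrier (target_product A)"
    using free_gen_closed by (intro P.generate_incl) auto
  have "\<exists>y. y \<in> generate (target_product A) (free_gen A ` A) \<and> y \<in> S"
    if S: "u \<in> S" "openin (target_topology A) S" for S
  proof -
    obtain J where "finite J" "J \<subseteq> finite_targets A"
      "\<And>v. v \<in> carrier (target_product A) \<Longrightarrow> (\<And>i. i \<in> J \<Longrightarrow> v i = u i) \<Longrightarrow> v \<in> S"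
      using openin_target_topologyD[OF S(2,1)] by blast
    moreover obtain v where "v \<in> generate (target_product A) (free_gen A ` A)" "\<forall>i\<in>J. v i = u i"
      using * calculation by meson
    ultimately show ?thesis using gc by (intro exI[of _ v]) auto
  qed
  then show "u \<in> carrier (free_profinite A)"
    using * by (auto simp: free_profinite_def in_closure_of topspace_target_topology)
qed

lemma mult_target_product:
  "x \<otimes>\<^bsub>target_product A\<^esub> y = (\<lambda>i\<in>finite_targets A. x i \<otimes>\<^bsub>fst i\<^esub> y i)"
  by (simp add: target_product_def)

lemma inv_target_product:
  "x \<in> carrier (target_product A) \<Longrightarrow>
    inv\<^bsub>target_product A\<^esub> x = (\<lambda>i\<in>finite_targets A. inv\<^bsub>fst i\<^esub> x i)"
  unfolding target_product_def by (subst inv_product_group) (auto simp: finite_targetsD)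

lemma subgroup_free_profinite: "subgroup (carrier (free_profinite A)) (target_product A)"
proof -
  interpret P: group "target_product A" by (rule group_target_product)
  let ?g = "generate (target_product A) (free_gen A ` A)"
  have sg: "subgroup ?g (target_product A)"
    using free_gen_closed by (intro P.generate_is_subgroup) auto
  show ?thesis
  proof (rule P.subgroupI)
    show "carrier (free_profinite A) \<subseteq> carrier (target_product A)"
      using in_free_profinite_iff by blast
    have "\<one>\<^bsub>target_product A\<^esub> \<in> carrier (free_profinite A)"
      using subgroup.one_closed[OF sg] by (auto simp: in_free_profinite_iff)
    then show "carrier (free_profinite A) \<noteq> {}" by auto
    fix u assume u: "u \<in> carrier (free_profinite A)"
    then have uc: "u \<in> carrier (target_product A)" by (simp add: in_free_profinite_iff)
    show "inv\<^bsub>target_product A\<^esub> u \<in> carrier (free_profinite A)"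
      unfolding in_free_profinite_iff
    proof (intro conjI allI impI)
      fix J assume J: "finite J" "J \<subseteq> finite_targets A"
      then obtain v where v: "v \<in> ?g" "\<forall>i\<in>J. v i = u i" using u in_free_profinite_iff by blast
      then have "v \<in> carrier (target_product A)" using subgroup.mem_carrier[OF sg] by blast
      then show "\<exists>v\<in>?g. \<forall>i\<in>J. v i = (inv\<^bsub>target_product A\<^esub> u) i"
        using v J subgroup.m_inv_closed[OF sg v(1)]
        by (intro bexI[of _ "inv\<^bsub>target_product A\<^esub> v"]) (auto simp: inv_target_product uc subset_iff)
    qed (use uc in simp)
    fix u' assume u': "u' \<in> carrier (free_profinite A)"
    then have uc': "u' \<in> carrier (target_product A)" by (simp add: in_free_profinite_iff)
    show "u \<otimes>\<^bsub>target_product A\<^esub> u' \<in> carrier (free_profinite A)"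
      unfolding in_free_profinite_iff
    proof (intro conjI allI impI)
      fix J assume J: "finite J" "J \<subseteq> finite_targets A"
      then obtain v v' where v: "v \<in> ?g" "\<forall>i\<in>J. v i = u i" "v' \<in> ?g" "\<forall>i\<in>J. v' i = u' i"
        using u u' in_free_profinite_iff by metis
      then show "\<exists>v\<in>?g. \<forall>i\<in>J. v i = (u \<otimes>\<^bsub>target_product A\<^esub> u') i"
        using J subgroup.m_closed[OF sg v(1,3)]
        by (intro bexI[of _ "v \<otimes>\<^bsub>target_product A\<^esub> v'"]) (auto simp: mult_target_product subset_iff)
    qed (use uc uc' in simp)
  qed
qed

lemma free_profinite_eq:
  "free_profinite A = (target_product A)\<lparr>carrier := carrier (free_profinite A)\<rparr>"
  by (simp add: free_profinite_def)

lemma group_free_profinite: "group (free_profinite A)"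
  using group.subgroup_imp_group[OF group_target_product subgroup_free_profinite]
  by (metis free_profinite_eq)

lemma free_profinite_closed_imp:
  "u \<in> carrier (free_profinite A) \<Longrightarrow> u \<in> carrier (target_product A)"
  by (simp add: in_free_profinite_iff)

lemma mult_free_profinite:
  "x \<otimes>\<^bsub>free_profinite A\<^esub> y = (\<lambda>i\<in>finite_targets A. x i \<otimes>\<^bsub>fst i\<^esub> y i)"
  by (simp add: free_profinite_def mult_target_product)

text \<open>An index is a finite group together with a map from the generators, and the coordinate
  at it is the homomorphism extending that map. The universal property rests on this.\<close>

lemma coordinate_hom:
  assumes "i \<in> finite_targets A"
  shows "group_hom (free_profinite A) (fst i) (\<lambda>u. u i)"
proof -
  have "(\<lambda>u. u i) \<in> hom (free_profinite A) (fst i)"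
    using assms by (auto simp: hom_def mult_free_profinite dest!: free_profinite_closed_imp)
      (auto simp: carrier_target_product)
  then show ?thesis
    using group_free_profinite finite_targetsD(1)[OF assms]
    unfolding group_hom_def group_hom_axioms_def by blast
qed

lemma free_gen_in_free_profinite: "a \<in> A \<Longrightarrow> free_gen A a \<in> carrier (free_profinite A)"
  unfolding in_free_profinite_iff
  by (intro conjI allI impI bexI[of _ "free_gen A a"] free_gen_closed generate.incl) auto

lemma topspace_free_profinite: "topspace (free_profinite_topology A) = carrier (free_profinite A)"
  using free_profinite_closed_imp
  by (auto simp: free_profinite_topology_def topspace_target_topology)

lemma openin_free_profiniteD:
  assumes "openin (free_profinite_topology A) S" "u \<in> S"
  obtains J where "finite J" "J \<subseteq> finite_targets A"
    "\<And>v. v \<in> carrier (free_profinite A) \<Longrightarrow> (\<And>i. i \<in> J \<Longrightarrow> v i = u i) \<Longrightarrow> v \<in> S"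
proof -
  obtain U where U: "openin (target_topology A) U" "S = U \<inter> carrier (free_profinite A)"
    using assms(1) by (auto simp: free_profinite_topology_def openin_subtopology)
  with assms obtain J where "finite J" "J \<subseteq> finite_targets A"
    "\<And>v. v \<in> carrier (target_product A) \<Longrightarrow> (\<And>i. i \<in> J \<Longrightarrow> v i = u i) \<Longrightarrow> v \<in> U"
    using openin_target_topologyD[OF U(1)] by blast
  then show ?thesis using U(2) free_profinite_closed_imp by (intro that[of J]) auto
qed

lemma openin_free_profinite_ex:
  assumes "openin (free_profinite_topology A) S" "u \<in> S"
  shows "\<exists>J. finite J \<and> J \<subseteq> finite_targets A \<and>
    (\<forall>v\<in>carrier (free_profinite A). (\<forall>i\<in>J. v i = u i) \<longrightarrow> v \<in> S)"
proof (rule openin_free_profiniteD[OF assms])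
  fix J assume J: "finite J" "J \<subseteq> finite_targets A"
    "\<And>v. v \<in> carrier (free_profinite A) \<Longrightarrow> (\<And>i. i \<in> J \<Longrightarrow> v i = u i) \<Longrightarrow> v \<in> S"
  show ?thesis by (intro exI[of _ J] conjI ballI impI J) simp_all
qed

lemma openin_free_profiniteI:
  assumes S: "S \<subseteq> carrier (free_profinite A)"
    "\<And>u. u \<in> S \<Longrightarrow> \<exists>J. finite J \<and> J \<subseteq> finite_targets A \<and>
      (\<forall>v\<in>carrier (free_profinite A). (\<forall>i\<in>J. v i = u i) \<longrightarrow> v \<in> S)"
  shows "openin (free_profinite_topology A) S"
proof -
  \<comment> \<open>The union of the cylinders around points of \<open>S\<close>, taken in the
    ambient product, whose trace on the free profinite group lies in \<open>S\<close>. It cuts out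
    exactly \<open>S\<close>.\<close>
  let ?U = "{w \<in> carrier (target_product A). \<exists>u\<in>S. \<exists>J. finite J \<and> J \<subseteq> finite_targets A \<and>
      (\<forall>v\<in>carrier (free_profinite A). (\<forall>i\<in>J. v i = u i) \<longrightarrow> v \<in> S) \<and> (\<forall>i\<in>J. w i = u i)}"
  have "openin (target_topology A) ?U"
  proof (rule openin_target_topologyI)
    fix w assume "w \<in> ?U"
    then obtain u J where J: "u \<in> S" "finite J" "J \<subseteq> finite_targets A"
      "\<forall>v\<in>carrier (free_profinite A). (\<forall>i\<in>J. v i = u i) \<longrightarrow> v \<in> S" "\<forall>i\<in>J. w i = u i"
      by auto
    have "v \<in> ?U" if "v \<in> carrier (target_product A)" "\<forall>i\<in>J. v i = w i" for v
      using that J by (intro CollectI conjI bexI[of _ u] exI[of _ J]) simp_all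
    with J show "\<exists>J. finite J \<and> J \<subseteq> finite_targets A \<and>
          (\<forall>v\<in>carrier (target_product A). (\<forall>i\<in>J. v i = w i) \<longrightarrow> v \<in> ?U)"
      by (intro exI[of _ J]) simp
  qed auto
  moreover have "S = ?U \<inter> carrier (free_profinite A)"
  proof (intro equalityI subsetI IntI)
    fix u assume "u \<in> S"
    then show "u \<in> carrier (free_profinite A)" using S(1) by auto
    then have "u \<in> carrier (target_product A)" by (rule free_profinite_closed_imp)
    then show "u \<in> ?U" using \<open>u \<in> S\<close> S(2)[of u] by blast
  next
    fix u assume u: "u \<in> ?U \<inter> carrier (free_profinite A)"
    then obtain u' J where "\<forall>v\<in>carrier (free_profinite A). (\<forall>i\<in>J. v i = u' i) \<longrightarrow> v \<in> S"
      "\<forall>i\<in>J. u i = u' i" by blast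
    then show "u \<in> S" using u by blast
  qed
  ultimately show ?thesis
    unfolding free_profinite_topology_def openin_subtopology by blast
qed

lemma compact_space_free_profinite: "compact_space (free_profinite_topology A)"
proof -
  have "compact_space (target_topology A)"
    unfolding target_topology_def compact_space_product_topology
    by (auto simp: compact_space_discrete_topology finite_targetsD)
  then show ?thesis
    unfolding free_profinite_topology_def
    by (simp add: compact_space_subtopology closedin_compact_space free_profinite_def)
qed

text \<open>For finite sets \<open>J\<close> of indices these are open normal subgroups forming a
  base of neighbourhoods of the identity.\<close>

definition coord_kernel :: "'x set \<Rightarrow> (nat monoid \<times> ('x \<Rightarrow> nat)) set
    \<Rightarrow> (nat monoid \<times> ('x \<Rightarrow> nat) \<Rightarrow> nat) set" where
  "coord_kernel A J = {u \<in> carrier (free_profinite A). \<forall>i\<in>J. u i = \<one>\<^bsub>fst i\<^esub>}"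

lemma coord_kernel_normal:
  assumes "J \<subseteq> finite_targets A"
  shows "coord_kernel A J \<lhd> free_profinite A"
proof -
  interpret F: group "free_profinite A" by (rule group_free_profinite)
  note ch = coordinate_hom[OF subsetD[OF assms]]
  have mem: "u i \<in> carrier (fst i)" if "u \<in> carrier (free_profinite A)" "i \<in> J" for u i
    using that free_profinite_closed_imp[of u A] assms by (auto simp: carrier_target_product)
  have one: "i \<in> J \<Longrightarrow> \<one>\<^bsub>free_profinite A\<^esub> i = \<one>\<^bsub>fst i\<^esub>" for i
    using group_hom.hom_one[OF ch] .
  have inv: "i \<in> J \<Longrightarrow> u \<in> carrier (free_profinite A) \<Longrightarrow>
      (inv\<^bsub>free_profinite A\<^esub> u) i = inv\<^bsub>fst i\<^esub> u i" for i u
    using group_hom.hom_inv[OF ch] .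
  have mul: "i \<in> J \<Longrightarrow> (u \<otimes>\<^bsub>free_profinite A\<^esub> v) i = u i \<otimes>\<^bsub>fst i\<^esub> v i" for i u v
    using assms by (auto simp: mult_free_profinite)
  have gi: "group (fst i)" if "i \<in> J" for i by (rule finite_targetsD(1)[OF subsetD[OF assms that]])
  have s: "subgroup (coord_kernel A J) (free_profinite A)"
  proof (rule F.subgroupI)
    show "coord_kernel A J \<noteq> {}"
      using one F.one_closed unfolding coord_kernel_def by blast
    fix u assume u: "u \<in> coord_kernel A J"
    then show "inv\<^bsub>free_profinite A\<^esub> u \<in> coord_kernel A J"
      by (simp add: coord_kernel_def inv gi monoid.inv_one[OF group.is_monoid])
    fix v assume "v \<in> coord_kernel A J"
    with u show "u \<otimes>\<^bsub>free_profinite A\<^esub> v \<in> coord_kernel A J"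
      by (simp add: coord_kernel_def mul gi monoid.l_one[OF group.is_monoid] monoid.one_closed[OF group.is_monoid])
  qed (auto simp: coord_kernel_def)
  show ?thesis
  proof (rule F.normal_invI[OF s])
    fix x h assume "x \<in> carrier (free_profinite A)" "h \<in> coord_kernel A J"
    then show "x \<otimes>\<^bsub>free_profinite A\<^esub> h \<otimes>\<^bsub>free_profinite A\<^esub> inv\<^bsub>free_profinite A\<^esub> x \<in> coord_kernel A J"
      by (simp add: coord_kernel_def inv mul mem gi group.r_inv monoid.r_one[OF group.is_monoid])
  qed
qed

lemma F_relators_cong:
  assumes "\<And>a. a \<in> F_gens g r s \<Longrightarrow> x a = x' a"
  shows "F_relators G x g r s n = F_relators G x' g r s n"
proof -
  have o: "ordered_prod G k f = ordered_prod G k f'" if "\<And>i. i < k \<Longrightarrow> f i = f' i" for k and f f' :: "nat \<Rightarrow> 'a"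
    using that unfolding ordered_prod_def by (intro foldr_cong) auto
  have "ordered_prod G g (\<lambda>i. commutator G (x (Gen_alpha i)) (x (Gen_beta i)))
      = ordered_prod G g (\<lambda>i. commutator G (x' (Gen_alpha i)) (x' (Gen_beta i)))"
    using assms by (intro o) (auto simp: F_gens_def)
  moreover have "ordered_prod G r (\<lambda>j. x (Gen_gamma j)) = ordered_prod G r (\<lambda>j. x' (Gen_gamma j))"
    using assms by (intro o) (auto simp: F_gens_def)
  moreover have "ordered_prod G s (\<lambda>j. x (Gen_delta j)) = ordered_prod G s (\<lambda>j. x' (Gen_delta j))"
    using assms by (intro o) (auto simp: F_gens_def)
  moreover have "(\<lambda>l. x (Gen_delta l) [^]\<^bsub>G\<^esub> n l) ` {..<s} = (\<lambda>l. x' (Gen_delta l) [^]\<^bsub>G\<^esub> n l) ` {..<s}"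
    using assms by (intro image_cong) (auto simp: F_gens_def)
  ultimately show ?thesis unfolding F_relators_def by simp
qed

text \<open>The free profinite group is built from finite groups on natural numbers. Transport of
  structure brings other finite groups, such as quotients of a semidirect product, within reach of
  its universal property.\<close>

lemma finite_group_nat_copy:
  assumes "group K" "finite (carrier K)"
  obtains K' :: "nat monoid" and e where "group K'" "finite (carrier K')" "e \<in> hom K K'"
    "e ` carrier K = carrier K'" "inj_on e (carrier K)"
proof -
  interpret group K by fact
  obtain e :: "_ \<Rightarrow> nat" where e: "inj_on e (carrier K)"
    using finite_imp_inj_to_nat_seg[OF assms(2)] by blast
  define d where "d = inv_into (carrier K) e"
  have d: "d (e x) = x" if "x \<in> carrier K" for x using e that by (simp add: d_def)
  define K' where "K' = \<lparr>carrier = e ` carrier K, monoid.mult = (\<lambda>x y. e (d x \<otimes>\<^bsub>K\<^esub> d y)), one = e \<one>\<^bsub>K\<^esub>\<rparr>"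
  have h: "e \<in> hom K K'" by (auto simp: hom_def K'_def d)
  have "e \<in> iso K K'" using h e by (auto simp: iso_def bij_betw_def K'_def)
  then have i: "K \<cong> K'" by (auto simp: is_iso_def)
  have "monoid K'"
    by (rule monoidI) (auto simp: K'_def d m_assoc)
  then have "group K'" by (rule iso_imp_group[OF i])
  moreover have c: "e ` carrier K = carrier K'" by (simp add: K'_def)
  moreover have "finite (carrier K')" using assms(2) by (simp flip: c)
  ultimately show ?thesis using h e by (intro that)
qed

section \<open>Open normal subgroups and the universal property\<close>

locale F_presentation = profinite_group \<Delta> T
  for \<Delta> :: "('a, 'b) monoid_scheme" (structure) and T :: "'a topology" +
  fixes g r s :: nat and n :: "nat \<Rightarrow> nat" and p :: "(nat monoid \<times> (F_gen \<Rightarrow> nat) \<Rightarrow> nat) \<Rightarrow> 'a"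
  assumes p_hom: "p \<in> hom (free_profinite (F_gens g r s)) \<Delta>"
    and p_continuous: "continuous_map (free_profinite_topology (F_gens g r s)) T p"
    and p_surj: "p ` carrier (free_profinite (F_gens g r s)) = carrier \<Delta>"
    and p_kernel: "kernel (free_profinite (F_gens g r s)) \<Delta> p
      = closed_normal_closure (free_profinite (F_gens g r s)) (free_profinite_topology (F_gens g r s))
          (F_relators (free_profinite (F_gens g r s)) (free_gen (F_gens g r s)) g r s n)"
begin

abbreviation "gens \<equiv> F_gens g r s"
abbreviation "FP \<equiv> free_profinite gens"

text \<open>Letters outside the finite generating set get the identity, so that the assignment is
  total with values in the carrier, as the lemmas on evaluating words require.\<close>

definition fgen :: "F_gen \<Rightarrow> nat monoid \<times> (F_gen \<Rightarrow> nat) \<Rightarrow> nat" where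
  "fgen a = (if a \<in> gens then free_gen gens a else \<one>\<^bsub>FP\<^esub>)"

definition gen :: "F_gen \<Rightarrow> 'a" where
  "gen a = p (fgen a)"

text \<open>These are the open normal subgroups; the condition on coordinates avoids the quotient topology.\<close>

definition open_normal :: "'a set set" where
  "open_normal = {V. V \<lhd> \<Delta> \<and> (\<exists>J. finite J \<and> J \<subseteq> finite_targets gens \<and> p ` coord_kernel gens J \<subseteq> V)}"

lemma p_surjE:
  assumes "x \<in> carrier \<Delta>"
  obtains u where "u \<in> carrier FP" "x = p u"
  using assms unfolding p_surj[symmetric] by (rule imageE) (rule that)

lemma p_group_hom: "group_hom FP \<Delta> p"
  using p_hom group_free_profinite is_group by (simp add: group_hom_def group_hom_axioms_def)

lemma fgen_closed [simp]: "fgen a \<in> carrier FP"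
  using free_gen_in_free_profinite group_free_profinite[THEN group.is_monoid, THEN monoid.one_closed]
  by (auto simp: fgen_def)

lemma gen_closed [simp]: "gen a \<in> carrier \<Delta>"
  using group_hom.hom_closed[OF p_group_hom] by (simp add: gen_def)

lemma p_ev: "p (ev FP fgen w) = ev \<Delta> gen w"
  using group_hom.hom_ev[OF p_group_hom, of fgen w] by (simp add: gen_def[abs_def])

lemma relators_eq: "F_relators FP (free_gen gens) g r s n = ev FP fgen ` F_words g r s n"
proof -
  have "F_relators FP (free_gen gens) g r s n = F_relators FP fgen g r s n"
    by (rule F_relators_cong) (simp add: fgen_def)
  then show ?thesis using group.F_relators_ev[OF group_free_profinite, of fgen] by simp
qed

lemma relators_subset_kernel:
  "ev FP fgen ` F_words g r s n \<subseteq> kernel FP \<Delta> p"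
  unfolding p_kernel closed_normal_closure_def relators_eq by blast

lemma relator_one: "w \<in> F_words g r s n \<Longrightarrow> ev \<Delta> gen w = \<one>"
  using relators_subset_kernel p_ev[of w] by (auto simp: kernel_def)

lemma open_normalD:
  assumes "V \<in> open_normal"
  shows "V \<lhd> \<Delta>" "subgroup V \<Delta>"
  using assms normal_imp_subgroup by (auto simp: open_normal_def)

lemma open_normal_Int:
  assumes "V \<in> open_normal" "W \<in> open_normal"
  shows "V \<inter> W \<in> open_normal"
proof -
  obtain J J' where J: "finite J" "J \<subseteq> finite_targets gens" "p ` coord_kernel gens J \<subseteq> V"
    "finite J'" "J' \<subseteq> finite_targets gens" "p ` coord_kernel gens J' \<subseteq> W"
    using assms by (auto simp: open_normal_def)
  have "coord_kernel gens (J \<union> J') \<subseteq> coord_kernel gens J \<inter> coord_kernel gens J'"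
    by (auto simp: coord_kernel_def)
  then have "p ` coord_kernel gens (J \<union> J') \<subseteq> V \<inter> W" using J by blast
  moreover have "V \<inter> W \<lhd> \<Delta>"
    using assms open_normalD by (intro normal_subgroup_intersect)
  ultimately show ?thesis unfolding open_normal_def using J by (intro CollectI conjI exI[of _ "J \<union> J'"]) auto
qed

lemma open_normal_mono:
  assumes "V \<in> open_normal" "V \<subseteq> W" "W \<lhd> \<Delta>"
  shows "W \<in> open_normal"
proof -
  have "\<exists>J. finite J \<and> J \<subseteq> finite_targets gens \<and> p ` coord_kernel gens J \<subseteq> V"
    using assms(1) by (simp add: open_normal_def)
  then obtain J where J: "finite J \<and> J \<subseteq> finite_targets gens \<and> p ` coord_kernel gens J \<subseteq> V" ..
  then have "p ` coord_kernel gens J \<subseteq> W" using assms(2) by (intro subset_trans[OF _ assms(2)]) simp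
  then show ?thesis unfolding open_normal_def using J assms(3) by (intro CollectI conjI exI[of _ J]) simp_all
qed

lemma subgroup_vimage:
  assumes "subgroup S \<Delta>"
  shows "subgroup {u \<in> carrier FP. p u \<in> S} FP"
proof -
  interpret p: group_hom FP \<Delta> p by (rule p_group_hom)
  show ?thesis
    by (rule p.subgroupI)
      (use assms in \<open>auto intro: subgroup.m_closed subgroup.m_inv_closed subgroup.one_closed
        intro!: exI[of _ "\<one>\<^bsub>FP\<^esub>"]\<close>)
qed

lemma coord_diff:
  assumes "u \<in> carrier FP" "v \<in> carrier FP" "J \<subseteq> finite_targets gens" "\<And>i. i \<in> J \<Longrightarrow> v i = u i"
  shows "inv\<^bsub>FP\<^esub> v \<otimes>\<^bsub>FP\<^esub> u \<in> coord_kernel gens J"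
proof -
  interpret p: group_hom FP \<Delta> p by (rule p_group_hom)
  have "(inv\<^bsub>FP\<^esub> v \<otimes>\<^bsub>FP\<^esub> u) i = \<one>\<^bsub>fst i\<^esub>" if "i \<in> J" for i
  proof -
    have i: "i \<in> finite_targets gens" using that assms(3) by auto
    interpret c: group_hom FP "fst i" "\<lambda>u. u i" by (rule coordinate_hom[OF i])
    show ?thesis using assms(4)[OF that] assms(1,2) c.hom_closed[of u] by (simp add: c.hom_inv)
  qed
  then show ?thesis using assms by (simp add: coord_kernel_def)
qed

text \<open>On the finitely many coordinates that determine its class modulo \<open>V\<close>, a
  preimage of an element agrees with some element of the abstract subgroup generated by the free
  generators. This is topological generation in the form that suits zero sets of cocycles.\<close>

lemma generated_by_gens:
  assumes V: "V \<in> open_normal" and S: "subgroup S \<Delta>" "V \<subseteq> S" "\<And>a. a \<in> gens \<Longrightarrow> gen a \<in> S"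
  shows "S = carrier \<Delta>"
proof
  show "S \<subseteq> carrier \<Delta>" using S(1) subgroup.subset by blast
  interpret p: group_hom FP \<Delta> p by (rule p_group_hom)
  obtain J where J: "finite J" "J \<subseteq> finite_targets gens" "p ` coord_kernel gens J \<subseteq> V"
    using V by (auto simp: open_normal_def)
  let ?S = "{u \<in> carrier FP. p u \<in> S}"
  have sub: "subgroup ?S FP" by (rule subgroup_vimage[OF S(1)])
  have "free_gen gens ` gens \<subseteq> ?S"
    using S(3) free_gen_in_free_profinite by (auto simp: gen_def fgen_def)
  then have "generate FP (free_gen gens ` gens) \<subseteq> ?S"
    by (rule p.generate_subgroup_incl[OF _ sub])
  moreover have "generate FP (free_gen gens ` gens) = generate (target_product gens) (free_gen gens ` gens)"
    using group.generate_consistent[OF group_target_product _ subgroup_free_profinite, of "free_gen gens ` gens" gens]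
      free_gen_in_free_profinite free_profinite_eq[of gens] by (metis image_subsetI)
  ultimately have gS: "generate (target_product gens) (free_gen gens ` gens) \<subseteq> ?S" by simp
  show "carrier \<Delta> \<subseteq> S"
  proof
    fix x assume "x \<in> carrier \<Delta>"
    then obtain u where u: "u \<in> carrier FP" "x = p u" using p_surj by blast
    from in_free_profinite_iff[THEN iffD1, OF u(1), THEN conjunct2, rule_format, OF J(1,2)]
    obtain v where v: "v \<in> generate (target_product gens) (free_gen gens ` gens)" "\<forall>i\<in>J. v i = u i"
      by auto
    have v': "v \<in> carrier FP" "p v \<in> S" using gS v(1) by auto
    have "inv\<^bsub>FP\<^esub> v \<otimes>\<^bsub>FP\<^esub> u \<in> coord_kernel gens J"
      using u(1) v'(1) J(2) v(2) by (intro coord_diff) auto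
    then have "p (inv\<^bsub>FP\<^esub> v \<otimes>\<^bsub>FP\<^esub> u) \<in> S" using J(3) S(2) by blast
    then have "p v \<otimes> p (inv\<^bsub>FP\<^esub> v \<otimes>\<^bsub>FP\<^esub> u) \<in> S" by (intro subgroup.m_closed[OF S(1)] v')
    moreover have "p v \<otimes> p (inv\<^bsub>FP\<^esub> v \<otimes>\<^bsub>FP\<^esub> u) = p u"
      using u(1) v'(1) by (simp flip: p.hom_mult p.m_assoc)
    ultimately show "x \<in> S" using u(2) by simp
  qed
qed

lemma open_normal_finite_index:
  assumes "V \<in> open_normal"
  shows "finite (carrier (\<Delta> Mod V))"
proof -
  interpret p: group_hom FP \<Delta> p by (rule p_group_hom)
  obtain J where J: "finite J" "J \<subseteq> finite_targets gens" "p ` coord_kernel gens J \<subseteq> V"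
    using assms by (auto simp: open_normal_def)
  note V = open_normalD[OF assms]
  \<comment> \<open>A coset is recovered from the \<open>J\<close>-coordinates of any of its
    preimages: two preimages with the same coordinates differ by the coordinate kernel, which maps
    into \<open>V\<close>. There are finitely many coordinate tuples.\<close>
  let ?c = "\<lambda>c. V #> p (SOME u. u \<in> carrier FP \<and> restrict u J = c)"
  have "carrier (\<Delta> Mod V) \<subseteq> ?c ` (\<Pi>\<^sub>E i\<in>J. carrier (fst i))"
  proof
    fix Z assume "Z \<in> carrier (\<Delta> Mod V)"
    then obtain x where "x \<in> carrier \<Delta>" "Z = V #> x" by (auto simp: FactGroup_def RCOSETS_def)
    moreover from this have "x \<in> p ` carrier FP" using p_surj by simp
    ultimately obtain u where u: "u \<in> carrier FP" "Z = V #> p u" by auto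
    define v where "v = (SOME v. v \<in> carrier FP \<and> restrict v J = restrict u J)"
    have v: "v \<in> carrier FP" "restrict v J = restrict u J"
      using someI_ex[of "\<lambda>v. v \<in> carrier FP \<and> restrict v J = restrict u J"] u(1)
      unfolding v_def by blast+
    have "v i = u i" if "i \<in> J" for i using v(2) that by (metis restrict_apply)
    then have "inv\<^bsub>FP\<^esub> v \<otimes>\<^bsub>FP\<^esub> u \<in> coord_kernel gens J"
      using u(1) v(1) J(2) by (intro coord_diff) auto
    then have "p (inv\<^bsub>FP\<^esub> v \<otimes>\<^bsub>FP\<^esub> u) \<in> V" using J(3) by blast
    then have i: "inv p v \<otimes> p u \<in> V" using u(1) v(1) by (simp add: p.hom_inv)
    have "p v \<otimes> (inv p v \<otimes> p u) \<otimes> inv p v \<in> V"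
      using u(1) v(1) by (intro normal.inv_op_closed2[OF V(1)] i) auto
    then have m: "p u \<otimes> inv p v \<in> V"
      using u(1) v(1) by (simp add: inv_solve_right m_assoc[symmetric])
    then have "V #> p v = V #> p u"
      using u(1) v(1) by (intro repr_independence[OF _ _ V(2)]) (auto intro: subgroup.rcos_module_rev[OF V(2) is_group])
    then have "Z = ?c (restrict u J)" using u(2) by (simp add: v_def)
    moreover have "restrict u J \<in> (\<Pi>\<^sub>E i\<in>J. carrier (fst i))"
      using free_profinite_closed_imp[OF u(1)] J(2) by (auto simp: carrier_target_product PiE_iff)
    ultimately show "Z \<in> ?c ` (\<Pi>\<^sub>E i\<in>J. carrier (fst i))" by blast
  qed
  moreover have "finite (\<Pi>\<^sub>E i\<in>J. carrier (fst i))"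
    using J(1,2) by (intro finite_PiE finite_targetsD(2)) auto
  ultimately show ?thesis using finite_surj by blast
qed

lemma open_normal_if_openin:
  assumes "N \<lhd> \<Delta>" "openin T N"
  shows "N \<in> open_normal"
proof -
  let ?S = "{u \<in> carrier FP. p u \<in> N}"
  interpret p: group_hom FP \<Delta> p by (rule p_group_hom)
  have "openin (free_profinite_topology gens) ?S"
    using openin_continuous_map_preimage[OF p_continuous assms(2)] by (simp add: topspace_free_profinite)
  moreover have "\<one>\<^bsub>FP\<^esub> \<in> ?S" using normal_imp_subgroup[OF assms(1)] by (simp add: subgroup.one_closed)
  ultimately have "\<exists>J. finite J \<and> J \<subseteq> finite_targets gens \<and>
    (\<forall>v\<in>carrier FP. (\<forall>i\<in>J. v i = \<one>\<^bsub>FP\<^esub> i) \<longrightarrow> v \<in> ?S)"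
    by (rule openin_free_profinite_ex)
  then obtain J where "finite J \<and> J \<subseteq> finite_targets gens \<and>
    (\<forall>v\<in>carrier FP. (\<forall>i\<in>J. v i = \<one>\<^bsub>FP\<^esub> i) \<longrightarrow> v \<in> ?S)" ..
  note J = this[THEN conjunct1] this[THEN conjunct2, THEN conjunct1] this[THEN conjunct2, THEN conjunct2]
  have "coord_kernel gens J \<subseteq> ?S"
  proof
    fix v assume v: "v \<in> coord_kernel gens J"
    show "v \<in> ?S"
    proof (rule J(3)[rule_format])
      show "v \<in> carrier FP" using v by (simp add: coord_kernel_def)
      fix i assume i: "i \<in> J"
      then show "v i = \<one>\<^bsub>FP\<^esub> i"
        using v group_hom.hom_one[OF coordinate_hom[OF subsetD[OF J(2) i]]] by (simp add: coord_kernel_def)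
    qed
  qed
  then show ?thesis unfolding open_normal_def using J assms(1) by (intro CollectI conjI exI[of _ J]) auto
qed

lemma closedin_image:
  assumes "closedin (free_profinite_topology gens) C"
  shows "closedin T (p ` C)"
  by (rule compactin_imp_closedin[OF Hausdorff image_compactin[OF
        closedin_compact_space[OF compact_space_free_profinite assms] p_continuous]])

text \<open>The preimage of \<open>S\<close> in the free profinite group is a union of cosets of a
  coordinate kernel, hence closed. Its image under \<open>p\<close> is \<open>S\<close>, and a
  continuous map from a compact to a Hausdorff space preserves closedness.\<close>

lemma closedin_if_contains_open_normal:
  assumes V: "V \<in> open_normal" and S: "subgroup S \<Delta>" "V \<subseteq> S"
  shows "closedin T S"
proof -
  interpret p: group_hom FP \<Delta> p by (rule p_group_hom)
  obtain J where J: "finite J" "J \<subseteq> finite_targets gens" "p ` coord_kernel gens J \<subseteq> V"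
    using V by (auto simp: open_normal_def)
  let ?S = "{u \<in> carrier FP. p u \<in> S}"
  have sub: "subgroup ?S FP" by (rule subgroup_vimage[OF S(1)])
  have "openin (free_profinite_topology gens) (carrier FP - ?S)"
  proof (rule openin_free_profiniteI)
    fix u assume u: "u \<in> carrier FP - ?S"
    have "v \<in> carrier FP - ?S" if v: "v \<in> carrier FP" "\<forall>i\<in>J. v i = u i" for v
    proof
      show "v \<notin> ?S"
      proof
        assume vS: "v \<in> ?S"
        have "inv\<^bsub>FP\<^esub> v \<otimes>\<^bsub>FP\<^esub> u \<in> coord_kernel gens J"
          using u v J(2) by (intro coord_diff) auto
        then have "inv\<^bsub>FP\<^esub> v \<otimes>\<^bsub>FP\<^esub> u \<in> ?S" using J(3) S(2) by (auto simp: coord_kernel_def)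
        then have "v \<otimes>\<^bsub>FP\<^esub> (inv\<^bsub>FP\<^esub> v \<otimes>\<^bsub>FP\<^esub> u) \<in> ?S" by (rule subgroup.m_closed[OF sub vS])
        then show False using u v by (simp flip: p.m_assoc)
      qed
    qed (use v in simp)
    then show "\<exists>J. finite J \<and> J \<subseteq> finite_targets gens \<and>
        (\<forall>v\<in>carrier FP. (\<forall>i\<in>J. v i = u i) \<longrightarrow> v \<in> carrier FP - ?S)"
      using J by (intro exI[of _ J]) simp
  qed auto
  then have "closedin (free_profinite_topology gens) ?S"
    by (auto simp: closedin_def topspace_free_profinite)
  then have "closedin T (p ` ?S)" by (rule closedin_image)
  moreover have "p ` ?S = S" using p_surj subgroup.subset[OF S(1)] by auto
  ultimately show ?thesis by simp
qed

text \<open>A preimage of \<open>z\<close> has a cylinder neighbourhood that avoids the preimage of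
  \<open>C\<close>. Its coordinates define a coordinate kernel, whose image under the surjection
  \<open>p\<close> is normal and serves as \<open>V\<close>.\<close>

lemma separate_closed:
  assumes C: "closedin T C" and z: "z \<in> carrier \<Delta>" "z \<notin> C"
  obtains V where "V \<in> open_normal" "\<And>v. v \<in> V \<Longrightarrow> z \<otimes> v \<notin> C"
proof -
  interpret p: group_hom FP \<Delta> p by (rule p_group_hom)
  obtain u where u: "u \<in> carrier FP" "z = p u" using z(1) by (rule p_surjE)
  let ?O = "{u \<in> carrier FP. p u \<in> carrier \<Delta> - C}"
  have "openin T (carrier \<Delta> - C)" using C by (simp add: closedin_def topspace_eq)
  then have o: "openin (free_profinite_topology gens) ?O"
    using openin_continuous_map_preimage[OF p_continuous, of "carrier \<Delta> - C"]
    by (simp only: topspace_free_profinite)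
  have "u \<in> ?O" using u z by auto
  then have "\<exists>J. finite J \<and> J \<subseteq> finite_targets gens \<and>
    (\<forall>v\<in>carrier FP. (\<forall>i\<in>J. v i = u i) \<longrightarrow> v \<in> ?O)"
    by (rule openin_free_profinite_ex[OF o])
  then obtain J where "finite J \<and> J \<subseteq> finite_targets gens \<and>
    (\<forall>v\<in>carrier FP. (\<forall>i\<in>J. v i = u i) \<longrightarrow> v \<in> ?O)" ..
  note J = this[THEN conjunct1] this[THEN conjunct2, THEN conjunct1] this[THEN conjunct2, THEN conjunct2]
  have nk: "coord_kernel gens J \<lhd> FP" by (rule coord_kernel_normal[OF J(2)])
  show ?thesis
  proof
    have "p ` coord_kernel gens J \<lhd> \<Delta>"
    proof (rule normal_invI)
      show "subgroup (p ` coord_kernel gens J) \<Delta>"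
        using p.subgroup_img_is_subgroup[OF normal_imp_subgroup[OF nk]] .
      fix x h assume "x \<in> carrier \<Delta>" "h \<in> p ` coord_kernel gens J"
      then obtain y k where y: "y \<in> carrier FP" "x = p y" "k \<in> coord_kernel gens J" "h = p k"
        by (elim p_surjE imageE)
      then have kc: "k \<in> carrier FP" by (simp add: coord_kernel_def)
      have "y \<otimes>\<^bsub>FP\<^esub> k \<otimes>\<^bsub>FP\<^esub> inv\<^bsub>FP\<^esub> y \<in> coord_kernel gens J"
        using y by (intro normal.inv_op_closed2[OF nk])
      moreover have "p (y \<otimes>\<^bsub>FP\<^esub> k \<otimes>\<^bsub>FP\<^esub> inv\<^bsub>FP\<^esub> y) = x \<otimes> h \<otimes> inv x"
        using y kc by (simp add: p.hom_inv)
      ultimately show "x \<otimes> h \<otimes> inv x \<in> p ` coord_kernel gens J" by (metis imageI)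
    qed
    then show "p ` coord_kernel gens J \<in> open_normal"
      using J by (auto simp: open_normal_def)
    fix v assume "v \<in> p ` coord_kernel gens J"
    then obtain k where k: "k \<in> coord_kernel gens J" "v = p k" by blast
    then have kc: "k \<in> carrier FP" by (simp add: coord_kernel_def)
    have "u \<otimes>\<^bsub>FP\<^esub> k \<in> ?O"
    proof (rule J(3)[rule_format])
      show "u \<otimes>\<^bsub>FP\<^esub> k \<in> carrier FP" using u kc by simp
      fix i assume i: "i \<in> J"
      interpret c: group_hom FP "fst i" "\<lambda>u. u i" by (rule coordinate_hom[OF subsetD[OF J(2) i]])
      show "(u \<otimes>\<^bsub>FP\<^esub> k) i = u i" using k i u kc c.hom_closed[of u] by (simp add: coord_kernel_def)
    qed
    then show "z \<otimes> v \<notin> C" using u k kc by simp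
  qed
qed

text \<open>The pair of \<open>K\<close> and \<open>f\<close> is itself an index of the product, and
  its coordinate extends \<open>f\<close>. The kernel of this coordinate is closed, normal and
  contains the relators, hence contains the kernel of \<open>p\<close>; so the coordinate factors
  through \<open>p\<close>.\<close>

lemma universal_property_nat:
  fixes K :: "nat monoid"
  assumes K: "group K" "finite (carrier K)" and f: "\<And>a. f a \<in> carrier K"
    and rel: "\<And>w. w \<in> F_words g r s n \<Longrightarrow> ev K f w = \<one>\<^bsub>K\<^esub>"
  obtains h where "h \<in> hom \<Delta> K" "\<And>a. a \<in> gens \<Longrightarrow> h (gen a) = f a" "kernel \<Delta> K h \<in> open_normal"
proof -
  interpret p: group_hom FP \<Delta> p by (rule p_group_hom)
  define i where "i = (K, restrict f gens)"
  have i: "i \<in> finite_targets gens" using K f by (simp add: i_def finite_targets_def)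
  have fi: "fst i = K" by (simp add: i_def)
  interpret c: group_hom FP K "\<lambda>u. u i" using coordinate_hom[OF i] by (simp add: fi)
  have fgen_i: "a \<in> gens \<Longrightarrow> fgen a i = f a" for a
    using i by (simp add: fgen_def free_gen_def i_def)
  have ki: "kernel FP K (\<lambda>u. u i) = coord_kernel gens {i}"
    by (auto simp: kernel_def coord_kernel_def fi)
  have "closed_normal_closure FP (free_profinite_topology gens)
      (F_relators FP (free_gen gens) g r s n) \<subseteq> coord_kernel gens {i}"
    unfolding closed_normal_closure_def
  proof (rule Inter_lower, intro CollectI conjI)
    show "coord_kernel gens {i} \<lhd> FP" by (rule coord_kernel_normal) (use i in simp)
    have "openin (free_profinite_topology gens) (carrier FP - coord_kernel gens {i})"
      by (rule openin_free_profiniteI) (use i in \<open>auto simp: coord_kernel_def intro!: exI[of _ "{i}"]\<close>)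
    then show "closedin (free_profinite_topology gens) (coord_kernel gens {i})"
      by (auto simp: closedin_def topspace_free_profinite double_diff coord_kernel_def)
    have "ev FP fgen w \<in> coord_kernel gens {i}" if "w \<in> F_words g r s n" for w
    proof -
      have "(ev FP fgen w) i = ev K (\<lambda>a. fgen a i) w" by (rule c.hom_ev) simp
      also have "\<dots> = ev K f w"
        using snd_F_words[OF that] by (intro c.H.ev_cong) (simp add: fgen_i)
      finally show ?thesis using rel[OF that] by (simp add: coord_kernel_def fi p.ev_closed)
    qed
    then show "F_relators FP (free_gen gens) g r s n \<subseteq> coord_kernel gens {i}"
      unfolding relators_eq by blast
  qed
  then have kp: "kernel FP \<Delta> p \<subseteq> coord_kernel gens {i}" using p_kernel by simp
  have wd: "u i = v i" if uv: "u \<in> carrier FP" "v \<in> carrier FP" "p u = p v" for u v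
  proof -
    have "p (inv\<^bsub>FP\<^esub> u \<otimes>\<^bsub>FP\<^esub> v) = \<one>" using uv by (simp add: p.hom_inv)
    then have "inv\<^bsub>FP\<^esub> u \<otimes>\<^bsub>FP\<^esub> v \<in> coord_kernel gens {i}" using uv kp by (auto simp: kernel_def)
    then have "inv\<^bsub>K\<^esub> u i \<otimes>\<^bsub>K\<^esub> v i = \<one>\<^bsub>K\<^esub>"
      using uv by (simp add: coord_kernel_def fi c.hom_inv)
    then have "u i \<otimes>\<^bsub>K\<^esub> (inv\<^bsub>K\<^esub> u i \<otimes>\<^bsub>K\<^esub> v i) = u i" using uv by simp
    then show ?thesis using uv by (simp flip: c.H.m_assoc)
  qed
  define h where "h x = (SOME u. u \<in> carrier FP \<and> p u = x) i" for x
  have h: "h (p u) = u i" if "u \<in> carrier FP" for u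
  proof -
    define v where "v = (SOME v. v \<in> carrier FP \<and> p v = p u)"
    have "v \<in> carrier FP \<and> p v = p u"
      unfolding v_def using that someI[of "\<lambda>v. v \<in> carrier FP \<and> p v = p u" u] by simp
    then have "v i = u i" using that by (intro wd) simp_all
    then show ?thesis by (simp add: h_def v_def)
  qed
  have hom: "h \<in> hom \<Delta> K"
  proof (rule homI)
    fix x y assume "x \<in> carrier \<Delta>" "y \<in> carrier \<Delta>"
    then obtain u v where uv: "u \<in> carrier FP" "x = p u" "v \<in> carrier FP" "y = p v"
      by (elim p_surjE)
    show "h x \<in> carrier K" using uv by (simp add: h)
    have "h (p (u \<otimes>\<^bsub>FP\<^esub> v)) = h (p u) \<otimes>\<^bsub>K\<^esub> h (p v)" using uv by (subst (1 2 3) h) auto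
    then show "h (x \<otimes> y) = h x \<otimes>\<^bsub>K\<^esub> h y" using uv by simp
  qed
  show ?thesis
  proof
    show "h \<in> hom \<Delta> K" by (rule hom)
    show "h (gen a) = f a" if "a \<in> gens" for a using that by (simp add: gen_def h fgen_i)
    interpret h: group_hom \<Delta> K h using hom K is_group by (simp add: group_hom_def group_hom_axioms_def)
    have "p ` coord_kernel gens {i} \<subseteq> kernel \<Delta> K h"
      by (auto simp: kernel_def coord_kernel_def h fi)
    then show "kernel \<Delta> K h \<in> open_normal"
      using i h.normal_kernel unfolding open_normal_def by (intro CollectI conjI exI[of _ "{i}"]) auto
  qed
qed

lemma universal_property:
  fixes K :: "('k, 'l) monoid_scheme"
  assumes K: "group K" "finite (carrier K)" and f: "\<And>a. f a \<in> carrier K"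
    and rel: "\<And>w. w \<in> F_words g r s n \<Longrightarrow> ev K f w = \<one>\<^bsub>K\<^esub>"
  obtains h where "h \<in> hom \<Delta> K" "\<And>a. a \<in> gens \<Longrightarrow> h (gen a) = f a" "kernel \<Delta> K h \<in> open_normal"
proof -
  obtain K' :: "nat monoid" and e where K': "group K'" "finite (carrier K')" "e \<in> hom K K'"
    "e ` carrier K = carrier K'" "inj_on e (carrier K)"
    by (rule finite_group_nat_copy[OF K])
  interpret e: group_hom K K' e using K K' by (simp add: group_hom_def group_hom_axioms_def)
  have "ev K' (\<lambda>a. e (f a)) w = \<one>\<^bsub>K'\<^esub>" if "w \<in> F_words g r s n" for w
    using e.hom_ev[of f w] f rel[OF that] by simp
  then obtain h' where h': "h' \<in> hom \<Delta> K'" "\<And>a. a \<in> gens \<Longrightarrow> h' (gen a) = e (f a)"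
      "kernel \<Delta> K' h' \<in> open_normal"
    using universal_property_nat[OF K'(1,2), of "\<lambda>a. e (f a)"] f by auto
  interpret h': group_hom \<Delta> K' h' using h' K' is_group by (simp add: group_hom_def group_hom_axioms_def)
  define d where "d = inv_into (carrier K) e"
  have de: "d (e x) = x" if "x \<in> carrier K" for x using K'(5) that by (simp add: d_def)
  have ed: "e (d y) = y" "d y \<in> carrier K" if "y \<in> carrier K'" for y
    using that K'(4) by (auto simp: d_def f_inv_into_f inv_into_into)
  have dm: "d (y \<otimes>\<^bsub>K'\<^esub> y') = d y \<otimes>\<^bsub>K\<^esub> d y'" if "y \<in> carrier K'" "y' \<in> carrier K'" for y y'
    using de[of "d y \<otimes>\<^bsub>K\<^esub> d y'"] ed that by simp
  show ?thesis
  proof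
    show "(\<lambda>x. d (h' x)) \<in> hom \<Delta> K" by (rule homI) (auto simp: dm ed)
    show "d (h' (gen a)) = f a" if "a \<in> gens" for a using h'(2)[OF that] f by (simp add: de)
    have "d y = \<one>\<^bsub>K\<^esub> \<longleftrightarrow> y = \<one>\<^bsub>K'\<^esub>" if "y \<in> carrier K'" for y
      using ed[OF that] de[of "\<one>\<^bsub>K\<^esub>"] by auto
    then have "kernel \<Delta> K (\<lambda>x. d (h' x)) = kernel \<Delta> K' h'" by (auto simp: kernel_def)
    then show "kernel \<Delta> K (\<lambda>x. d (h' x)) \<in> open_normal" using h'(3) by simp
  qed
qed

end

section \<open>Crossed homomorphisms from solutions of the Fox equations\<close>

text \<open>The semidirect product of the functions on \<open>Q\<close> by \<open>Q\<close>: crossed homomorphisms are homomorphisms into it.\<close>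

definition twisted :: "('q, 'd) monoid_scheme \<Rightarrow> (('q \<Rightarrow> 'c::ab_group_add) \<times> 'q) monoid" where
  "twisted Q = \<lparr>carrier = {e. snd e \<in> carrier Q \<and> (\<forall>q. q \<notin> carrier Q \<longrightarrow> fst e q = 0)},
     monoid.mult = (\<lambda>e e'. (\<lambda>q. if q \<in> carrier Q then fst e q + fst e' (inv\<^bsub>Q\<^esub> snd e \<otimes>\<^bsub>Q\<^esub> q) else 0,
       snd e \<otimes>\<^bsub>Q\<^esub> snd e')),
     one = (\<lambda>q. 0, \<one>\<^bsub>Q\<^esub>)\<rparr>"

text \<open>Extension by zero outside the carrier, so that elements of the semidirect product with
  the same values on \<open>Q\<close> are equal.\<close>

definition trunc :: "('q, 'd) monoid_scheme \<Rightarrow> ('q \<Rightarrow> 'c::ab_group_add) \<Rightarrow> 'q \<Rightarrow> 'c" where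
  "trunc Q f = (\<lambda>q. if q \<in> carrier Q then f q else 0)"

text \<open>The kernel of reducing coefficients modulo \<open>L\<close>. Factoring it out makes the
  semidirect product finite as soon as \<open>L\<close> has finite index.\<close>

definition twisted_kernel :: "('q, 'd) monoid_scheme \<Rightarrow> 'c::ab_group_add set \<Rightarrow> (('q \<Rightarrow> 'c) \<times> 'q) set" where
  "twisted_kernel Q L = {e \<in> carrier (twisted Q). snd e = \<one>\<^bsub>Q\<^esub> \<and> (\<forall>q\<in>carrier Q. fst e q \<in> L)}"

context group
begin

lemma twisted_inverse:
  assumes "e \<in> carrier (twisted G)"
  shows "(\<lambda>q. if q \<in> carrier G then - fst e (snd e \<otimes> q) else 0, inv snd e) \<in> carrier (twisted G)"
    "(\<lambda>q. if q \<in> carrier G then - fst e (snd e \<otimes> q) else 0, inv snd e) \<otimes>\<^bsub>twisted G\<^esub> e = \<one>\<^bsub>twisted G\<^esub>"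
  using assms by (auto simp: twisted_def fun_eq_iff)

lemma group_twisted: "group (twisted G :: (('a \<Rightarrow> 'c::ab_group_add) \<times> 'a) monoid)"
proof (rule groupI)
  fix x :: "('a \<Rightarrow> 'c) \<times> 'a"
  assume "x \<in> carrier (twisted G)"
  then show "\<exists>y\<in>carrier (twisted G). y \<otimes>\<^bsub>twisted G\<^esub> x = \<one>\<^bsub>twisted G\<^esub>"
    using twisted_inverse by blast
qed (auto simp: twisted_def fun_eq_iff inv_mult_group m_assoc add.assoc)

lemma inv_twisted:
  assumes "e \<in> carrier (twisted G)"
  shows "inv\<^bsub>twisted G\<^esub> e = (\<lambda>q. if q \<in> carrier G then - fst e (snd e \<otimes> q) else 0, inv snd e)"
  by (rule group.inv_equality[OF group_twisted twisted_inverse(2)[OF assms] assms twisted_inverse(1)[OF assms]])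

lemma twisted_kernel_normal:
  fixes L :: "'c::ab_group_add set"
  assumes L: "add_subgroup L"
  shows "twisted_kernel G L \<lhd> twisted G"
proof -
  interpret W: group "twisted G :: (('a \<Rightarrow> 'c) \<times> 'a) monoid" by (rule group_twisted)
  have s: "subgroup (twisted_kernel G L) (twisted G)"
  proof (rule W.subgroupI)
    have "\<one>\<^bsub>twisted G\<^esub> \<in> twisted_kernel G L"
      using add_subgroupD(1)[OF L] by (simp add: twisted_kernel_def twisted_def)
    then show "twisted_kernel G L \<noteq> {}" by auto
    fix e assume e: "e \<in> twisted_kernel G L"
    then show "inv\<^bsub>twisted G\<^esub> e \<in> twisted_kernel G L"
      using add_subgroupD(3)[OF L] by (auto simp: twisted_kernel_def inv_twisted) (simp add: twisted_def)
    fix e' assume "e' \<in> twisted_kernel G L"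
    with e show "e \<otimes>\<^bsub>twisted G\<^esub> e' \<in> twisted_kernel G L"
      using add_subgroupD(4)[OF L] by (auto simp: twisted_kernel_def twisted_def)
  qed (auto simp: twisted_kernel_def)
  show ?thesis
  proof (rule W.normal_invI[OF s])
    fix x e :: "('a \<Rightarrow> 'c) \<times> 'a"
    assume x: "x \<in> carrier (twisted G)" and e: "e \<in> twisted_kernel G L"
    then show "x \<otimes>\<^bsub>twisted G\<^esub> e \<otimes>\<^bsub>twisted G\<^esub> inv\<^bsub>twisted G\<^esub> x \<in> twisted_kernel G L"
      unfolding inv_twisted[OF x]
      by (auto simp: twisted_kernel_def twisted_def m_assoc[symmetric])
  qed
qed

end

context marked_group
begin

text \<open>The reason for the formula of \<open>fox\<close>: it is the function component of a word
  evaluated in the semidirect product.\<close>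

lemma ev_twisted:
  "ev (twisted Q) (\<lambda>a. (trunc Q (y a), \<xi> a)) w = (trunc Q (fox Q \<xi> y w), ev Q \<xi> w)"
proof (induction w)
  case Nil
  then show ?case by (simp add: twisted_def trunc_def)
next
  case (Cons t w)
  have "(trunc Q (y (snd t)), \<xi> (snd t)) \<in> carrier (twisted Q)"
    by (simp add: twisted_def trunc_def)
  then show ?case
    by (simp add: Cons.IH inv_twisted) (auto simp: twisted_def trunc_def fun_eq_iff)
qed

end

lemma (in group) twisted_coset_eqD:
  fixes L :: "'c::ab_group_add set"
  assumes L: "add_subgroup L" and e: "(f, x) \<in> carrier (twisted G)" "(f', x) \<in> carrier (twisted G)"
    and eq: "twisted_kernel G L #>\<^bsub>twisted G\<^esub> (f, x) = twisted_kernel G L #>\<^bsub>twisted G\<^esub> (f', x)"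
    and q: "q \<in> carrier G"
  shows "f q - f' q \<in> L"
proof -
  interpret W: group "twisted G :: (('a \<Rightarrow> 'c) \<times> 'a) monoid" by (rule group_twisted)
  have "(f, x) \<in> twisted_kernel G L #>\<^bsub>twisted G\<^esub> (f', x)"
    unfolding eq[symmetric]
    by (rule W.rcos_self[OF e(1) normal_imp_subgroup[OF twisted_kernel_normal[OF L]]])
  then obtain k where "k \<in> twisted_kernel G L" "(f, x) = k \<otimes>\<^bsub>twisted G\<^esub> (f', x)"
    by (auto simp: r_coset_def)
  then show ?thesis using q by (auto simp: twisted_kernel_def twisted_def)
qed

lemma (in group) finite_twisted_quotient:
  fixes L :: "'c::ab_group_add set"
  assumes L: "add_subgroup L" and R: "finite R" "\<And>c. \<exists>r\<in>R. c - r \<in> L" and fin: "finite (carrier G)"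
  shows "finite (carrier (twisted G Mod twisted_kernel G L))"
proof -
  interpret W: group "twisted G :: (('a \<Rightarrow> 'c) \<times> 'a) monoid" by (rule group_twisted)
  note n = twisted_kernel_normal[OF L]
  let ?F = "\<lambda>e. twisted_kernel G L #>\<^bsub>twisted G\<^esub> (trunc G (fst e), snd e)"
  have "carrier (twisted G Mod twisted_kernel G L) \<subseteq> ?F ` ((carrier G \<rightarrow>\<^sub>E R) \<times> carrier G)"
  proof
    fix Z assume "Z \<in> carrier (twisted G Mod twisted_kernel G L)"
    then obtain e where e: "e \<in> carrier (twisted G)" "Z = twisted_kernel G L #>\<^bsub>twisted G\<^esub> e"
      by (auto simp: FactGroup_def RCOSETS_def)
    define \<rho> where "\<rho> c = (SOME r. r \<in> R \<and> c - r \<in> L)" for c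
    have \<rho>: "\<rho> c \<in> R" "c - \<rho> c \<in> L" for c
    proof -
      have "\<exists>r. r \<in> R \<and> c - r \<in> L" using R(2)[of c] by blast
      then have "\<rho> c \<in> R \<and> c - \<rho> c \<in> L" unfolding \<rho>_def by (rule someI_ex)
      then show "\<rho> c \<in> R" "c - \<rho> c \<in> L" by auto
    qed
    let ?f = "restrict (\<lambda>q. \<rho> (fst e q)) (carrier G)"
    have c: "(trunc G ?f, snd e) \<in> carrier (twisted G)" using e by (simp add: twisted_def trunc_def)
    let ?k = "(trunc G (\<lambda>q. fst e q - \<rho> (fst e q)), \<one>)"
    have "?k \<in> twisted_kernel G L" using \<rho>(2) by (simp add: twisted_kernel_def twisted_def trunc_def)
    moreover have "e = ?k \<otimes>\<^bsub>twisted G\<^esub> (trunc G ?f, snd e)"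
      using e(1) by (auto simp: twisted_def trunc_def prod_eq_iff fun_eq_iff)
    ultimately have "e \<in> twisted_kernel G L #>\<^bsub>twisted G\<^esub> (trunc G ?f, snd e)"
      unfolding r_coset_def by blast
    then have "Z = ?F (?f, snd e)"
      using e(2) W.repr_independence[OF _ c normal_imp_subgroup[OF n]] by simp
    moreover have "(?f, snd e) \<in> (carrier G \<rightarrow>\<^sub>E R) \<times> carrier G"
      using e(1) \<rho>(1) by (simp add: twisted_def)
    ultimately show "Z \<in> ?F ` ((carrier G \<rightarrow>\<^sub>E R) \<times> carrier G)" by blast
  qed
  moreover have "finite ((carrier G \<rightarrow>\<^sub>E R) \<times> carrier G)"
    using R fin by (intro finite_cartesian_product finite_PiE) auto
  ultimately show ?thesis using finite_surj by blast
qed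

context F_presentation
begin

lemma quotient_marked:
  assumes "U \<in> open_normal"
  shows "marked_group (\<Delta> Mod U) (\<lambda>a. U #> gen a)" "group_hom \<Delta> (\<Delta> Mod U) (\<lambda>x. U #> x)"
proof -
  note U = open_normalD[OF assms]
  have h: "(\<lambda>x. U #> x) \<in> hom \<Delta> (\<Delta> Mod U)" by (rule normal.r_coset_hom_Mod[OF U(1)])
  show g: "group_hom \<Delta> (\<Delta> Mod U) (\<lambda>x. U #> x)"
    using h is_group normal.factorgroup_is_group[OF U(1)] by (simp add: group_hom_def group_hom_axioms_def)
  show "marked_group (\<Delta> Mod U) (\<lambda>a. U #> gen a)"
    using open_normal_finite_index[OF assms] normal.factorgroup_is_group[OF U(1)] group_hom.hom_closed[OF g]
    by (simp add: marked_group_def marked_group_axioms_def)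
qed

text \<open>The Fox equations modulo \<open>L\<close> say that the relators die in the finite group
  obtained from the semidirect product by reducing coefficients. The universal property gives a
  homomorphism from \<Delta> to it, and its function component is \<open>D\<close>.\<close>

lemma cocycle_exists:
  fixes L :: "'c::ab_group_add set"
  assumes U: "U \<in> open_normal" and L: "add_subgroup L"
    and R: "finite R" "\<And>c. \<exists>r\<in>R. c - r \<in> L"
    and rel: "\<And>w q. w \<in> F_words g r s n \<Longrightarrow> q \<in> carrier (\<Delta> Mod U) \<Longrightarrow>
      fox (\<Delta> Mod U) (\<lambda>a. U #> gen a) y w q \<in> L"
  obtains D V where "cocycle_mod \<Delta> (\<Delta> Mod U) (\<lambda>x. U #> x) L D"
    "\<And>a q. a \<in> gens \<Longrightarrow> q \<in> carrier (\<Delta> Mod U) \<Longrightarrow> D (gen a) q - y a q \<in> L"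
    "V \<in> open_normal" "V \<subseteq> U" "\<And>v q. v \<in> V \<Longrightarrow> q \<in> carrier (\<Delta> Mod U) \<Longrightarrow> D v q \<in> L"
proof -
  define Q where "Q = \<Delta> Mod U"
  define \<psi> where "\<psi> = (\<lambda>x. U #> x)"
  define \<xi> where "\<xi> = (\<lambda>a. U #> gen a)"
  interpret Q: marked_group Q \<xi> using quotient_marked[OF U] by (simp add: Q_def \<xi>_def)
  interpret \<psi>: group_hom \<Delta> Q \<psi> using quotient_marked[OF U] by (simp add: Q_def \<psi>_def)
  interpret W: group "twisted Q :: (('a set \<Rightarrow> 'c) \<times> 'a set) monoid" by (rule Q.group_twisted)
  let ?N = "twisted_kernel Q L"
  let ?K = "twisted Q Mod ?N"
  define \<pi> where "\<pi> e = ?N #>\<^bsub>twisted Q\<^esub> e" for e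
  note N = Q.twisted_kernel_normal[OF L]
  have \<pi>: "group_hom (twisted Q) ?K \<pi>"
    using normal.r_coset_hom_Mod[OF N] W.is_group normal.factorgroup_is_group[OF N]
    by (simp add: group_hom_def group_hom_axioms_def \<pi>_def[abs_def])
  interpret \<pi>: group_hom "twisted Q" ?K \<pi> by (rule \<pi>)
  let ?e = "\<lambda>a. (trunc Q (y a), \<xi> a)"
  have ec: "?e a \<in> carrier (twisted Q)" for a by (simp add: twisted_def trunc_def)
  have \<pi>N: "\<pi> e = \<one>\<^bsub>?K\<^esub>" if "e \<in> ?N" for e
    using W.coset_join2[OF _ normal_imp_subgroup[OF N] that] that
    by (simp add: \<pi>_def FactGroup_def twisted_kernel_def)
  have "ev ?K (\<lambda>a. \<pi> (?e a)) w = \<one>\<^bsub>?K\<^esub>" if w: "w \<in> F_words g r s n" for w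
  proof -
    have "ev Q \<xi> w = \<psi> (ev \<Delta> gen w)"
      using \<psi>.hom_ev[of gen w] by (simp add: \<psi>_def \<xi>_def)
    then have 1: "ev Q \<xi> w = \<one>\<^bsub>Q\<^esub>" using relator_one[OF w] by simp
    have "(trunc Q (fox Q \<xi> y w), \<one>\<^bsub>Q\<^esub>) \<in> ?N"
      using rel[OF w, folded Q_def \<xi>_def] by (simp add: twisted_kernel_def twisted_def trunc_def)
    then have "\<pi> (ev (twisted Q) ?e w) = \<one>\<^bsub>?K\<^esub>"
      by (simp add: Q.ev_twisted 1 \<pi>N)
    then show ?thesis using \<pi>.hom_ev[of ?e w] ec by simp
  qed
  moreover have "finite (carrier ?K)"
    by (rule Q.finite_twisted_quotient[OF L R Q.finite_Q])
  ultimately obtain h where h: "h \<in> hom \<Delta> ?K" "\<And>a. a \<in> gens \<Longrightarrow> h (gen a) = \<pi> (?e a)"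
      "kernel \<Delta> ?K h \<in> open_normal"
    using universal_property[OF normal.factorgroup_is_group[OF N], of "\<lambda>a. \<pi> (?e a)"] ec by auto
  interpret h: group_hom \<Delta> ?K h
    using h(1) is_group normal.factorgroup_is_group[OF N] by (simp add: group_hom_def group_hom_axioms_def)
  \<comment> \<open>Intersecting with \<open>U\<close> makes \<psi> trivial on \<open>V\<close>
    before it is known that \<open>h\<close> lies over \<psi>.\<close>
  define V where "V = kernel \<Delta> ?K h \<inter> U"
  have V: "V \<in> open_normal" "V \<subseteq> U" using open_normal_Int[OF h(3) U] by (auto simp: V_def)
  have \<psi>U: "\<psi> v = \<one>\<^bsub>Q\<^esub>" if "v \<in> U" for v
    using coset_join2[OF _ open_normalD(2)[OF U] that] subgroup.mem_carrier[OF open_normalD(2)[OF U] that]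
    by (simp add: \<psi>_def Q_def FactGroup_def)
  \<comment> \<open>\<open>f\<close> witnesses that \<open>h x\<close> lies over
    \<open>\<psi> x\<close>. The elements with a witness form a subgroup containing \<open>V\<close>
    and the generators, hence all of \<Delta>; \<open>D x\<close> is then a chosen witness.\<close>
  let ?P = "\<lambda>x f. (f, \<psi> x) \<in> carrier (twisted Q) \<and> h x = \<pi> (f, \<psi> x)"
  let ?S = "{x \<in> carrier \<Delta>. \<exists>f. ?P x f}"
  have one: "(\<lambda>q. 0, \<one>\<^bsub>Q\<^esub>) = \<one>\<^bsub>twisted Q\<^esub>" by (simp add: twisted_def)
  have "subgroup ?S \<Delta>"
  proof (rule subgroupI)
    have "\<one> \<in> ?S"
      by (simp, rule exI[of _ "\<lambda>q. 0"]) (simp add: one)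
    then show "?S \<noteq> {}" by blast
    fix x assume "x \<in> ?S"
    then obtain f where x: "x \<in> carrier \<Delta>" "?P x f" by blast
    have "inv\<^bsub>twisted Q\<^esub> (f, \<psi> x) = (fst (inv\<^bsub>twisted Q\<^esub> (f, \<psi> x)), \<psi> (inv x))"
      using x by (simp add: Q.inv_twisted)
    then have "?P (inv x) (fst (inv\<^bsub>twisted Q\<^esub> (f, \<psi> x)))"
      using x \<pi>.hom_inv[of "(f, \<psi> x)"] W.inv_closed[of "(f, \<psi> x)"] by simp
    then show "inv x \<in> ?S" using x by blast
    fix x' assume "x' \<in> ?S"
    then obtain f' where x': "x' \<in> carrier \<Delta>" "?P x' f'" by blast
    let ?m = "(f, \<psi> x) \<otimes>\<^bsub>twisted Q\<^esub> (f', \<psi> x')"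
    have "?m = (fst ?m, \<psi> (x \<otimes> x'))"
      using x x' by (simp add: twisted_def)
    then have "?P (x \<otimes> x') (fst ?m)"
      using x x' \<pi>.hom_mult[of "(f, \<psi> x)" "(f', \<psi> x')"] W.m_closed[of "(f, \<psi> x)" "(f', \<psi> x')"] by simp
    then show "x \<otimes> x' \<in> ?S" using x x' by blast
  qed blast
  moreover have "V \<subseteq> ?S"
  proof
    fix v assume v: "v \<in> V"
    then have "v \<in> carrier \<Delta>" "h v = \<one>\<^bsub>?K\<^esub>" "\<psi> v = \<one>\<^bsub>Q\<^esub>" using \<psi>U by (auto simp: V_def kernel_def)
    then have "?P v (\<lambda>q. 0)" using \<pi>.hom_one by (simp add: one)
    then show "v \<in> ?S" using \<open>v \<in> carrier \<Delta>\<close> by blast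
  qed
  moreover have "gen a \<in> ?S" if "a \<in> gens" for a
  proof -
    have "?P (gen a) (trunc Q (y a))" using h(2)[OF that] ec[of a] by (simp add: \<psi>_def \<xi>_def)
    then show ?thesis by auto
  qed
  ultimately have "?S = carrier \<Delta>" by (rule generated_by_gens[OF V(1)])
  then have ex: "\<exists>f. ?P x f" if "x \<in> carrier \<Delta>" for x using that by blast
  define D where "D x = (SOME f. ?P x f)" for x
  have D: "(D x, \<psi> x) \<in> carrier (twisted Q)" "h x = \<pi> (D x, \<psi> x)" if "x \<in> carrier \<Delta>" for x
    using someI_ex[OF ex[OF that]] by (auto simp: D_def)
  show ?thesis
  proof
    show "cocycle_mod \<Delta> (\<Delta> Mod U) (\<lambda>x. U #> x) L D"
      unfolding cocycle_mod_def Q_def[symmetric] \<psi>_def[symmetric]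
    proof (intro ballI)
      fix x x' q assume x: "x \<in> carrier \<Delta>" "x' \<in> carrier \<Delta>" and q: "q \<in> carrier Q"
      let ?m = "(D x, \<psi> x) \<otimes>\<^bsub>twisted Q\<^esub> (D x', \<psi> x')"
      have m: "?m = (fst ?m, \<psi> (x \<otimes> x'))" using x by (simp add: twisted_def)
      have mc: "?m \<in> carrier (twisted Q)" using D x by (intro W.m_closed)
      have "\<pi> (D (x \<otimes> x'), \<psi> (x \<otimes> x')) = \<pi> ?m"
        using D x \<pi>.hom_mult h.hom_mult m_closed by metis
      then have eq: "\<pi> (D (x \<otimes> x'), \<psi> (x \<otimes> x')) = \<pi> (fst ?m, \<psi> (x \<otimes> x'))"
        by (simp only: m[symmetric])
      have "(fst ?m, \<psi> (x \<otimes> x')) \<in> carrier (twisted Q)" using mc by (simp only: m[symmetric])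
      then have "D (x \<otimes> x') q - fst ?m q \<in> L"
        by (rule Q.twisted_coset_eqD[OF L D(1)[OF m_closed[OF x]] _ eq[unfolded \<pi>_def] q])
      then show "D (x \<otimes> x') q - D x q - D x' (inv\<^bsub>Q\<^esub> \<psi> x \<otimes>\<^bsub>Q\<^esub> q) \<in> L"
        using q by (simp add: twisted_def diff_diff_eq)
    qed
    show "D (gen a) q - y a q \<in> L" if "a \<in> gens" "q \<in> carrier (\<Delta> Mod U)" for a q
    proof -
      have "D (gen a) q - trunc Q (y a) q \<in> L"
      proof (rule Q.twisted_coset_eqD[OF L, where x = "\<psi> (gen a)"])
        show "(D (gen a), \<psi> (gen a)) \<in> carrier (twisted Q)" by (rule D) simp
        show "(trunc Q (y a), \<psi> (gen a)) \<in> carrier (twisted Q)" using ec[of a] by (simp add: \<psi>_def \<xi>_def)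
        show "?N #>\<^bsub>twisted Q\<^esub> (D (gen a), \<psi> (gen a)) = ?N #>\<^bsub>twisted Q\<^esub> (trunc Q (y a), \<psi> (gen a))"
          using D(2)[of "gen a"] h(2)[OF that(1)] by (simp add: \<pi>_def \<psi>_def \<xi>_def)
      qed (use that in \<open>simp add: Q_def\<close>)
      then show ?thesis using that by (simp add: trunc_def Q_def)
    qed
    show "V \<in> open_normal" "V \<subseteq> U" using V by auto
    show "D v q \<in> L" if "v \<in> V" "q \<in> carrier (\<Delta> Mod U)" for v q
    proof -
      have v: "v \<in> carrier \<Delta>" "h v = \<one>\<^bsub>?K\<^esub>" "\<psi> v = \<one>\<^bsub>Q\<^esub>" using that \<psi>U by (auto simp: V_def kernel_def)
      have "D v q - (\<lambda>q. 0) q \<in> L"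
      proof (rule Q.twisted_coset_eqD[OF L, where x = "\<one>\<^bsub>Q\<^esub>"])
        show "(D v, \<one>\<^bsub>Q\<^esub>) \<in> carrier (twisted Q)" using D(1)[OF v(1)] v(3) by simp
        show "(\<lambda>q. 0::'c, \<one>\<^bsub>Q\<^esub>) \<in> carrier (twisted Q)" by (simp add: one)
        show "?N #>\<^bsub>twisted Q\<^esub> (D v, \<one>\<^bsub>Q\<^esub>) = ?N #>\<^bsub>twisted Q\<^esub> (\<lambda>q. 0::'c, \<one>\<^bsub>Q\<^esub>)"
          using D(2)[OF v(1)] v \<pi>.hom_one by (simp add: \<pi>_def one)
      qed (use that in \<open>simp add: Q_def\<close>)
      then show ?thesis by simp
    qed
  qed
qed

end

section \<open>The values of the surface relator\<close>

context marked_group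
begin

lemma sum_translate:
  assumes "h \<in> carrier Q"
  shows "(\<Sum>q\<in>carrier Q. f (h \<otimes> q)) = (\<Sum>q\<in>carrier Q. f q)"
  by (rule sum.reindex_bij_witness[of _ "\<lambda>q. inv h \<otimes> q" "\<lambda>q. h \<otimes> q"])
    (use assms in \<open>auto simp: m_assoc[symmetric]\<close>)

text \<open>Summing over \<open>Q\<close> makes translations invisible, so every letter contributes
  the total of its value, with a sign. Commutators therefore contribute nothing.\<close>

lemma sum_fox:
  "(\<Sum>q\<in>carrier Q. fox Q \<xi> y w q)
    = sum_list (map (\<lambda>t. if fst t then \<Sum>q\<in>carrier Q. y (snd t) q else - (\<Sum>q\<in>carrier Q. y (snd t) q)) w)"
proof (induction w)
  case (Cons t w)
  show ?case
    using Cons.IH sum_translate[of "\<xi> (snd t)" "\<lambda>q. y (snd t) q"]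
      sum_translate[of "\<xi> (snd t)" "fox Q \<xi> y w"] sum_translate[of "inv \<xi> (snd t)" "fox Q \<xi> y w"]
    by (auto simp: sum.distrib sum_negf sum_subtractf)
qed simp

text \<open>When \<open>y\<close> is supported on one letter, only the block containing that letter
  contributes, and the prefix before it acts by translation.\<close>

lemma fox_single_gen:
  assumes "a \<notin> snd ` set u" "a \<notin> snd ` set v" "\<And>b q. b \<noteq> a \<Longrightarrow> y b q = 0" "q \<in> carrier Q"
  shows "fox Q \<xi> y (u @ w @ v) q = fox Q \<xi> y w (inv ev Q \<xi> u \<otimes> q)"
proof -
  have z: "fox Q \<xi> y x q' = 0" if "a \<notin> snd ` set x" "q' \<in> carrier Q" for x q'
    using that by (intro fox_zero assms(3)) auto
  show ?thesis using assms z by (simp add: fox_append)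
qed

end

locale F_marked = marked_group Q \<xi> for Q :: "('q, 'd) monoid_scheme" (structure) and \<xi> :: "F_gen \<Rightarrow> 'q" +
  fixes g r s :: nat
  assumes generated: "\<And>S. subgroup S Q \<Longrightarrow> \<xi> ` F_gens g r s \<subseteq> S \<Longrightarrow> S = carrier Q"
begin

text \<open>The condition on \<open>y \<delta>\<^sub>l\<close> makes \<open>fox\<close> vanish on the torsion relators \<open>\<delta>\<^sub>l\<^bsup>n\<^sub>l\<^esup>\<close>.\<close>

definition good :: "'c::ab_group_add set \<Rightarrow> (F_gen \<Rightarrow> 'q \<Rightarrow> 'c) \<Rightarrow> bool" where
  "good L y \<longleftrightarrow> (\<forall>a. \<forall>q\<in>carrier Q. y a q \<in> L) \<and>
    (\<forall>l<s. \<exists>f. \<forall>q\<in>carrier Q. y (Gen_delta l) q = f q - f (inv \<xi> (Gen_delta l) \<otimes> q))"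

text \<open>These are the values by which the derivative of the surface relator can be corrected
  without disturbing the torsion relators.\<close>

definition attained :: "'c::ab_group_add set \<Rightarrow> ('q \<Rightarrow> 'c) \<Rightarrow> bool" where
  "attained L u \<longleftrightarrow> (\<exists>y. good L y \<and> (\<forall>q\<in>carrier Q. fox Q \<xi> y (prod_word g r s) q = u q))"

lemma attainedI:
  "good L y \<Longrightarrow> (\<And>q. q \<in> carrier Q \<Longrightarrow> fox Q \<xi> y (prod_word g r s) q = u q) \<Longrightarrow> attained L u"
  unfolding attained_def by blast

lemma attained_zero:
  assumes "add_subgroup L" shows "attained L (\<lambda>q. 0)"
  by (rule attainedI[of _ "\<lambda>a q. 0"])
    (auto simp: good_def add_subgroupD(1)[OF assms] fox_zero intro!: exI[of _ "\<lambda>q. 0"])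

lemma attained_diff:
  assumes L: "add_subgroup L" and "attained L u" "attained L u'"
  shows "attained L (\<lambda>q. u q - u' q)"
proof -
  obtain y y' where y: "good L y" "\<And>q. q \<in> carrier Q \<Longrightarrow> fox Q \<xi> y (prod_word g r s) q = u q"
    "good L y'" "\<And>q. q \<in> carrier Q \<Longrightarrow> fox Q \<xi> y' (prod_word g r s) q = u' q"
    using assms(2,3) unfolding attained_def by metis
  have "good L (\<lambda>a q. y a q - y' a q)"
    unfolding good_def
  proof (intro conjI allI ballI impI)
    show "y a q - y' a q \<in> L" if "q \<in> carrier Q" for a q
      using y(1,3) that add_subgroupD(2)[OF L] by (auto simp: good_def)
    fix l assume "l < s"
    then obtain f f' where
      "\<forall>q\<in>carrier Q. y (Gen_delta l) q = f q - f (inv \<xi> (Gen_delta l) \<otimes> q)"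
      "\<forall>q\<in>carrier Q. y' (Gen_delta l) q = f' q - f' (inv \<xi> (Gen_delta l) \<otimes> q)"
      using y(1,3) unfolding good_def by metis
    then show "\<exists>f. \<forall>q\<in>carrier Q. y (Gen_delta l) q - y' (Gen_delta l) q = f q - f (inv \<xi> (Gen_delta l) \<otimes> q)"
      by (intro exI[of _ "\<lambda>q. f q - f' q"]) simp
  qed
  then show ?thesis using y(2,4) by (intro attainedI) (auto simp: fox_diff)
qed

lemma attained_cong:
  "attained L u \<Longrightarrow> (\<And>q. q \<in> carrier Q \<Longrightarrow> u q = u' q) \<Longrightarrow> attained L u'"
  unfolding attained_def by metis

lemma attained_minus:
  assumes L: "add_subgroup L" and "attained L u"
  shows "attained L (\<lambda>q. - u q)"
  using attained_diff[OF L attained_zero[OF L] assms(2)] by simp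

lemma attained_add:
  assumes L: "add_subgroup L" and "attained L u" "attained L u'"
  shows "attained L (\<lambda>q. u q + u' q)"
  using attained_diff[OF L assms(2) attained_minus[OF L assms(3)]] by simp

lemma attained_sum:
  assumes L: "add_subgroup L" and "\<And>i. i \<in> I \<Longrightarrow> attained L (u i)"
  shows "attained L (\<lambda>q. \<Sum>i\<in>I. u i q)"
  using assms(2)
  by (induction I rule: infinite_finite_induct) (auto intro: attained_zero[OF L] attained_add[OF L])

text \<open>The translators form a subgroup, so it suffices to find the generators among them.\<close>

definition translators :: "'c::ab_group_add set \<Rightarrow> 'q set" where
  "translators L = {h \<in> carrier Q. \<forall>f. (\<forall>q\<in>carrier Q. f q \<in> L) \<longrightarrow> attained L (\<lambda>q. f q - f (inv h \<otimes> q))}"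

lemma translatorsD:
  "h \<in> translators L \<Longrightarrow> (\<And>q. q \<in> carrier Q \<Longrightarrow> f q \<in> L) \<Longrightarrow> attained L (\<lambda>q. f q - f (inv h \<otimes> q))"
  by (simp add: translators_def)

lemma subgroup_translators:
  assumes L: "add_subgroup L"
  shows "subgroup (translators L) Q"
proof (rule subgroupI)
  have "\<one> \<in> translators L"
    using attained_zero[OF L] by (auto simp: translators_def elim: attained_cong)
  then show "translators L \<noteq> {}" by blast
  fix h assume h: "h \<in> translators L"
  then have hc: "h \<in> carrier Q" by (simp add: translators_def)
  show "inv h \<in> translators L"
    unfolding translators_def
  proof (intro CollectI conjI allI impI)
    fix f assume f: "\<forall>q\<in>carrier Q. f q \<in> L"
    have "attained L (\<lambda>q. f (h \<otimes> q) - f (h \<otimes> (inv h \<otimes> q)))"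
      using f hc by (intro translatorsD[OF h, of "\<lambda>q. f (h \<otimes> q)"]) simp
    from attained_minus[OF L this] show "attained L (\<lambda>q. f q - f (inv (inv h) \<otimes> q))"
      by (rule attained_cong) (use hc in \<open>simp add: m_assoc[symmetric]\<close>)
  qed (use hc in simp)
  fix k assume k: "k \<in> translators L"
  then have kc: "k \<in> carrier Q" by (simp add: translators_def)
  show "h \<otimes> k \<in> translators L"
    unfolding translators_def
  proof (intro CollectI conjI allI impI)
    fix f assume f: "\<forall>q\<in>carrier Q. f q \<in> L"
    have 1: "attained L (\<lambda>q. f (inv k \<otimes> q) - f (inv k \<otimes> (inv h \<otimes> q)))"
      using f kc by (intro translatorsD[OF h, of "\<lambda>q. f (inv k \<otimes> q)"]) simp
    have 2: "attained L (\<lambda>q. f q - f (inv k \<otimes> q))"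
      using f by (intro translatorsD[OF k]) simp
    from attained_add[OF L 2 1] show "attained L (\<lambda>q. f q - f (inv (h \<otimes> k) \<otimes> q))"
      by (rule attained_cong) (use hc kc in \<open>simp add: inv_mult_assoc\<close>)
  qed (use hc kc in simp)
qed (auto simp: translators_def)

lemma upt_split: "i < k \<Longrightarrow> [0..<k] = [0..<i] @ [i] @ [Suc i..<k]"
  using upt_add_eq_append[of 0 i "k - i"] upt_conv_Cons[of i k] by simp

lemma prod_word_split_comm:
  assumes "i < g"
  shows "\<exists>v. prod_word g r s = concat (map comm_word [0..<i]) @ comm_word i @ v
    \<and> Gen_alpha i \<notin> snd ` set v \<and> Gen_beta i \<notin> snd ` set v"
  unfolding prod_word_def upt_split[OF assms] by (auto simp: comm_word_def)

lemma prod_word_split_delta: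
  assumes "l < s"
  shows "\<exists>u v. prod_word g r s = u @ [(True, Gen_delta l)] @ v \<and> Gen_delta l \<notin> snd ` set u
    \<and> Gen_delta l \<notin> snd ` set v \<and> u = concat (map comm_word [0..<g]) @ map (\<lambda>j. (True, Gen_gamma j)) [0..<r]
     @ map (\<lambda>l. (True, Gen_delta l)) [0..<l]"
  unfolding prod_word_def upt_split[OF assms] by (auto simp: comm_word_def)

lemma prod_word_split_gamma:
  assumes "j < r"
  shows "\<exists>u v. prod_word g r s = u @ [(True, Gen_gamma j)] @ v \<and> Gen_gamma j \<notin> snd ` set u
    \<and> Gen_gamma j \<notin> snd ` set v"
  unfolding prod_word_def upt_split[OF assms]
  by (rule exI[of _ "concat (map comm_word [0..<g]) @ map (\<lambda>j. (True, Gen_gamma j)) [0..<j]"])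
    (auto simp: comm_word_def)

text \<open>For a commutator of a and b the Fox derivatives are 1 - aba^(-1) with respect to a and a
  - aba^(-1)b^(-1) with respect to b. Values supported on one letter thus realise differences for
  aba^(-1) and, after absorbing a into the function, for aba^(-1)b^(-1)a^(-1), both conjugated by
  the prefix \<open>P\<close>. As \<open>P\<close> is a translator it can be removed, and the two
  elements generate a and b.\<close>

lemma translators_comm:
  fixes L :: "'c::ab_group_add set"
  assumes L: "add_subgroup L" and i: "i < g"
    and P: "ev Q \<xi> (concat (map comm_word [0..<i])) \<in> translators L"
  shows "\<xi> (Gen_alpha i) \<in> translators L" "\<xi> (Gen_beta i) \<in> translators L"
proof -
  define pre where "pre = concat (map comm_word [0..<i])"
  define P where "P = ev Q \<xi> pre"
  define a where "a = \<xi> (Gen_alpha i)"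
  define b where "b = \<xi> (Gen_beta i)"
  have c: "P \<in> carrier Q" "a \<in> carrier Q" "b \<in> carrier Q" by (auto simp: P_def a_def b_def)
  note sg = subgroup_translators[OF L]
  obtain v where v: "prod_word g r s = pre @ comm_word i @ v"
    "Gen_alpha i \<notin> snd ` set v" "Gen_beta i \<notin> snd ` set v"
    using prod_word_split_comm[OF i] by (auto simp: pre_def)
  have pre: "Gen_alpha i \<notin> snd ` set pre" "Gen_beta i \<notin> snd ` set pre"
    by (auto simp: pre_def comm_word_def)
  have good: "good L (\<lambda>x q. if x = z then f q else 0)"
    if "z = Gen_alpha i \<or> z = Gen_beta i" "\<forall>q\<in>carrier Q. f q \<in> L" for z and f :: "'q \<Rightarrow> 'c"
    using that add_subgroupD(1)[OF L] by (auto simp: good_def intro!: exI[of _ "\<lambda>q. 0"])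
  have 1: "P \<otimes> a \<otimes> b \<otimes> inv a \<otimes> inv P \<in> translators L"
    unfolding translators_def
  proof (intro CollectI conjI allI impI)
    fix f :: "'q \<Rightarrow> 'c" assume f: "\<forall>q\<in>carrier Q. f q \<in> L"
    let ?y = "\<lambda>x q. if x = Gen_alpha i then f (P \<otimes> q) else 0"
    show "attained L (\<lambda>q. f q - f (inv (P \<otimes> a \<otimes> b \<otimes> inv a \<otimes> inv P) \<otimes> q))"
    proof (rule attainedI[of L ?y])
      show "good L ?y" using f c by (intro good) auto
      fix q assume q: "q \<in> carrier Q"
      have "fox Q \<xi> ?y (prod_word g r s) q = fox Q \<xi> ?y (comm_word i) (inv P \<otimes> q)"
        unfolding v(1) P_def using pre v(2) q by (intro fox_single_gen) auto
      also have "\<dots> = f q - f (inv (P \<otimes> a \<otimes> b \<otimes> inv a \<otimes> inv P) \<otimes> q)"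
        using c q by (simp add: comm_word_def a_def[symmetric] b_def[symmetric] inv_mult_group m_assoc
            r_cancel_one[symmetric] flip: m_assoc[of P "inv P"])
      finally show "fox Q \<xi> ?y (prod_word g r s) q = f q - f (inv (P \<otimes> a \<otimes> b \<otimes> inv a \<otimes> inv P) \<otimes> q)" .
    qed
  qed (use c in simp)
  have 2: "P \<otimes> a \<otimes> b \<otimes> inv a \<otimes> inv b \<otimes> inv a \<otimes> inv P \<in> translators L"
    unfolding translators_def
  proof (intro CollectI conjI allI impI)
    fix f :: "'q \<Rightarrow> 'c" assume f: "\<forall>q\<in>carrier Q. f q \<in> L"
    let ?y = "\<lambda>x q. if x = Gen_beta i then f (P \<otimes> a \<otimes> q) else 0"
    show "attained L (\<lambda>q. f q - f (inv (P \<otimes> a \<otimes> b \<otimes> inv a \<otimes> inv b \<otimes> inv a \<otimes> inv P) \<otimes> q))"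
    proof (rule attainedI[of L ?y])
      show "good L ?y" using f c by (intro good) auto
      fix q assume q: "q \<in> carrier Q"
      have "fox Q \<xi> ?y (prod_word g r s) q = fox Q \<xi> ?y (comm_word i) (inv P \<otimes> q)"
        unfolding v(1) P_def using pre v(3) q by (intro fox_single_gen) auto
      also have "\<dots> = f (P \<otimes> (a \<otimes> (inv a \<otimes> (inv P \<otimes> q))))
          - f (inv (P \<otimes> a \<otimes> b \<otimes> inv a \<otimes> inv b \<otimes> inv a \<otimes> inv P) \<otimes> q)"
        using c q by (simp add: comm_word_def a_def[symmetric] b_def[symmetric] inv_mult_group m_assoc)
      also have "P \<otimes> (a \<otimes> (inv a \<otimes> (inv P \<otimes> q))) = q"
        using c q by (simp flip: m_assoc)
      finally show "fox Q \<xi> ?y (prod_word g r s) q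
          = f q - f (inv (P \<otimes> a \<otimes> b \<otimes> inv a \<otimes> inv b \<otimes> inv a \<otimes> inv P) \<otimes> q)" .
    qed
  qed (use c in simp)
  have PT: "P \<in> translators L" using P by (simp add: P_def pre_def)
  have 3: "inv P \<otimes> x \<otimes> P \<in> translators L" if "x \<in> translators L" for x
    using PT that by (intro subgroup.m_closed[OF sg] subgroup.m_inv_closed[OF sg])
  have A: "a \<otimes> b \<otimes> inv a \<in> translators L"
    using 3[OF 1] c by (simp add: m_assoc) (simp flip: m_assoc)
  have B: "a \<otimes> b \<otimes> inv a \<otimes> inv b \<otimes> inv a \<in> translators L"
    using 3[OF 2] c by (simp add: m_assoc) (simp flip: m_assoc)
  have "inv (inv (a \<otimes> b \<otimes> inv a) \<otimes> (a \<otimes> b \<otimes> inv a \<otimes> inv b \<otimes> inv a)) \<in> translators L"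
    by (intro subgroup.m_closed[OF sg] subgroup.m_inv_closed[OF sg] A B)
  also have "inv (inv (a \<otimes> b \<otimes> inv a) \<otimes> (a \<otimes> b \<otimes> inv a \<otimes> inv b \<otimes> inv a)) = a \<otimes> b"
    using c by (simp add: inv_mult_group m_assoc; (simp flip: m_assoc)?)
  finally have ab: "a \<otimes> b \<in> translators L" .
  have "inv (a \<otimes> b \<otimes> inv a) \<otimes> (a \<otimes> b) \<in> translators L"
    by (intro subgroup.m_closed[OF sg] subgroup.m_inv_closed[OF sg] A ab)
  also have "inv (a \<otimes> b \<otimes> inv a) \<otimes> (a \<otimes> b) = a"
    using c by (simp add: inv_mult_group m_assoc; (simp flip: m_assoc)?)
  finally show aT: "\<xi> (Gen_alpha i) \<in> translators L" by (simp add: a_def)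
  have "inv a \<otimes> (a \<otimes> b) \<in> translators L"
    using aT by (intro subgroup.m_closed[OF sg] subgroup.m_inv_closed[OF sg] ab) (simp add: a_def)
  then show "\<xi> (Gen_beta i) \<in> translators L" using c by (simp add: b_def flip: m_assoc)
qed

text \<open>A good value at an elliptic generator d is already a difference with respect to d. The
  prefix \<open>P\<close> turns it into a difference with respect to the conjugate of d by
  \<open>P\<close>, and \<open>P\<close> is itself a translator.\<close>

lemma translators_delta:
  fixes L :: "'c::ab_group_add set"
  assumes L: "add_subgroup L" and l: "l < s" and r: "r = 0"
    and P: "ev Q \<xi> (concat (map comm_word [0..<g]) @ map (\<lambda>l. (True, Gen_delta l)) [0..<l]) \<in> translators L"
  shows "\<xi> (Gen_delta l) \<in> translators L"
proof -
  define d where "d = \<xi> (Gen_delta l)"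
  obtain u v where uv: "prod_word g r s = u @ [(True, Gen_delta l)] @ v"
    "Gen_delta l \<notin> snd ` set u" "Gen_delta l \<notin> snd ` set v"
    "u = concat (map comm_word [0..<g]) @ map (\<lambda>l. (True, Gen_delta l)) [0..<l]"
    using prod_word_split_delta[OF l] r by auto
  define P where "P = ev Q \<xi> u"
  have c: "P \<in> carrier Q" "d \<in> carrier Q" by (auto simp: P_def d_def)
  note sg = subgroup_translators[OF L]
  have 1: "P \<otimes> d \<otimes> inv P \<in> translators L"
    unfolding translators_def
  proof (intro CollectI conjI allI impI)
    fix f :: "'q \<Rightarrow> 'c" assume f: "\<forall>q\<in>carrier Q. f q \<in> L"
    let ?y = "\<lambda>x q. if x = Gen_delta l then f (P \<otimes> q) - f (P \<otimes> (inv d \<otimes> q)) else 0"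
    show "attained L (\<lambda>q. f q - f (inv (P \<otimes> d \<otimes> inv P) \<otimes> q))"
    proof (rule attainedI[of L ?y])
      have "\<exists>f'. \<forall>q\<in>carrier Q. ?y (Gen_delta l') q = f' q - f' (inv \<xi> (Gen_delta l') \<otimes> q)" for l'
        by (cases "l' = l") (auto simp: d_def intro: exI[of _ "\<lambda>q. f (P \<otimes> q)"] exI[of _ "\<lambda>q. 0"])
      then show "good L ?y"
        using f c add_subgroupD(1,2)[OF L] by (auto simp: good_def)
      fix q assume q: "q \<in> carrier Q"
      have "fox Q \<xi> ?y (prod_word g r s) q = fox Q \<xi> ?y [(True, Gen_delta l)] (inv P \<otimes> q)"
        unfolding uv(1) P_def using uv(2,3) q by (intro fox_single_gen) auto
      also have "\<dots> = f (P \<otimes> (inv P \<otimes> q)) - f (P \<otimes> (inv d \<otimes> (inv P \<otimes> q)))" by simp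
      also have "P \<otimes> (inv P \<otimes> q) = q" using c q by (simp flip: m_assoc)
      also have "P \<otimes> (inv d \<otimes> (inv P \<otimes> q)) = inv (P \<otimes> d \<otimes> inv P) \<otimes> q"
        using c q by (simp add: inv_mult_group m_assoc)
      finally show "fox Q \<xi> ?y (prod_word g r s) q = f q - f (inv (P \<otimes> d \<otimes> inv P) \<otimes> q)" .
    qed
  qed (use c in simp)
  have "P \<in> translators L" using P by (simp add: P_def uv(4))
  then have "inv P \<otimes> (P \<otimes> d \<otimes> inv P) \<otimes> P \<in> translators L"
    by (intro subgroup.m_closed[OF sg] subgroup.m_inv_closed[OF sg] 1)
  also have "inv P \<otimes> (P \<otimes> d \<otimes> inv P) \<otimes> P = d"
    using c by (simp add: m_assoc) (simp flip: m_assoc)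
  finally show ?thesis by (simp add: d_def)
qed

text \<open>Strong induction along the surface relator works because the prefix before a letter only
  involves earlier generators.\<close>

lemma translators_all:
  fixes L :: "'c::ab_group_add set"
  assumes L: "add_subgroup L" and r: "r = 0"
  shows "translators L = carrier Q"
proof (rule generated[OF subgroup_translators[OF L]])
  note sg = subgroup_translators[OF L]
  have ab: "\<xi> (Gen_alpha i) \<in> translators L \<and> \<xi> (Gen_beta i) \<in> translators L" if "i < g" for i
    using that
  proof (induction i rule: less_induct)
    case (less i)
    have "ev Q \<xi> (concat (map comm_word [0..<i])) \<in> translators L"
      using less.IH less.prems by (intro subgroup_ev[OF sg]) (auto simp: comm_word_def)
    then show ?case using translators_comm[OF L less.prems] by blast
  qed
  have d: "\<xi> (Gen_delta l) \<in> translators L" if "l < s" for l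
    using that
  proof (induction l rule: less_induct)
    case (less l)
    have "ev Q \<xi> (concat (map comm_word [0..<g]) @ map (\<lambda>l. (True, Gen_delta l)) [0..<l]) \<in> translators L"
      using less.IH less.prems ab by (intro subgroup_ev[OF sg]) (auto simp: comm_word_def)
    then show ?case using translators_delta[OF L less.prems r] by blast
  qed
  show "\<xi> ` F_gens g r s \<subseteq> translators L" using ab d r by (auto simp: F_gens_def)
qed

text \<open>With a puncture, its generator occurs exactly once in the surface relator and in no
  torsion relator, so its value can be prescribed. Otherwise a function of sum zero is a combination
  of differences of point masses, and all elements of \<open>Q\<close> are translators.\<close>

lemma attained_sum_zero:
  fixes L :: "'c::ab_group_add set"
  assumes L: "add_subgroup L" and u: "\<And>q. q \<in> carrier Q \<Longrightarrow> u q \<in> L"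
    and r: "r > 0 \<or> (\<Sum>q\<in>carrier Q. u q) = 0"
  shows "attained L u"
proof (cases "r > 0")
  case True
  obtain w v where uv: "prod_word g r s = w @ [(True, Gen_gamma 0)] @ v"
    "Gen_gamma 0 \<notin> snd ` set w" "Gen_gamma 0 \<notin> snd ` set v"
    using prod_word_split_gamma[OF True] by auto
  define P where "P = ev Q \<xi> w"
  have c: "P \<in> carrier Q" by (auto simp: P_def)
  let ?y = "\<lambda>x q. if x = Gen_gamma 0 then u (P \<otimes> q) else 0"
  show ?thesis
  proof (rule attainedI[of L ?y])
    show "good L ?y" using u c add_subgroupD(1)[OF L]
      by (auto simp: good_def intro!: exI[of _ "\<lambda>q. 0"])
    fix q assume q: "q \<in> carrier Q"
    have "fox Q \<xi> ?y (prod_word g r s) q = fox Q \<xi> ?y [(True, Gen_gamma 0)] (inv P \<otimes> q)"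
      unfolding uv(1) P_def using uv(2,3) q by (intro fox_single_gen) auto
    then show "fox Q \<xi> ?y (prod_word g r s) q = u q" using c q by (simp flip: m_assoc)
  qed
next
  case False
  \<comment> \<open>\<open>u x\<close> placed at the identity; its translate by \<open>x\<close> is
    \<open>u x\<close> placed at \<open>x\<close>. Summing the differences over \<open>x\<close>,
    the masses at the identity cancel because \<open>u\<close> has sum zero, and what remains is
    \<open>- u\<close>.\<close>
  let ?f = "\<lambda>x q. if q = \<one> then u x else 0"
  have "attained L (\<lambda>q. \<Sum>x\<in>carrier Q. ?f x q - ?f x (inv x \<otimes> q))"
  proof (rule attained_sum[OF L])
    fix x assume x: "x \<in> carrier Q"
    then have "x \<in> translators L" using translators_all[OF L] False by simp
    then show "attained L (\<lambda>q. ?f x q - ?f x (inv x \<otimes> q))"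
      by (rule translatorsD) (use u x add_subgroupD(1)[OF L] in auto)
  qed
  from attained_minus[OF L this] show ?thesis
  proof (rule attained_cong)
    fix q assume q: "q \<in> carrier Q"
    have 1: "(\<Sum>x\<in>carrier Q. ?f x q) = 0" using r False by (cases "q = \<one>") auto
    have "inv x \<otimes> q = \<one> \<longleftrightarrow> x = q" if "x \<in> carrier Q" for x
      using that q by (metis inv_equality inv_inv inv_closed l_inv)
    then have "(\<Sum>x\<in>carrier Q. ?f x (inv x \<otimes> q)) = (\<Sum>x\<in>carrier Q. if x = q then u x else 0)"
      by (intro sum.cong) auto
    also have "\<dots> = u q" using q finite_Q by simp
    finally show "- (\<Sum>x\<in>carrier Q. ?f x q - ?f x (inv x \<otimes> q)) = u q"
      using 1 by (simp add: sum_subtractf)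
  qed
qed

end

section \<open>Norms along the elliptic generators and lifting of solutions\<close>

context marked_group
begin

lemma inv_pow_Suc:
  assumes "d \<in> carrier Q" "q \<in> carrier Q"
  shows "inv (d [^] Suc i) \<otimes> q = inv d \<otimes> (inv (d [^] i) \<otimes> q)"
  using assms by (simp add: inv_mult_assoc)

text \<open>The norm of a difference telescopes. This is why good values satisfy the torsion
  relators.\<close>

lemma fox_replicate_difference:
  assumes "\<And>q. q \<in> carrier Q \<Longrightarrow> y a q = f q - f (inv \<xi> a \<otimes> q)" "\<xi> a [^] k = \<one>" "q \<in> carrier Q"
  shows "fox Q \<xi> y (replicate k (True, a)) q = 0"
proof -
  have "fox Q \<xi> y (replicate k (True, a)) q
      = (\<Sum>i<k. f (inv (\<xi> a [^] i) \<otimes> q) - f (inv (\<xi> a [^] Suc i) \<otimes> q))"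
    unfolding fox_replicate[OF assms(3)]
  proof (intro sum.cong refl)
    fix i
    show "y a (inv (\<xi> a [^] i) \<otimes> q) = f (inv (\<xi> a [^] i) \<otimes> q) - f (inv (\<xi> a [^] Suc i) \<otimes> q)"
      using assms(1)[of "inv (\<xi> a [^] i) \<otimes> q"] inv_pow_Suc[of "\<xi> a" q i] assms(3) by simp
  qed
  also have "\<dots> = f (inv (\<xi> a [^] (0::nat)) \<otimes> q) - f (inv (\<xi> a [^] k) \<otimes> q)"
    by (rule sum_lessThan_telescope')
  finally show ?thesis using assms(2,3) by simp
qed

text \<open>Translating a full norm shifts its summands cyclically.\<close>

lemma fox_replicate_invariant:
  assumes "\<xi> a [^] k = \<one>" "q \<in> carrier Q"
  shows "fox Q \<xi> y (replicate k (True, a)) (inv \<xi> a \<otimes> q) = fox Q \<xi> y (replicate k (True, a)) q"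
proof -
  let ?f = "\<lambda>i::nat. y a (inv (\<xi> a [^] i) \<otimes> q)"
  have "fox Q \<xi> y (replicate k (True, a)) (inv \<xi> a \<otimes> q) = (\<Sum>i<k. ?f (Suc i))"
    using assms(2) nat_pow_Suc2[of "\<xi> a"]
    by (simp add: fox_replicate inv_mult_assoc del: nat_pow_Suc)
  also have "\<dots> = (\<Sum>i<k. ?f i) + ?f k - ?f 0"
    using sum.lessThan_Suc_shift[of ?f k] assms(2) by (simp del: nat_pow_Suc)
  finally show ?thesis using assms by (simp add: fox_replicate)
qed

text \<open>A \<open>d\<close>-invariant function is the norm of its restriction to a set of orbit representatives,
  because \<open>d\<close> acts freely.\<close>

lemma norm_preimage:
  fixes v :: "'q \<Rightarrow> 'c::ab_group_add"
  assumes d: "d \<in> carrier Q" and ord: "\<And>i::nat. d [^] i = \<one> \<longleftrightarrow> k dvd i" and k: "k > 0"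
    and v: "\<And>q. q \<in> carrier Q \<Longrightarrow> v (inv d \<otimes> q) = v q"
  obtains w where "\<And>q. w q = v q \<or> w q = 0"
    "\<And>q. q \<in> carrier Q \<Longrightarrow> (\<Sum>i<k. w (inv (d [^] i) \<otimes> q)) = v q"
proof -
  define orb where "orb q = {inv (d [^] i) \<otimes> q |i::nat. True}" for q
  define rep where "rep q = (SOME x. x \<in> orb q)" for q
  have vi: "v (inv (d [^] i) \<otimes> q) = v q" if "q \<in> carrier Q" for i :: nat and q
  proof (induction i)
    case (Suc i)
    then show ?case using v[of "inv (d [^] i) \<otimes> q"] inv_pow_Suc[OF d that, of i] that d by simp
  qed (use that in simp)
  have add: "inv (d [^] i) \<otimes> (inv (d [^] j) \<otimes> q) = inv (d [^] (i + j)) \<otimes> q"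
    if "q \<in> carrier Q" for i j :: nat and q
    using that d by (simp add: inv_mult_assoc[symmetric] nat_pow_mult add.commute)
  have orb: "orb (inv (d [^] i) \<otimes> q) = orb q" if "q \<in> carrier Q" for i :: nat and q
  proof (intro equalityI subsetI)
    fix x assume "x \<in> orb q"
    then obtain j :: nat where j: "x = inv (d [^] j) \<otimes> q" by (auto simp: orb_def)
    have "d [^] (j + k * i) = d [^] j"
      using ord[of "k * i"] d by (simp flip: nat_pow_mult)
    \<comment> \<open>Undoing a translation by the \<open>i\<close>-th power needs an exponent
      \<open>j - i\<close>; adding a multiple of the order \<open>k\<close> keeps it a natural
      number.\<close>
    moreover have "j + k * i = (j + (k - 1) * i) + i" using k by (cases k) auto
    ultimately have "x = inv (d [^] (j + (k - 1) * i)) \<otimes> (inv (d [^] i) \<otimes> q)"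
      using add[OF that] j by metis
    then show "x \<in> orb (inv (d [^] i) \<otimes> q)" unfolding orb_def by blast
  next
    fix x assume "x \<in> orb (inv (d [^] i) \<otimes> q)"
    then obtain j :: nat where j: "x = inv (d [^] j) \<otimes> (inv (d [^] i) \<otimes> q)" by (auto simp: orb_def)
    then have "x = inv (d [^] (j + i)) \<otimes> q" using add[OF that] by simp
    then show "x \<in> orb q" unfolding orb_def by blast
  qed
  have rep: "rep q \<in> orb q" for q
    unfolding rep_def by (rule someI[of _ "inv (d [^] (0::nat)) \<otimes> q"]) (unfold orb_def, blast)
  have uniq: "i = j" if "inv (d [^] i) \<otimes> q = inv (d [^] j) \<otimes> q" "i < k" "j < k" "q \<in> carrier Q" "i \<le> j" for i j :: nat and q
  proof -
    have "inv (d [^] i) = inv (d [^] j)" using that d by simp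
    then have "d [^] i = d [^] j" using d by (metis inv_inv nat_pow_closed)
    also have "\<dots> = d [^] i \<otimes> d [^] (j - i)" using d that(5) by (simp add: nat_pow_mult)
    finally have e: "d [^] i \<otimes> d [^] (j - i) = d [^] i" by simp
    have "d [^] (j - i) = inv (d [^] i) \<otimes> (d [^] i \<otimes> d [^] (j - i))" using d by (simp flip: m_assoc)
    then have "d [^] (j - i) = \<one>" using d by (simp add: e)
    then have "k dvd j - i" using ord by simp
    then show ?thesis using nat_dvd_not_less[of "j - i" k] that by (cases "j - i = 0") auto
  qed
  let ?w = "\<lambda>q. if q = rep q then v q else 0"
  show ?thesis
  proof (rule that[of ?w])
    fix q assume q: "q \<in> carrier Q"
    obtain i0 :: nat where i0: "rep q = inv (d [^] i0) \<otimes> q" using rep[of q] by (auto simp: orb_def)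
    define i1 where "i1 = i0 mod k"
    have i1: "i1 < k" using k by (simp add: i1_def)
    have "d [^] i0 = d [^] (k * (i0 div k)) \<otimes> d [^] i1" using d by (simp add: nat_pow_mult i1_def)
    also have "d [^] (k * (i0 div k)) = \<one>" using ord by simp
    finally have rep1: "rep q = inv (d [^] i1) \<otimes> q" using i0 d by simp
    have "(\<Sum>i<k. ?w (inv (d [^] i) \<otimes> q)) = (\<Sum>i<k. if i = i1 then v q else 0)"
    proof (intro sum.cong refl)
      fix i assume i: "i \<in> {..<k}"
      have "rep (inv (d [^] i) \<otimes> q) = inv (d [^] i1) \<otimes> q"
        using orb[OF q] rep1 by (simp add: rep_def)
      moreover have "inv (d [^] i) \<otimes> q = inv (d [^] i1) \<otimes> q \<longleftrightarrow> i = i1"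
        using uniq[of i q i1] uniq[of i1 q i] i i1 q by (metis lessThan_iff linear)
      ultimately show "?w (inv (d [^] i) \<otimes> q) = (if i = i1 then v q else 0)"
        using vi[OF q] by simp
    qed
    then show "(\<Sum>i<k. ?w (inv (d [^] i) \<otimes> q)) = v q" using i1 by simp
  qed auto
qed

end

lemma sum_list_replicate_eq: "sum_list (replicate k (c::'c::ab_group_add)) = (\<Sum>i<k. c)"
  by (induction k) (auto simp: add.commute)

lemma sum_list_zero_all: "(\<And>x. x \<in> set xs \<Longrightarrow> x = (0::'c::ab_group_add)) \<Longrightarrow> sum_list xs = 0"
  by (induction xs) auto

context F_marked
begin

text \<open>The torsion relators are corrected before the surface relator. Their values lie in
  \<open>L\<close> and are invariant, hence are norms of functions with values in \<open>L\<close>,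
  which can be subtracted at the elliptic generators. The surface relator then still has values in
  \<open>L\<close>, and a good correction removes them without affecting the torsion
  relators.\<close>

lemma lift_solution:
  fixes L :: "'c::ab_group_add set" and y :: "F_gen \<Rightarrow> 'q \<Rightarrow> 'c"
  assumes L: "add_subgroup L" and torsion_free: "\<And>(k::nat) (c::'c). k > 0 \<Longrightarrow> (\<Sum>i<k. c) = 0 \<Longrightarrow> c = 0"
    and ord: "\<And>l (i::nat). l < s \<Longrightarrow> \<xi> (Gen_delta l) [^] i = \<one> \<longleftrightarrow> n l dvd i" "\<And>l. l < s \<Longrightarrow> n l > 0"
    and y: "\<And>w q. w \<in> F_words g r s n \<Longrightarrow> q \<in> carrier Q \<Longrightarrow> fox Q \<xi> y w q \<in> L"
  obtains y' where "\<And>a q. q \<in> carrier Q \<Longrightarrow> y' a q - y a q \<in> L"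
    "\<And>w q. w \<in> F_words g r s n \<Longrightarrow> q \<in> carrier Q \<Longrightarrow> fox Q \<xi> y' w q = 0"
proof -
  have one: "\<xi> (Gen_delta l) [^] n l = \<one>" if "l < s" for l using ord(1)[OF that] by simp
  have "\<exists>w. (\<forall>q\<in>carrier Q. w q \<in> L) \<and> (\<forall>q\<in>carrier Q.
      (\<Sum>i<n l. w (inv (\<xi> (Gen_delta l) [^] i) \<otimes> q)) = fox Q \<xi> y (pow_word n l) q)" if l: "l < s" for l
  proof -
    obtain w where w: "\<And>q. w q = fox Q \<xi> y (pow_word n l) q \<or> w q = 0"
      "\<And>q. q \<in> carrier Q \<Longrightarrow> (\<Sum>i<n l. w (inv (\<xi> (Gen_delta l) [^] i) \<otimes> q)) = fox Q \<xi> y (pow_word n l) q"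
      using norm_preimage[OF \<xi>_closed ord(1)[OF l] ord(2)[OF l], of "fox Q \<xi> y (pow_word n l)"]
        fox_replicate_invariant[OF one[OF l]] unfolding pow_word_def by metis
    have "w q \<in> L" if q: "q \<in> carrier Q" for q
      using w(1)[of q] add_subgroupD(1)[OF L] y[of "pow_word n l" q] l q by (auto simp: F_words_def)
    then show ?thesis using w(2) by blast
  qed
  then obtain w where w: "\<And>l q. l < s \<Longrightarrow> q \<in> carrier Q \<Longrightarrow> w l q \<in> L"
    "\<And>l q. l < s \<Longrightarrow> q \<in> carrier Q \<Longrightarrow>
      (\<Sum>i<n l. w l (inv (\<xi> (Gen_delta l) [^] i) \<otimes> q)) = fox Q \<xi> y (pow_word n l) q"
    by metis
  define z where "z a q = (case a of Gen_delta l \<Rightarrow> if l < s then w l q else 0 | _ \<Rightarrow> 0)" for a q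
  have zL: "z a q \<in> L" if "q \<in> carrier Q" for a q
    using w(1) that add_subgroupD(1)[OF L] by (auto simp: z_def split: F_gen.splits)
  define y1 where "y1 a q = y a q - z a q" for a q
  have y1_pow: "fox Q \<xi> y1 (pow_word n l) q = 0" if "l < s" "q \<in> carrier Q" for l q
  proof -
    have "fox Q \<xi> z (pow_word n l) q = fox Q \<xi> y (pow_word n l) q"
      using w(2) that by (simp add: pow_word_def fox_replicate z_def)
    then show ?thesis by (simp add: y1_def[abs_def] fox_diff)
  qed
  have y1_W: "fox Q \<xi> y1 (prod_word g r s) q \<in> L" if q: "q \<in> carrier Q" for q
    using y[of "prod_word g r s" q] fox_mem[OF L zL q] add_subgroupD(2)[OF L] q
    by (simp add: y1_def[abs_def] fox_diff F_words_def)
  \<comment> \<open>Without punctures only elliptic generators contribute to the total. Each torsion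
    relator, now satisfied exactly, says that \<open>n l\<close> times the total of
    \<open>y1\<close> at its generator is zero, and the coefficients are torsion-free.\<close>
  have "(\<Sum>q\<in>carrier Q. fox Q \<xi> y1 (prod_word g r s) q) = 0" if r: "r = 0"
  proof -
    have S: "(\<Sum>q\<in>carrier Q. y1 (Gen_delta l) q) = 0" if "l < s" for l
    proof (rule torsion_free[of "n l"])
      have "0 = (\<Sum>q\<in>carrier Q. fox Q \<xi> y1 (pow_word n l) q)" using y1_pow[OF that] by simp
      also have "\<dots> = (\<Sum>i<n l. \<Sum>q\<in>carrier Q. y1 (Gen_delta l) q)"
        by (simp add: sum_fox pow_word_def sum_list_replicate_eq)
      finally show "(\<Sum>i<n l. \<Sum>q\<in>carrier Q. y1 (Gen_delta l) q) = 0" by simp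
    qed (use ord(2)[OF that] in simp)
    let ?f = "\<lambda>t. if fst t then \<Sum>q\<in>carrier Q. y1 (snd t) q else - (\<Sum>q\<in>carrier Q. y1 (snd t) q)"
    have "sum_list (map ?f (concat (map comm_word l))) = 0" for l
      by (induction l) (auto simp: comm_word_def)
    moreover have "sum_list (map ?f (map (\<lambda>l. (True, Gen_delta l)) [0..<s])) = 0"
      using S by (intro sum_list_zero_all) auto
    ultimately show ?thesis by (simp add: sum_fox prod_word_def r)
  qed
  then have "r > 0 \<or> (\<Sum>q\<in>carrier Q. fox Q \<xi> y1 (prod_word g r s) q) = 0" by blast
  from attained_sum_zero[OF L y1_W this]
  obtain y2 where y2: "good L y2"
    "\<forall>q\<in>carrier Q. fox Q \<xi> y2 (prod_word g r s) q = fox Q \<xi> y1 (prod_word g r s) q"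
    unfolding attained_def by blast
  have y2_pow: "fox Q \<xi> y2 (pow_word n l) q = 0" if l: "l < s" and q: "q \<in> carrier Q" for l q
  proof -
    obtain f where "\<forall>q\<in>carrier Q. y2 (Gen_delta l) q = f q - f (inv \<xi> (Gen_delta l) \<otimes> q)"
      using y2(1) l unfolding good_def by blast
    then show ?thesis unfolding pow_word_def
      by (intro fox_replicate_difference[OF _ one[OF l] q, of _ f]) blast
  qed
  show ?thesis
  proof (rule that[of "\<lambda>a q. y1 a q - y2 a q"])
    show "y1 a q - y2 a q - y a q \<in> L" if "q \<in> carrier Q" for a q
    proof -
      have "- z a q - y2 a q \<in> L"
        using zL[OF that] y2(1) that by (intro add_subgroupD(2,3)[OF L]) (auto simp: good_def)
      then show ?thesis by (simp add: y1_def)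
    qed
    show "fox Q \<xi> (\<lambda>a q. y1 a q - y2 a q) w q = 0" if "w \<in> F_words g r s n" "q \<in> carrier Q" for w q
      using that y2(2) y1_pow y2_pow by (auto simp: fox_diff F_words_def)
  qed
qed

end

section \<open>Counting solutions modulo an integer\<close>

lemma card_class_functions:
  assumes S: "finite S" and E: "equiv S E" and R: "finite R"
  shows "card {f \<in> S \<rightarrow>\<^sub>E R. \<forall>x y. (x, y) \<in> E \<longrightarrow> f x = f y} = card R ^ card (S // E)"
proof -
  let ?F = "{f \<in> S \<rightarrow>\<^sub>E R. \<forall>x y. (x, y) \<in> E \<longrightarrow> f x = f y}"
  let ?H = "S // E \<rightarrow>\<^sub>E R"
  have "bij_betw (\<lambda>h. restrict (\<lambda>x. h (E `` {x})) S) ?H ?F"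
  proof (rule bij_betwI')
    fix h h' assume h: "h \<in> ?H" "h' \<in> ?H"
    show "(restrict (\<lambda>x. h (E `` {x})) S = restrict (\<lambda>x. h' (E `` {x})) S) = (h = h')"
    proof
      assume eq: "restrict (\<lambda>x. h (E `` {x})) S = restrict (\<lambda>x. h' (E `` {x})) S"
      show "h = h'"
      proof (rule PiE_ext[OF h])
        fix c assume "c \<in> S // E"
        then obtain x where "x \<in> S" "c = E `` {x}" by (rule quotientE)
        then show "h c = h' c" using fun_cong[OF eq, of x] by simp
      qed
    qed simp
  next
    fix h assume h: "h \<in> ?H"
    have "restrict (\<lambda>x. h (E `` {x})) S \<in> S \<rightarrow>\<^sub>E R"
      using h quotientI[of _ S E] by (auto simp: PiE_iff)
    moreover have "restrict (\<lambda>x. h (E `` {x})) S x = restrict (\<lambda>x. h (E `` {x})) S y" if "(x, y) \<in> E" for x y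
      using equiv_class_eq[OF E that] equiv_type[OF E] that by auto
    ultimately show "restrict (\<lambda>x. h (E `` {x})) S \<in> ?F" by blast
  next
    fix f assume f: "f \<in> ?F"
    define h where "h = restrict (\<lambda>c. f (SOME x. x \<in> c)) (S // E)"
    have rep: "f (SOME y. y \<in> E `` {x}) = f x" if "x \<in> S" for x
    proof -
      have "x \<in> E `` {x}" using E that by (rule equiv_class_self)
      then have "(SOME y. y \<in> E `` {x}) \<in> E `` {x}" by (rule someI)
      then show ?thesis using f by simp
    qed
    have "h \<in> ?H"
    proof
      fix c assume c: "c \<in> S // E"
      then obtain x where "x \<in> S" "c = E `` {x}" by (rule quotientE)
      then show "h c \<in> R" using c f rep by (auto simp: h_def)
    qed (simp add: h_def)
    moreover have "f = restrict (\<lambda>x. h (E `` {x})) S"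
    proof
      fix x show "f x = restrict (\<lambda>x. h (E `` {x})) S x"
        using f rep[of x] quotientI[of x S E] by (cases "x \<in> S") (auto simp: h_def PiE_iff extensional_def)
    qed
    ultimately show "\<exists>h\<in>?H. f = restrict (\<lambda>x. h (E `` {x})) S" by blast
  qed
  then have "card ?F = card ?H" using bij_betw_same_card by fastforce
  also have "\<dots> = card R ^ card (S // E)"
    using finite_quotient[OF S equiv_type[OF E]] by (simp add: card_PiE)
  finally show ?thesis .
qed

lemma pigeonhole_fibre:
  assumes "finite E" "f ` D \<subseteq> E" "card D > k * card E"
  obtains e where "e \<in> E" "card {d \<in> D. f d = e} > k"
proof -
  have "\<exists>e\<in>E. card {d \<in> D. f d = e} > k"
  proof (rule ccontr)
    assume "\<not> ?thesis"
    then have le: "card {d \<in> D. f d = e} \<le> k" if "e \<in> E" for e using that by force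
    have "D = (\<Union>e\<in>E. {d \<in> D. f d = e})" using assms(2) by auto
    then have "card D \<le> (\<Sum>e\<in>E. card {d \<in> D. f d = e})"
      using card_UN_le[OF assms(1), of "\<lambda>e. {d \<in> D. f d = e}"] by simp
    also have "\<dots> \<le> (\<Sum>e\<in>E. k)" using le by (rule sum_mono)
    finally show False using assms(3) by (simp add: mult.commute)
  qed
  then show ?thesis using that by blast
qed

text \<open>With one of the subgroups trivial this is the one-sided coset relation, so that a single
  count covers left, right and two-sided invariant functions.\<close>

definition double_cosets :: "('q, 'd) monoid_scheme \<Rightarrow> 'q set \<Rightarrow> 'q set \<Rightarrow> ('q \<times> 'q) set" where
  "double_cosets Q H K = {(x, y). x \<in> carrier Q \<and> y \<in> carrier Q \<and> (\<exists>h\<in>H. \<exists>k\<in>K. y = h \<otimes>\<^bsub>Q\<^esub> x \<otimes>\<^bsub>Q\<^esub> k)}"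

context group
begin

lemma equiv_double_cosets:
  assumes H: "subgroup H G" and K: "subgroup K G"
  shows "equiv (carrier G) (double_cosets G H K)"
proof (rule equivI)
  note c = subgroup.mem_carrier[OF H] subgroup.mem_carrier[OF K]
  show "double_cosets G H K \<subseteq> carrier G \<times> carrier G" by (auto simp: double_cosets_def)
  show "refl_on (carrier G) (double_cosets G H K)"
    using subgroup.one_closed[OF H] subgroup.one_closed[OF K]
    by (auto simp: refl_on_def double_cosets_def intro!: bexI[of _ \<one>])
  show "sym (double_cosets G H K)"
  proof (rule symI)
    fix x y assume "(x, y) \<in> double_cosets G H K"
    then obtain h k where *: "x \<in> carrier G" "y \<in> carrier G" "h \<in> H" "k \<in> K" "y = h \<otimes> x \<otimes> k"
      by (auto simp: double_cosets_def)
    then have "x = inv h \<otimes> y \<otimes> inv k"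
      using c by (simp add: m_assoc) (simp add: m_assoc[symmetric])
    then show "(y, x) \<in> double_cosets G H K"
      using * subgroup.m_inv_closed[OF H] subgroup.m_inv_closed[OF K] unfolding double_cosets_def by blast
  qed
  show "trans (double_cosets G H K)"
  proof (rule transI)
    fix x y z assume "(x, y) \<in> double_cosets G H K" "(y, z) \<in> double_cosets G H K"
    then obtain h k h' k' where *: "x \<in> carrier G" "z \<in> carrier G" "h \<in> H" "k \<in> K" "h' \<in> H" "k' \<in> K"
       "z = h' \<otimes> (h \<otimes> x \<otimes> k) \<otimes> k'"
      by (auto simp: double_cosets_def)
    then have "z = (h' \<otimes> h) \<otimes> x \<otimes> (k \<otimes> k')" using c by (simp add: m_assoc)
    then show "(x, z) \<in> double_cosets G H K"
      using * subgroup.m_closed[OF H] subgroup.m_closed[OF K] unfolding double_cosets_def by blast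
  qed
qed

lemma double_coset_class:
  assumes "subgroup H G" "subgroup K G" "x \<in> carrier G"
  shows "double_cosets G H K `` {x} = (\<lambda>(h, k). h \<otimes> x \<otimes> k) ` (H \<times> K)"
proof (intro equalityI subsetI)
  fix y assume "y \<in> double_cosets G H K `` {x}"
  then obtain h k where "h \<in> H" "k \<in> K" "y = h \<otimes> x \<otimes> k" by (auto simp: double_cosets_def)
  then show "y \<in> (\<lambda>(h, k). h \<otimes> x \<otimes> k) ` (H \<times> K)" by (intro image_eqI[of _ _ "(h, k)"]) auto
next
  fix y assume "y \<in> (\<lambda>(h, k). h \<otimes> x \<otimes> k) ` (H \<times> K)"
  then obtain h k where *: "h \<in> H" "k \<in> K" "y = h \<otimes> x \<otimes> k" by auto
  then have "y \<in> carrier G"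
    using assms(3) subgroup.mem_carrier[OF assms(1)] subgroup.mem_carrier[OF assms(2)] by simp
  then show "y \<in> double_cosets G H K `` {x}" using * assms(3) unfolding double_cosets_def by blast
qed

text \<open>A double coset is the image of the product of the two subgroups under multiplication
  around a representative, and this map is injective when one of them is trivial.\<close>

lemma card_double_cosets:
  assumes fin: "finite (carrier G)" and H: "subgroup H G" and K: "subgroup K G"
  shows "card (carrier G) \<le> card H * card K * card (carrier G // double_cosets G H K)"
    and "H = {\<one>} \<or> K = {\<one>} \<Longrightarrow> card H * card K * card (carrier G // double_cosets G H K) = card (carrier G)"
proof -
  let ?E = "double_cosets G H K"
  note eq = equiv_double_cosets[OF H K]
  have finHK: "finite H" "finite K"
    using fin subgroup.subset[OF H] subgroup.subset[OF K] finite_subset by auto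
  have U: "\<Union> (carrier G // ?E) = carrier G" by (rule Union_quotient[OF eq])
  have finq: "finite (carrier G // ?E)" using finite_quotient[OF fin equiv_type[OF eq]] .
  have le: "card c \<le> card H * card K" if c: "c \<in> carrier G // ?E" for c
  proof -
    obtain x where "x \<in> carrier G" "c = ?E `` {x}" using c by (rule quotientE)
    then show ?thesis
      using card_image_le[of "H \<times> K" "\<lambda>(h, k). h \<otimes> x \<otimes> k"] finHK
      by (simp add: double_coset_class[OF H K] card_cartesian_product)
  qed
  have "card (carrier G) \<le> (\<Sum>c\<in>carrier G // ?E. card c)"
    using card_Union_le_sum_card[of "carrier G // ?E"] U by simp
  also have "\<dots> \<le> (\<Sum>c\<in>carrier G // ?E. card H * card K)" using le by (rule sum_mono)
  finally show "card (carrier G) \<le> card H * card K * card (carrier G // ?E)" by (simp add: mult.commute)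
  assume triv: "H = {\<one>} \<or> K = {\<one>}"
  have "card c = card H * card K" if c: "c \<in> carrier G // ?E" for c
  proof -
    obtain x where x: "x \<in> carrier G" "c = ?E `` {x}" using c by (rule quotientE)
    have "inj_on (\<lambda>(h, k). h \<otimes> x \<otimes> k) (H \<times> K)"
      using triv x(1) subgroup.mem_carrier[OF H] subgroup.mem_carrier[OF K]
      by (auto simp: inj_on_def)
    then show ?thesis using x by (simp add: double_coset_class[OF H K] card_image card_cartesian_product)
  qed
  then have "card H * card K * card (carrier G // ?E) = card (\<Union> (carrier G // ?E))"
    using quotient_disj[OF eq] finq fin U by (intro card_partition) auto
  then show "card H * card K * card (carrier G // ?E) = card (carrier G)" by (simp add: U)
qed

lemma invariant_generate:
  assumes d: "d \<in> carrier G" and f: "\<And>q. q \<in> carrier G \<Longrightarrow> f (inv d \<otimes> q) = f q"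
    and h: "h \<in> generate G {d}" and q: "q \<in> carrier G"
  shows "f (h \<otimes> q) = f q"
proof -
  let ?S = "{h \<in> carrier G. \<forall>q\<in>carrier G. f (h \<otimes> q) = f q}"
  have sg: "subgroup ?S G"
  proof (rule subgroupI)
    have "\<one> \<in> ?S" by simp
    then show "?S \<noteq> {}" by blast
    fix a assume a: "a \<in> ?S"
    show "inv a \<in> ?S"
    proof (intro CollectI conjI ballI)
      fix q assume q: "q \<in> carrier G"
      have "f (a \<otimes> (inv a \<otimes> q)) = f (inv a \<otimes> q)" using a q by simp
      then show "f (inv a \<otimes> q) = f q" using a q by (simp flip: m_assoc)
    qed (use a in simp)
    fix b assume "b \<in> ?S"
    with a show "a \<otimes> b \<in> ?S" by (auto simp: m_assoc)
  qed auto
  have "inv d \<in> ?S" using d f by simp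
  from subgroup.m_inv_closed[OF sg this] have "d \<in> ?S" using d by (simp only: inv_inv)
  then have "generate G {d} \<subseteq> ?S" by (intro generate_subgroup_incl[OF _ sg]) simp
  then show ?thesis using h q by auto
qed

end

text \<open>Here \<open>C\<close> is the order of \<open>Q\<close>, \<open>c\<close> that of
  \<open>K\<close>, \<open>xc\<close> the number of cosets of \<open>K\<close>, \<open>b\<close> the
  modulus and \<open>m\<close> the number of zero-sum functions; \<open>a l\<close> counts those
  invariant under the \<open>l\<close>-th elliptic generator, \<open>Y l\<close> its orbits and
  \<open>d l\<close> the double cosets. With \<open>M = C - xc\<close>, \<open>m\<close> is at least
  \<open>b ^ M\<close>, while \<open>a l\<close> is at most \<open>b\<close> to the power
  \<open>M / n l\<close>. Hyperbolicity says that the sum of the \<open>1 / n l\<close> is less than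
  \<open>2 * g + r + s - 2\<close>. One of the two factors \<open>m\<close> is for the surface
  relator, the other for the coboundaries.\<close>

lemma counting_inequality:
  fixes a Y d n :: "nat \<Rightarrow> nat" and b c xc C m g r s :: nat
  assumes b: "b \<ge> 2" and c: "c \<ge> 2" "c * xc = C" "C > 0" and m: "b ^ C \<le> m * b ^ xc"
    and Y: "\<And>l. l < s \<Longrightarrow> n l * Y l = C" and d: "\<And>l. l < s \<Longrightarrow> C \<le> n l * c * d l"
    and a: "\<And>l. l < s \<Longrightarrow> a l * b ^ d l \<le> b ^ Y l"
    and hyp: "2 - 2 * real g - real r - (\<Sum>l<s. 1 - 1 / real (n l)) < 0"
  shows "m * m * (\<Prod>l<s. a l) < m ^ (2 * g + r + s)"
proof -
  define M where "M = C - xc"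
  have xc: "xc > 0" "xc < C" using c by (auto simp: mult.commute) 
  have M: "M > 0" using xc by (simp add: M_def)
  have "b ^ M * b ^ xc \<le> m * b ^ xc" using m xc by (simp add: M_def flip: power_add)
  then have m': "b ^ M \<le> m" using b by simp
  have np: "n l > 0" if "l < s" for l using Y[OF that] c by (cases "n l") auto
  \<comment> \<open>The subtraction is truncated: a nonzero \<open>a l\<close> forces
    \<open>d l \<le> Y l\<close>, and for \<open>a l = 0\<close> there is nothing to show.\<close>
  have a': "a l \<le> b ^ (Y l - d l)" if l: "l < s" for l
  proof (cases "a l = 0")
    case False
    then have "b ^ d l \<le> b ^ Y l" using a[OF l] by (metis le_trans mult_le_mono1 nat_mult_1 One_nat_def Suc_leI not_gr_zero)
    then have "d l \<le> Y l" using b by simp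
    then have "a l * b ^ d l \<le> b ^ (Y l - d l) * b ^ d l" using a[OF l] by (simp flip: power_add)
    then show ?thesis using b by simp
  qed simp
  have e: "real (Y l - d l) \<le> real M * (1 / real (n l))" if l: "l < s" for l
  proof -
    have "c * xc \<le> c * (n l * d l)" using d[OF l] c(2) by (simp add: ac_simps)
    then have "xc \<le> n l * d l" using c(1) by simp
    then have "n l * (Y l - d l) \<le> M" using Y[OF l] by (simp add: M_def diff_mult_distrib2)
    then have "real (n l) * real (Y l - d l) \<le> real M" by (metis of_nat_le_iff of_nat_mult)
    then show ?thesis using np[OF l] by (simp add: field_simps)
  qed
  have "(\<Sum>l<s. 1 - 1 / real (n l)) = real s - (\<Sum>l<s. 1 / real (n l))"
    by (simp add: sum_subtractf)
  then have h: "(\<Sum>l<s. 1 / real (n l)) < 2 * real g + real r + real s - 2" using hyp by simp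
  moreover have "(\<Sum>l<s. 1 / real (n l)) \<ge> 0" by (intro sum_nonneg) simp
  ultimately have k: "2 * g + r + s > 2" by linarith
  define k where "k = 2 * g + r + s - 2"
  have kr: "real k = 2 * real g + real r + real s - 2" using k by (simp add: k_def of_nat_diff)
  have "real (\<Sum>l<s. Y l - d l) \<le> (\<Sum>l<s. real M * (1 / real (n l)))"
    unfolding of_nat_sum using e by (intro sum_mono) auto
  also have "\<dots> = real M * (\<Sum>l<s. 1 / real (n l))" by (simp only: sum_distrib_left)
  also have "\<dots> < real M * real k" using h kr M by simp
  finally have "(\<Sum>l<s. Y l - d l) < M * k" by (metis of_nat_less_iff of_nat_mult)
  then have "b ^ (\<Sum>l<s. Y l - d l) < b ^ (M * k)" using b by (intro power_strict_increasing) auto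
  moreover have "(\<Prod>l<s. a l) \<le> (\<Prod>l<s. b ^ (Y l - d l))" using a' by (intro prod_mono) auto
  then have "(\<Prod>l<s. a l) \<le> b ^ (\<Sum>l<s. Y l - d l)" by (simp add: power_sum)
  moreover have "b ^ (M * k) \<le> m ^ k" unfolding power_mult by (intro power_mono m') simp
  ultimately have "(\<Prod>l<s. a l) < m ^ k" by linarith
  moreover have "m > 0" using m' b by (metis not_gr_zero le_zero_eq power_not_zero rel_simps(76))
  ultimately have "m * m * (\<Prod>l<s. a l) < m * m * m ^ k" by simp
  also have "\<dots> = m ^ (2 + k)" by (simp add: power_add power2_eq_square)
  also have "2 + k = 2 * g + r + s" using k by (simp add: k_def)
  finally show ?thesis .
qed

lemma dvd_sum_mod: "(N::int) dvd (\<Sum>i\<in>I. f i mod N) \<longleftrightarrow> N dvd (\<Sum>i\<in>I. f i)"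
  by (simp add: dvd_eq_mod_eq_0 mod_sum_eq)

lemma dvd_diff_mod_eq: "(0::int) \<le> x \<Longrightarrow> x < N \<Longrightarrow> 0 \<le> x' \<Longrightarrow> x' < N \<Longrightarrow> N dvd x - x' \<Longrightarrow> x = x'"
  by (metis mod_eq_dvd_iff mod_pos_pos_trivial)

section \<open>Zero-sum functions on the cosets of a subgroup\<close>

context group
begin

definition coset_sum :: "'a set \<Rightarrow> ('a \<Rightarrow> int) \<Rightarrow> 'a \<Rightarrow> int" where
  "coset_sum K f q = (\<Sum>k\<in>K. f (q \<otimes> k))"

lemma coset_sum_shift:
  assumes K: "subgroup K G" and k: "k \<in> K" and q: "q \<in> carrier G"
  shows "coset_sum K f (q \<otimes> k) = coset_sum K f q"
proof -
  have kc: "k \<in> carrier G" using subgroup.mem_carrier[OF K k] .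
  have 1: "inv k \<otimes> (k \<otimes> x) = x" "k \<otimes> (inv k \<otimes> x) = x" if "x \<in> carrier G" for x
    using kc that by (simp_all flip: m_assoc)
  show ?thesis
    unfolding coset_sum_def
    by (rule sum.reindex_bij_witness[of _ "\<lambda>x. inv k \<otimes> x" "\<lambda>x. k \<otimes> x"])
      (use 1 k kc q in \<open>simp_all add: subgroup.mem_carrier[OF K] m_assoc subgroup.m_closed[OF K] subgroup.m_inv_closed[OF K]\<close>)
qed

lemma coset_sum_const:
  assumes "subgroup K G" "\<And>k. k \<in> K \<Longrightarrow> f (q \<otimes> k) = f q"
  shows "coset_sum K f q = int (card K) * f q"
  using assms by (simp add: coset_sum_def)

text \<open>The modulus is chosen congruent to \<open>1\<close> modulo \<open>card K\<close>, so that \<open>-1\<close> inverts \<open>card K\<close>.\<close>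

definition zero_sum :: "'a set \<Rightarrow> ('a \<Rightarrow> int) set" where
  "zero_sum K = {f \<in> carrier G \<rightarrow>\<^sub>E {0..<int (card K) + 1}.
     \<forall>q\<in>carrier G. (int (card K) + 1) dvd coset_sum K f q}"

definition zero_sum_inv :: "'a set \<Rightarrow> 'a \<Rightarrow> ('a \<Rightarrow> int) set" where
  "zero_sum_inv K d = {f \<in> zero_sum K. \<forall>q\<in>carrier G. f (inv d \<otimes> q) = f q}"

definition reduce :: "'a set \<Rightarrow> ('a \<Rightarrow> int) \<Rightarrow> 'a \<Rightarrow> int" where
  "reduce K f = restrict (\<lambda>q. f q mod (int (card K) + 1)) (carrier G)"

lemma reduce_closed: "reduce K f \<in> carrier G \<rightarrow>\<^sub>E {0..<int (card K) + 1}"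
proof -
  have "0 \<le> f q mod (int (card K) + 1)" "f q mod (int (card K) + 1) < int (card K) + 1" for q
    by (intro pos_mod_sign pos_mod_bound; simp)+
  then show ?thesis by (simp add: reduce_def)
qed

lemma coset_sum_reduce:
  assumes K: "subgroup K G" and q: "q \<in> carrier G"
  shows "(int (card K) + 1) dvd coset_sum K (reduce K f) q \<longleftrightarrow> (int (card K) + 1) dvd coset_sum K f q"
proof -
  have "coset_sum K (reduce K f) q = (\<Sum>k\<in>K. f (q \<otimes> k) mod (int (card K) + 1))"
    unfolding coset_sum_def using q subgroup.mem_carrier[OF K] by (intro sum.cong) (auto simp: reduce_def)
  then show ?thesis by (simp add: dvd_sum_mod coset_sum_def)
qed

lemma reduce_in_zero_sum:
  assumes "subgroup K G" "\<And>q. q \<in> carrier G \<Longrightarrow> (int (card K) + 1) dvd coset_sum K f q"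
  shows "reduce K f \<in> zero_sum K"
  using assms reduce_closed by (auto simp: zero_sum_def coset_sum_reduce)

lemma coset_sum_add: "coset_sum K (\<lambda>q. f q + f' q) q = coset_sum K f q + coset_sum K f' q"
  by (simp add: coset_sum_def sum.distrib)

lemma reduce_eqD:
  assumes "reduce K f = reduce K f'" "q \<in> carrier G"
  shows "(int (card K) + 1) dvd f q - f' q"
  using fun_cong[OF assms(1), of q] assms(2) by (simp add: reduce_def mod_eq_dvd_iff)

lemma card_functions:
  assumes "finite (carrier G)"
  shows "card (carrier G \<rightarrow>\<^sub>E {0..<int (card K) + 1}) = (card K + 1) ^ card (carrier G)"
  using assms by (simp add: card_PiE nat_add_distrib)

lemma double_coset_invariant_iff:
  assumes "subgroup H G" "subgroup K G"
  shows "(\<forall>x y. (x, y) \<in> double_cosets G H K \<longrightarrow> f x = f y) \<longleftrightarrow>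
    (\<forall>q\<in>carrier G. \<forall>h\<in>H. \<forall>k\<in>K. f (h \<otimes> q \<otimes> k) = f q)"
proof (intro iffI allI ballI impI)
  fix q h k assume *: "\<forall>x y. (x, y) \<in> double_cosets G H K \<longrightarrow> f x = f y"
    and q: "q \<in> carrier G" "h \<in> H" "k \<in> K"
  then have "h \<otimes> q \<otimes> k \<in> carrier G"
    using subgroup.mem_carrier[OF assms(1)] subgroup.mem_carrier[OF assms(2)] by simp
  then have "(q, h \<otimes> q \<otimes> k) \<in> double_cosets G H K" using q unfolding double_cosets_def by blast
  then show "f (h \<otimes> q \<otimes> k) = f q" using * by simp
next
  fix x y assume *: "\<forall>q\<in>carrier G. \<forall>h\<in>H. \<forall>k\<in>K. f (h \<otimes> q \<otimes> k) = f q"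
    and "(x, y) \<in> double_cosets G H K"
  then obtain h k where "x \<in> carrier G" "h \<in> H" "k \<in> K" "y = h \<otimes> x \<otimes> k" unfolding double_cosets_def by blast
  then show "f x = f y" using * by simp
qed

text \<open>Since \<open>card K + 1\<close> vanishes modulo \<open>N\<close>, adding to a function
  its coset sums makes all coset sums vanish. So \<open>f\<close> is sent to the pair of
  \<open>f\<close> plus its coset sums and the coset sums themselves, which are invariant under
  \<open>K\<close>. Subtraction recovers \<open>f\<close>, whence the lower bound.\<close>

lemma card_zero_sum:
  assumes fin: "finite (carrier G)" and K: "subgroup K G"
  obtains xc where "card K * xc = card (carrier G)"
    "(card K + 1) ^ card (carrier G) \<le> card (zero_sum K) * (card K + 1) ^ xc"
proof -
  let ?N = "int (card K) + 1"
  let ?E = "double_cosets G {\<one>} K"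
  let ?I = "{f \<in> carrier G \<rightarrow>\<^sub>E {0..<?N}. \<forall>x y. (x, y) \<in> ?E \<longrightarrow> f x = f y}"
  have I: "card ?I = (card K + 1) ^ card (carrier G // ?E)"
    using card_class_functions[OF fin equiv_double_cosets[OF triv_subgroup K], of "{0..<?N}"]
    by (simp add: nat_add_distrib)
  have finM: "finite (carrier G \<rightarrow>\<^sub>E {0..<?N})" using fin by (intro finite_PiE) auto
  let ?h = "\<lambda>f. (reduce K (\<lambda>q. f q + coset_sum K f q), reduce K (coset_sum K f))"
  have "card (carrier G \<rightarrow>\<^sub>E {0..<?N}) \<le> card (zero_sum K \<times> ?I)"
  proof (rule card_inj_on_le[of ?h])
    show "inj_on ?h (carrier G \<rightarrow>\<^sub>E {0..<?N})"
    proof (rule inj_onI)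
      fix f f' assume f: "f \<in> carrier G \<rightarrow>\<^sub>E {0..<?N}" "f' \<in> carrier G \<rightarrow>\<^sub>E {0..<?N}" and eq: "?h f = ?h f'"
      show "f = f'"
      proof (rule PiE_ext[OF f])
        fix q assume q: "q \<in> carrier G"
        have "?N dvd (f q + coset_sum K f q) - (f' q + coset_sum K f' q)" "?N dvd coset_sum K f q - coset_sum K f' q"
          using eq q by (auto intro: reduce_eqD)
        then have "?N dvd ((f q + coset_sum K f q) - (f' q + coset_sum K f' q)) - (coset_sum K f q - coset_sum K f' q)"
          by (rule dvd_diff)
        then have "?N dvd f q - f' q" by (simp add: algebra_simps)
        moreover have "0 \<le> f q" "f q < ?N" "0 \<le> f' q" "f' q < ?N" using f q by (auto simp: PiE_iff)
        ultimately show "f q = f' q" using dvd_diff_mod_eq by blast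
      qed
    qed
    show "?h ` (carrier G \<rightarrow>\<^sub>E {0..<?N}) \<subseteq> zero_sum K \<times> ?I"
    proof (rule image_subsetI, intro SigmaI)
      fix f assume "f \<in> carrier G \<rightarrow>\<^sub>E {0..<?N}"
      show "reduce K (\<lambda>q. f q + coset_sum K f q) \<in> zero_sum K"
      proof (rule reduce_in_zero_sum[OF K])
        fix q assume q: "q \<in> carrier G"
        have "coset_sum K (coset_sum K f) q = int (card K) * coset_sum K f q"
          by (rule coset_sum_const[OF K]) (rule coset_sum_shift[OF K _ q])
        then show "?N dvd coset_sum K (\<lambda>q. f q + coset_sum K f q) q"
          by (intro dvdI[of _ _ "coset_sum K f q"]) (simp add: coset_sum_add algebra_simps)
      qed
      show "reduce K (coset_sum K f) \<in> ?I"
        using reduce_closed[of K "coset_sum K f"] coset_sum_shift[OF K] subgroup.mem_carrier[OF K]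
        by (auto simp: double_coset_invariant_iff[OF triv_subgroup K]) (simp add: reduce_def)
    qed
    have "zero_sum K \<subseteq> carrier G \<rightarrow>\<^sub>E {0..<?N}" by (auto simp: zero_sum_def)
    then show "finite (zero_sum K \<times> ?I)" using finM by (auto intro: finite_subset)
  qed
  then have "(card K + 1) ^ card (carrier G) \<le> card (zero_sum K) * (card K + 1) ^ card (carrier G // ?E)"
    by (simp add: card_functions[OF fin] card_cartesian_product I)
  moreover have "card K * card (carrier G // ?E) = card (carrier G)"
    using card_double_cosets(2)[OF fin triv_subgroup K] by simp
  ultimately show ?thesis using that by blast
qed

text \<open>Let \<open>H\<close> be generated by \<open>d\<close>. Adding a function that is
  invariant under \<open>H\<close> on the left and \<open>K\<close> on the right to an
  \<open>H\<close>-invariant zero-sum function gives an \<open>H\<close>-invariant function. The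
  coset sum of the result is \<open>card K\<close> times the first summand, and
  \<open>card K\<close> is invertible modulo \<open>N\<close>, so both summands can be
  recovered.\<close>

lemma card_zero_sum_inv:
  assumes fin: "finite (carrier G)" and K: "subgroup K G" and d: "d \<in> carrier G"
  obtains Y z where "ord d * Y = card (carrier G)" "card (carrier G) \<le> ord d * card K * z"
    "card (zero_sum_inv K d) * (card K + 1) ^ z \<le> (card K + 1) ^ Y"
proof -
  let ?N = "int (card K) + 1"
  define H where "H = generate G {d}"
  have H: "subgroup H G" unfolding H_def using d by (intro generate_is_subgroup) simp
  have cH: "card H = ord d" unfolding H_def using generate_pow_card[OF d] by simp
  have finM: "finite (carrier G \<rightarrow>\<^sub>E {0..<?N})" using fin by (intro finite_PiE) auto
  let ?E = "double_cosets G H {\<one>}" and ?E' = "double_cosets G H K"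
  let ?I = "{f \<in> carrier G \<rightarrow>\<^sub>E {0..<?N}. \<forall>x y. (x, y) \<in> ?E \<longrightarrow> f x = f y}"
  let ?I' = "{f \<in> carrier G \<rightarrow>\<^sub>E {0..<?N}. \<forall>x y. (x, y) \<in> ?E' \<longrightarrow> f x = f y}"
  have I: "card ?I = (card K + 1) ^ card (carrier G // ?E)"
    using card_class_functions[OF fin equiv_double_cosets[OF H triv_subgroup], of "{0..<?N}"]
    by (simp add: nat_add_distrib)
  have I': "card ?I' = (card K + 1) ^ card (carrier G // ?E')"
    using card_class_functions[OF fin equiv_double_cosets[OF H K], of "{0..<?N}"]
    by (simp add: nat_add_distrib)
  have sub: "zero_sum_inv K d \<subseteq> carrier G \<rightarrow>\<^sub>E {0..<?N}" by (auto simp: zero_sum_inv_def zero_sum_def)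
  have inv': "f (h \<otimes> q \<otimes> k) = f q" if "f \<in> ?I'" "h \<in> H" "k \<in> K" "q \<in> carrier G" for f h q k
    using that by (auto simp: double_coset_invariant_iff[OF H K])
  have cs': "coset_sum K f q = int (card K) * f q" if "f \<in> ?I'" "q \<in> carrier G" for f q
    using inv'[OF that(1) subgroup.one_closed[OF H] _ that(2)] that(2) by (intro coset_sum_const[OF K]) simp
  let ?h = "\<lambda>e. reduce K (\<lambda>q. fst e q + snd e q)"
  have "card (zero_sum_inv K d \<times> ?I') \<le> card ?I"
  proof (rule card_inj_on_le[of ?h])
    show "inj_on ?h (zero_sum_inv K d \<times> ?I')"
    proof (rule inj_onI)
      fix e e' assume e: "e \<in> zero_sum_inv K d \<times> ?I'" "e' \<in> zero_sum_inv K d \<times> ?I'" and eq: "?h e = ?h e'"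
      have ran: "fst x q \<in> {0..<?N}" "snd x q \<in> {0..<?N}" if "x \<in> zero_sum_inv K d \<times> ?I'" "q \<in> carrier G" for x q
        using that sub by (auto simp: PiE_iff subset_iff)
      have s: "snd e q = snd e' q \<and> fst e q = fst e' q" if q: "q \<in> carrier G" for q
      proof -
        have dv: "?N dvd (fst e q + snd e q) - (fst e' q + snd e' q)" if "q \<in> carrier G" for q
          using reduce_eqD[OF eq that] .
        have "?N dvd coset_sum K (\<lambda>q. fst e q + snd e q - (fst e' q + snd e' q)) q"
          unfolding coset_sum_def using q subgroup.mem_carrier[OF K] by (intro dvd_sum dv) auto
        also have "coset_sum K (\<lambda>q. fst e q + snd e q - (fst e' q + snd e' q)) q
            = coset_sum K (fst e) q + coset_sum K (snd e) q - (coset_sum K (fst e') q + coset_sum K (snd e') q)"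
          by (simp add: coset_sum_def sum.distrib sum_subtractf)
        also have "\<dots> = (coset_sum K (fst e) q - coset_sum K (fst e') q) + int (card K) * (snd e q - snd e' q)"
          using cs'[of "snd e" q] cs'[of "snd e'" q] e q by (auto simp: algebra_simps)
        finally have A: "?N dvd (coset_sum K (fst e) q - coset_sum K (fst e') q) + int (card K) * (snd e q - snd e' q)" .
        have "?N dvd coset_sum K (fst e) q - coset_sum K (fst e') q"
          using e q by (auto simp: zero_sum_inv_def zero_sum_def)
        with A have "?N dvd int (card K) * (snd e q - snd e' q)" by (simp add: dvd_add_right_iff)
        \<comment> \<open>The factor \<open>card K\<close> is removed by subtracting from a multiple
          of \<open>?N\<close>, as \<open>?N - card K = 1\<close>.\<close>
        then have "?N dvd ?N * (snd e q - snd e' q) - int (card K) * (snd e q - snd e' q)" by simp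
        then have "?N dvd snd e q - snd e' q" by (simp add: algebra_simps)
        then have 1: "snd e q = snd e' q" using ran[OF e(1) q] ran[OF e(2) q] by (intro dvd_diff_mod_eq[of _ ?N]) auto
        then have "?N dvd fst e q - fst e' q" using dv[OF q] by simp
        then have "fst e q = fst e' q" using ran[OF e(1) q] ran[OF e(2) q] by (intro dvd_diff_mod_eq[of _ ?N]) auto
        with 1 show ?thesis by simp
      qed
      have "fst x \<in> carrier G \<rightarrow>\<^sub>E {0..<?N}" "snd x \<in> carrier G \<rightarrow>\<^sub>E {0..<?N}"
        if "x \<in> zero_sum_inv K d \<times> ?I'" for x
        using that sub by (simp_all add: mem_Times_iff subsetD)
      note ext = this
      have "fst e = fst e'" by (rule PiE_ext[OF ext(1)[OF e(1)] ext(1)[OF e(2)]]) (simp add: s)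
      moreover have "snd e = snd e'" by (rule PiE_ext[OF ext(2)[OF e(1)] ext(2)[OF e(2)]]) (simp add: s)
      ultimately show "e = e'" by (rule prod_eqI)
    qed
    show "?h ` (zero_sum_inv K d \<times> ?I') \<subseteq> ?I"
    proof
      fix f assume "f \<in> ?h ` (zero_sum_inv K d \<times> ?I')"
      then obtain e where e: "f = ?h e" "fst e \<in> zero_sum_inv K d" "snd e \<in> ?I'" by auto
      have "fst e (inv d \<otimes> q) = fst e q" if "q \<in> carrier G" for q
        using e(2) that by (simp add: zero_sum_inv_def)
      from invariant_generate[where f = "fst e", OF d this]
      have "fst e (h \<otimes> q) = fst e q" if "h \<in> H" "q \<in> carrier G" for h q
        using that by (simp add: H_def)
      moreover have "snd e (h \<otimes> q) = snd e q" if "h \<in> H" "q \<in> carrier G" for h q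
        using inv'[OF e(3) that(1) subgroup.one_closed[OF K] that(2)] that subgroup.mem_carrier[OF H] by simp
      ultimately have "f (h \<otimes> q \<otimes> \<one>) = f q" if "h \<in> H" "q \<in> carrier G" for h q
        using that subgroup.mem_carrier[OF H] by (simp add: e(1) reduce_def)
      then show "f \<in> ?I"
        using reduce_closed unfolding double_coset_invariant_iff[OF H triv_subgroup] e(1) by blast
    qed
    show "finite ?I" using finM by (rule finite_subset[rotated]) auto
  qed
  then have "card (zero_sum_inv K d) * (card K + 1) ^ card (carrier G // ?E') \<le> (card K + 1) ^ card (carrier G // ?E)"
    by (simp add: card_cartesian_product I I')
  moreover have "ord d * card (carrier G // ?E) = card (carrier G)"
    using card_double_cosets(2)[OF fin H triv_subgroup] by (simp add: cH)
  moreover have "card (carrier G) \<le> ord d * card K * card (carrier G // ?E')"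
    using card_double_cosets(1)[OF fin H K] by (simp add: cH)
  ultimately show ?thesis using that by blast
qed

end

lemma card_F_gens: "finite (F_gens g r s)" "card (F_gens g r s) = 2 * g + r + s"
proof -
  show "finite (F_gens g r s)" by (simp add: F_gens_def)
  have "card (F_gens g r s) = card (Gen_alpha ` {..<g}) + card (Gen_beta ` {..<g})
      + card (Gen_gamma ` {..<r}) + card (Gen_delta ` {..<s})"
    unfolding F_gens_def by (subst card_Un_disjoint; (subst card_Un_disjoint)?; (subst card_Un_disjoint)?) auto
  also have "\<dots> = 2 * g + r + s" by (simp add: card_image inj_on_def)
  finally show "card (F_gens g r s) = 2 * g + r + s" .
qed

context F_marked
begin

text \<open>Fox derivatives of functions with zero coset sums again have zero coset sums, because
  right translations commute with the left action.\<close>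

lemma coset_sum_fox:
  assumes K: "subgroup K Q" and q: "q \<in> carrier Q"
    and y: "\<And>t q. t \<in> set w \<Longrightarrow> q \<in> carrier Q \<Longrightarrow> N dvd coset_sum K (y (snd t)) q"
  shows "N dvd coset_sum K (fox Q \<xi> y w) q"
proof -
  have "coset_sum K (fox Q \<xi> y w) q = (\<Sum>k\<in>K. fox Q \<xi> (\<lambda>a q. y a (q \<otimes> k)) w q)"
    unfolding coset_sum_def using q subgroup.mem_carrier[OF K] by (intro sum.cong refl) (simp add: fox_right)
  also have "\<dots> = fox Q \<xi> (\<lambda>a q. coset_sum K (y a) q) w q"
    by (simp add: fox_sum coset_sum_def)
  also have "\<dots> \<in> {x. N dvd x}"
    using y q by (intro fox_mem add_subgroup_multiples) auto
  finally show ?thesis by simp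
qed

text \<open>Pigeonhole: the Fox equations have more solutions than there are coboundaries.\<close>

lemma noncoboundary_solution:
  assumes K: "subgroup K Q" "card K \<ge> 2"
    and ord: "\<And>l. l < s \<Longrightarrow> ord (\<xi> (Gen_delta l)) = n l"
    and hyp: "2 - 2 * real g - real r - (\<Sum>l<s. 1 - 1 / real (n l)) < 0"
  obtains y :: "F_gen \<Rightarrow> 'q \<Rightarrow> int" where
    "\<And>a q. a \<in> F_gens g r s \<Longrightarrow> q \<in> carrier Q \<Longrightarrow> (int (card K) + 1) dvd coset_sum K (y a) q"
    "\<And>w q. w \<in> F_words g r s n \<Longrightarrow> q \<in> carrier Q \<Longrightarrow> (int (card K) + 1) dvd fox Q \<xi> y w q"
    "\<And>m. (\<And>q. q \<in> carrier Q \<Longrightarrow> (int (card K) + 1) dvd coset_sum K m q) \<Longrightarrow>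
      \<exists>a\<in>F_gens g r s. \<exists>q\<in>carrier Q. \<not> (int (card K) + 1) dvd y a q - (m q - m (inv \<xi> a \<otimes> q))"
proof -
  let ?N = "int (card K) + 1"
  let ?A = "F_gens g r s"
  let ?M = "zero_sum K"
  define d where "d l = \<xi> (Gen_delta l)" for l
  let ?Md = "\<lambda>l. zero_sum_inv K (d l)"
  have finM: "finite ?M"
    by (rule finite_subset[of _ "carrier Q \<rightarrow>\<^sub>E {0..<?N}"]) (auto simp: zero_sum_def intro: finite_PiE finite_Q)
  have finMd: "finite (?Md l)" for l by (rule finite_subset[OF _ finM]) (auto simp: zero_sum_inv_def)
  obtain xc where xc: "card K * xc = card (carrier Q)" "(card K + 1) ^ card (carrier Q) \<le> card ?M * (card K + 1) ^ xc"
    by (rule card_zero_sum[OF finite_Q K(1)])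
  have "\<exists>Y z. n l * Y = card (carrier Q) \<and> card (carrier Q) \<le> n l * card K * z \<and>
      card (?Md l) * (card K + 1) ^ z \<le> (card K + 1) ^ Y" if "l < s" for l
    using card_zero_sum_inv[OF finite_Q K(1), of "d l"] ord[OF that] unfolding d_def
    by (metis \<xi>_closed)
  then obtain Y z where Yz: "\<And>l. l < s \<Longrightarrow> n l * Y l = card (carrier Q)"
    "\<And>l. l < s \<Longrightarrow> card (carrier Q) \<le> n l * card K * z l"
    "\<And>l. l < s \<Longrightarrow> card (?Md l) * (card K + 1) ^ z l \<le> (card K + 1) ^ Y l"
    by metis
  have pos: "card (carrier Q) > 0" using finite_Q one_closed by (auto simp: card_gt_0_iff)
  have count: "card ?M * card ?M * (\<Prod>l<s. card (?Md l)) < card ?M ^ (2 * g + r + s)"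
    by (rule counting_inequality[OF _ K(2) xc(1) pos xc(2) Yz hyp]) (use K(2) in auto)
  \<comment> \<open>\<open>D\<close> consists of the assignments of zero-sum functions to the
    generators, and \<Psi> evaluates all relators. The torsion relators give functions invariant
    under the corresponding elliptic generator, which makes the target \<open>E\<close> small enough
    for the count.\<close>
  define D where "D = (?A \<rightarrow>\<^sub>E ?M)"
  define E where "E = ?M \<times> (\<Pi>\<^sub>E l\<in>{..<s}. ?Md l)"
  define \<Psi> where "\<Psi> y = (reduce K (fox Q \<xi> y (prod_word g r s)),
    \<lambda>l\<in>{..<s}. reduce K (fox Q \<xi> y (pow_word n l)))" for y :: "F_gen \<Rightarrow> 'q \<Rightarrow> int"
  have yM: "y a \<in> ?M" if "y \<in> D" "a \<in> ?A" for y a using that by (auto simp: D_def)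
  have cs: "?N dvd coset_sum K (fox Q \<xi> y w) q" if "y \<in> D" "w \<in> F_words g r s n" "q \<in> carrier Q" for y w q
  proof (rule coset_sum_fox[OF K(1) that(3)])
    fix t q' assume t: "t \<in> set w" "q' \<in> carrier Q"
    have "y (snd t) \<in> ?M" using yM[OF that(1) snd_F_words[OF that(2) t(1)]] .
    then show "?N dvd coset_sum K (y (snd t)) q'" using t(2) by (simp add: zero_sum_def)
  qed
  have red: "reduce K (fox Q \<xi> y w) \<in> ?M" if "y \<in> D" "w \<in> F_words g r s n" for y w
    by (rule reduce_in_zero_sum[OF K(1)]) (rule cs[OF that])
  have \<Psi>: "\<Psi> ` D \<subseteq> E"
  proof (rule image_subsetI)
    fix y assume y: "y \<in> D"
    have "reduce K (fox Q \<xi> y (pow_word n l)) \<in> ?Md l" if l: "l < s" for l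
    proof -
      have one: "d l [^] n l = \<one>" using ord[OF l] pow_ord_eq_1[of "d l"] by (simp add: d_def)
      have "reduce K (fox Q \<xi> y (pow_word n l)) (inv (d l) \<otimes> q) = reduce K (fox Q \<xi> y (pow_word n l)) q"
        if q: "q \<in> carrier Q" for q
        using q fox_replicate_invariant[of "Gen_delta l" "n l" q y] one
        by (simp add: reduce_def pow_word_def d_def)
      then show ?thesis using red[OF y, of "pow_word n l"] l by (simp add: zero_sum_inv_def F_words_def)
    qed
    then show "\<Psi> y \<in> E" using red[OF y, of "prod_word g r s"] by (auto simp: \<Psi>_def E_def F_words_def)
  qed
  have finE: "finite E" using finM finMd by (auto simp: E_def intro!: finite_PiE)
  have DE: "card D > card ?M * card E"
    using count card_F_gens by (simp add: D_def E_def card_PiE card_cartesian_product mult.assoc)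
  obtain e where e: "card {y \<in> D. \<Psi> y = e} > card ?M"
    using pigeonhole_fibre[OF finE \<Psi> DE] by blast
  let ?F = "{y \<in> D. \<Psi> y = e}"
  have "?F \<noteq> {}" using e by (metis card.empty not_less0)
  then obtain y0 where y0: "y0 \<in> ?F" by blast
  let ?cob = "\<lambda>y m. \<forall>a\<in>?A. \<forall>q\<in>carrier Q. ?N dvd y a q - y0 a q - (m q - m (inv \<xi> a \<otimes> q))"
  \<comment> \<open>In a fibre of \<Psi> differences solve the relators modulo \<open>?N\<close>. If
    every member differed from \<open>y0\<close> by a coboundary of a zero-sum function, that
    function would determine the member, and the fibre would have at most \<open>card ?M\<close>
    elements.\<close>
  have "\<exists>y1\<in>?F. \<forall>m\<in>?M. \<not> ?cob y1 m"
  proof (rule ccontr)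
    assume "\<not> ?thesis"
    then have "\<forall>y\<in>?F. \<exists>m. m \<in> ?M \<and> ?cob y m" by blast
    from bchoice[OF this] obtain f where f: "\<forall>y\<in>?F. f y \<in> ?M \<and> ?cob y (f y)" ..
    have "card ?F \<le> card ?M"
    proof (rule card_inj_on_le[of f])
      show "inj_on f ?F"
      proof (rule inj_onI)
        fix y y' assume y: "y \<in> ?F" "y' \<in> ?F" and eq: "f y = f y'"
        show "y = y'"
        proof (rule PiE_ext[of _ ?A "\<lambda>_. ?M"])
          fix a assume a: "a \<in> ?A"
          show "y a = y' a"
          proof (rule PiE_ext[of _ "carrier Q" "\<lambda>_. {0..<?N}"])
            fix q assume q: "q \<in> carrier Q"
            let ?b = "f y q - f y (inv \<xi> a \<otimes> q)"
            have "?N dvd (y a q - y0 a q - ?b) - (y' a q - y0 a q - ?b)"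
              using bspec[OF f y(1)] bspec[OF f y(2)] a q by (rule_tac dvd_diff) (simp_all add: eq)
            then have "?N dvd y a q - y' a q" by (simp add: algebra_simps)
            moreover have "y a q \<in> {0..<?N}" "y' a q \<in> {0..<?N}"
              using yM[of y a] yM[of y' a] y a q by (auto simp: zero_sum_def PiE_iff)
            ultimately show "y a q = y' a q" by (intro dvd_diff_mod_eq) auto
          qed (use yM[of y a] yM[of y' a] y a in \<open>auto simp: zero_sum_def\<close>)
        qed (use y in \<open>auto simp: D_def\<close>)
      qed
    qed (use f finM in auto)
    then show False using e by simp
  qed
  then obtain y1 where y1: "y1 \<in> ?F" "\<forall>m\<in>?M. \<not> ?cob y1 m" by blast
  show ?thesis
  proof (rule that[of "\<lambda>a q. y1 a q - y0 a q"])
    show "?N dvd coset_sum K (\<lambda>q. y1 a q - y0 a q) q" if "a \<in> ?A" "q \<in> carrier Q" for a q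
    proof -
      have "coset_sum K (\<lambda>q. y1 a q - y0 a q) q = coset_sum K (y1 a) q - coset_sum K (y0 a) q"
        by (simp add: coset_sum_def sum_subtractf)
      moreover have "y1 a \<in> ?M" "y0 a \<in> ?M" using yM that y1(1) y0 by auto
      ultimately show ?thesis using that(2) by (simp add: zero_sum_def)
    qed
    show "?N dvd fox Q \<xi> (\<lambda>a q. y1 a q - y0 a q) w q" if w: "w \<in> F_words g r s n" and q: "q \<in> carrier Q" for w q
    proof -
      have eq: "\<Psi> y1 = \<Psi> y0" using y1(1) y0 by simp
      have "reduce K (fox Q \<xi> y1 w) = reduce K (fox Q \<xi> y0 w)"
      proof (cases "w = prod_word g r s")
        case True
        then show ?thesis using eq by (simp add: \<Psi>_def)
      next
        case False
        then obtain l where l: "l < s" "w = pow_word n l" using w by (auto simp: F_words_def)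
        have "snd (\<Psi> y1) l = snd (\<Psi> y0) l" by (simp add: eq)
        then show ?thesis using l by (simp add: \<Psi>_def)
      qed
      from reduce_eqD[OF this q] show ?thesis by (simp add: fox_diff)
    qed
    \<comment> \<open>\<open>m\<close> has arbitrary integer values with coset sums divisible by
      \<open>?N\<close>; reducing them puts it into \<open>?M\<close> and changes its coboundary
      only by multiples of \<open>?N\<close>.\<close>
    fix m assume m: "\<And>q. q \<in> carrier Q \<Longrightarrow> ?N dvd coset_sum K m q"
    have "reduce K m \<in> ?M" by (rule reduce_in_zero_sum[OF K(1) m])
    then obtain a q where aq: "a \<in> ?A" "q \<in> carrier Q"
      "\<not> ?N dvd y1 a q - y0 a q - (reduce K m q - reduce K m (inv \<xi> a \<otimes> q))"
      using y1(2) by blast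
    have "?N dvd m q' - reduce K m q'" if "q' \<in> carrier Q" for q'
      using that by (simp add: reduce_def minus_mod_eq_mult_div)
    then have "?N dvd (m q - reduce K m q) - (m (inv \<xi> a \<otimes> q) - reduce K m (inv \<xi> a \<otimes> q))"
      using aq(2) by (rule_tac dvd_diff) auto
    then have "\<not> ?N dvd y1 a q - y0 a q - (m q - m (inv \<xi> a \<otimes> q))"
      using aq(3) dvd_add[of ?N "y1 a q - y0 a q - (m q - m (inv \<xi> a \<otimes> q))"
          "(m q - reduce K m q) - (m (inv \<xi> a \<otimes> q) - reduce K m (inv \<xi> a \<otimes> q))"]
      by (auto simp: algebra_simps)
    then show "\<exists>a\<in>?A. \<exists>q\<in>carrier Q. \<not> ?N dvd y1 a q - y0 a q - (m q - m (inv \<xi> a \<otimes> q))"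
      using aq by blast
  qed
qed

end

section \<open>Orders of the elliptic generators\<close>

text \<open>Blocks of length \<open>e\<close> act trivially, so each of the \<open>k\<close> blocks
  contributes the same function. In particular the derivative is divisible by \<open>k\<close>,
  which is how a torsion relator becomes vacuous modulo \<open>k\<close>.\<close>

lemma (in marked_group) fox_replicate_mult:
  assumes "\<xi> a [^] e = \<one>" "q \<in> carrier Q"
  shows "fox Q \<xi> y (replicate (e * k) (True, a)) q = (\<Sum>i<k. fox Q \<xi> y (replicate e (True, a)) q)"
proof (induction k)
  case (Suc k)
  have "replicate (e * Suc k) (True, a) = replicate e (True, a) @ replicate (e * k) (True, a)"
    by (simp flip: replicate_add)
  then show ?case using assms Suc by (simp add: fox_append ev_replicate add.commute)
qed simp

lemma (in cocycle_context) subgroup_cocycle_zero: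
  "subgroup {x \<in> carrier G. \<forall>q\<in>carrier Q. D x q \<in> L} G"
proof (rule G.subgroupI)
  have "\<one> \<in> {x \<in> carrier G. \<forall>q\<in>carrier Q. D x q \<in> L}" using D_one by simp
  then show "{x \<in> carrier G. \<forall>q\<in>carrier Q. D x q \<in> L} \<noteq> {}" by blast
  fix x assume x: "x \<in> {x \<in> carrier G. \<forall>q\<in>carrier Q. D x q \<in> L}"
  have "D (inv x) q \<in> L" if q: "q \<in> carrier Q" for q
  proof -
    have "D (inv x) q + D x (\<psi> x \<otimes>\<^bsub>Q\<^esub> q) \<in> L" "D x (\<psi> x \<otimes>\<^bsub>Q\<^esub> q) \<in> L"
      using x q D_inv by auto
    then show ?thesis using add_subgroupD(2)[OF L] by fastforce
  qed
  then show "inv x \<in> {x \<in> carrier G. \<forall>q\<in>carrier Q. D x q \<in> L}" using x by simp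
  fix z assume z: "z \<in> {x \<in> carrier G. \<forall>q\<in>carrier Q. D x q \<in> L}"
  have "D (x \<otimes> z) q \<in> L" if q: "q \<in> carrier Q" for q
  proof -
    have "D (x \<otimes> z) q - (D x q + D z (inv\<^bsub>Q\<^esub> \<psi> x \<otimes>\<^bsub>Q\<^esub> q)) \<in> L"
      using x z q by (intro D_mult) auto
    moreover have "D x q + D z (inv\<^bsub>Q\<^esub> \<psi> x \<otimes>\<^bsub>Q\<^esub> q) \<in> L"
      using x z q by (intro add_subgroupD(4)[OF L]) auto
    ultimately show ?thesis using add_subgroupD(4)[OF L] by fastforce
  qed
  then show "x \<otimes> z \<in> {x \<in> carrier G. \<forall>q\<in>carrier Q. D x q \<in> L}" using x z by simp
qed auto

lemma (in group) pow_in_generate: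
  assumes "a \<in> carrier G"
  shows "a [^] (i::nat) \<in> generate G {a}"
proof (induction i)
  case 0
  then show ?case by (simp add: generate.one)
next
  case (Suc i)
  then show ?case using assms by (simp add: generate.eng generate.incl)
qed

lemma (in group) cyclic_commute:
  assumes "a \<in> carrier G" "carrier G = generate G {a}" "x \<in> carrier G" "y \<in> carrier G"
  shows "x \<otimes> y = y \<otimes> x"
proof -
  obtain i j :: int where "x = a [^] i" "y = a [^] j"
    using assms(2-4) generate_pow[OF assms(1)] by auto
  then show ?thesis using assms(1) by (simp add: add.commute flip: int_pow_mult)
qed

context F_presentation
begin

lemma coset_eq_one_iff:
  assumes "U \<in> open_normal" "x \<in> carrier \<Delta>"
  shows "U #> x = \<one>\<^bsub>\<Delta> Mod U\<^esub> \<longleftrightarrow> x \<in> U"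
  using coset_join1[OF _ assms(2) open_normalD(2)[OF assms(1)]] subgroup.subset[OF open_normalD(2)[OF assms(1)]]
    coset_join2[OF assms(2) open_normalD(2)[OF assms(1)]]
  by (auto simp: FactGroup_def)

lemma coset_surj:
  assumes "q \<in> carrier (\<Delta> Mod U)"
  obtains x where "x \<in> carrier \<Delta>" "q = U #> x"
  using assms by (auto simp: FactGroup_def RCOSETS_def)

lemma subgroup_vimage_coset:
  assumes U: "U \<in> open_normal" and S: "subgroup S (\<Delta> Mod U)"
  shows "subgroup {x \<in> carrier \<Delta>. U #> x \<in> S} \<Delta>" "U \<subseteq> {x \<in> carrier \<Delta>. U #> x \<in> S}"
proof -
  interpret \<psi>: group_hom \<Delta> "\<Delta> Mod U" "\<lambda>x. U #> x" by (rule quotient_marked(2)[OF U])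
  show "subgroup {x \<in> carrier \<Delta>. U #> x \<in> S} \<Delta>"
  proof (rule subgroupI)
    have "\<one> \<in> {x \<in> carrier \<Delta>. U #> x \<in> S}" using subgroup.one_closed[OF S] \<psi>.hom_one by simp
    then show "{x \<in> carrier \<Delta>. U #> x \<in> S} \<noteq> {}" by blast
    fix a assume a: "a \<in> {x \<in> carrier \<Delta>. U #> x \<in> S}"
    then show "inv a \<in> {x \<in> carrier \<Delta>. U #> x \<in> S}"
      using subgroup.m_inv_closed[OF S, of "U #> a"] \<psi>.hom_inv[of a] by auto
    fix b assume "b \<in> {x \<in> carrier \<Delta>. U #> x \<in> S}"
    with a show "a \<otimes> b \<in> {x \<in> carrier \<Delta>. U #> x \<in> S}"
      using subgroup.m_closed[OF S, of "U #> a" "U #> b"] \<psi>.hom_mult[of a b] by auto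
  qed auto
  show "U \<subseteq> {x \<in> carrier \<Delta>. U #> x \<in> S}"
  proof
    fix x assume x: "x \<in> U"
    then have xc: "x \<in> carrier \<Delta>" using subgroup.mem_carrier[OF open_normalD(2)[OF U]] by blast
    have "U #> x \<in> S"
      unfolding iffD2[OF coset_eq_one_iff[OF U xc] x] by (rule subgroup.one_closed[OF S])
    then show "x \<in> {x \<in> carrier \<Delta>. U #> x \<in> S}" using xc by simp
  qed
qed

lemma quotient_F_marked:
  assumes U: "U \<in> open_normal"
  shows "F_marked (\<Delta> Mod U) (\<lambda>a. U #> gen a) g r s"
proof -
  have "S = carrier (\<Delta> Mod U)" if S: "subgroup S (\<Delta> Mod U)" "(\<lambda>a. U #> gen a) ` gens \<subseteq> S" for S
  proof
    show "S \<subseteq> carrier (\<Delta> Mod U)" using subgroup.subset[OF S(1)] .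
    have "{x \<in> carrier \<Delta>. U #> x \<in> S} = carrier \<Delta>"
      by (rule generated_by_gens[OF U subgroup_vimage_coset[OF U S(1)]]) (use S(2) in auto)
    then show "carrier (\<Delta> Mod U) \<subseteq> S" by (auto elim!: coset_surj)
  qed
  then show ?thesis
    using quotient_marked(1)[OF U] by (simp add: F_marked_def F_marked_axioms_def)
qed

text \<open>The existence of cocycles for integers modulo \<open>N\<close>, with the values on the
  generators replaced by values on all words, which is the form in which contradictions are read
  off.\<close>

lemma solution_cocycle:
  fixes N :: int
  assumes U: "U \<in> open_normal" and N: "N > 0"
    and rel: "\<And>w q. w \<in> F_words g r s n \<Longrightarrow> q \<in> carrier (\<Delta> Mod U) \<Longrightarrow>
      N dvd fox (\<Delta> Mod U) (\<lambda>a. U #> gen a) y w q"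
  obtains D V where "cocycle_context \<Delta> (\<Delta> Mod U) (\<lambda>x. U #> x) {x. N dvd x} D"
    "\<forall>(w :: (bool \<times> F_gen) list). snd ` set w \<subseteq> gens \<longrightarrow> (\<forall>q\<in>carrier (\<Delta> Mod U).
      N dvd D (ev \<Delta> gen w) q - fox (\<Delta> Mod U) (\<lambda>a. U #> gen a) y w q)"
    "V \<in> open_normal" "V \<subseteq> U" "\<forall>v\<in>V. \<forall>q\<in>carrier (\<Delta> Mod U). N dvd D v q"
proof -
  have R: "\<exists>r\<in>{0..<N}. c - r \<in> {x. N dvd x}" for c
    using N by (intro bexI[of _ "c mod N"]) (auto simp: minus_mod_eq_mult_div)
  obtain D V where D: "cocycle_mod \<Delta> (\<Delta> Mod U) (\<lambda>x. U #> x) {x. N dvd x} D"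
    "\<And>a q. a \<in> gens \<Longrightarrow> q \<in> carrier (\<Delta> Mod U) \<Longrightarrow> D (gen a) q - y a q \<in> {x. N dvd x}"
    "V \<in> open_normal" "V \<subseteq> U" "\<And>v q. v \<in> V \<Longrightarrow> q \<in> carrier (\<Delta> Mod U) \<Longrightarrow> D v q \<in> {x. N dvd x}"
    using cocycle_exists[OF U add_subgroup_multiples _ R, of y] rel by auto
  interpret Q: marked_group "\<Delta> Mod U" "\<lambda>a. U #> gen a" by (rule quotient_marked(1)[OF U])
  have ctx: "cocycle_context \<Delta> (\<Delta> Mod U) (\<lambda>x. U #> x) {x. N dvd x} D"
    using quotient_marked(2)[OF U] D(1) add_subgroup_multiples
    by (simp add: cocycle_context_def cocycle_context_axioms_def)
  interpret D: cocycle_context \<Delta> "\<Delta> Mod U" "\<lambda>x. U #> x" "{x. N dvd x}" D by (rule ctx)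
  show ?thesis
  proof (rule that[OF ctx _ D(3,4)], intro allI impI ballI)
    fix w :: "(bool \<times> F_gen) list" and q assume w: "snd ` set w \<subseteq> gens" and q: "q \<in> carrier (\<Delta> Mod U)"
    have "D (ev \<Delta> gen w) q - fox (\<Delta> Mod U) (\<lambda>a. U #> gen a) (\<lambda>a. D (gen a)) w q \<in> {x. N dvd x}"
      by (rule D.D_word) (use q in auto)
    moreover have "fox (\<Delta> Mod U) (\<lambda>a. U #> gen a) (\<lambda>a. D (gen a)) w q
        - fox (\<Delta> Mod U) (\<lambda>a. U #> gen a) y w q \<in> {x. N dvd x}"
      using D(2) w q by (intro Q.fox_diff_mem add_subgroup_multiples) auto
    ultimately show "N dvd D (ev \<Delta> gen w) q - fox (\<Delta> Mod U) (\<lambda>a. U #> gen a) y w q"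
      using add_subgroup_diff_trans[OF add_subgroup_multiples] by blast
  qed (use D(5) in auto)
qed

lemma delta_power_one: "l < s \<Longrightarrow> gen (Gen_delta l) [^] n l = \<one>"
  using relator_one[of "pow_word n l"] ev_replicate[of gen "n l" "Gen_delta l"]
  by (auto simp: F_words_def pow_word_def)

lemma quotient_power:
  assumes "U \<in> open_normal" "x \<in> carrier \<Delta>"
  shows "(U #> x) [^]\<^bsub>\<Delta> Mod U\<^esub> (i::nat) = U #> (x [^] i)"
  using group_hom.hom_nat_pow[OF quotient_marked(2)[OF assms(1)] assms(2), of i] by simp

lemma delta_in_gens: "l < s \<Longrightarrow> Gen_delta l \<in> gens" by (simp add: F_gens_def)

text \<open>If \<open>\<delta>\<^sub>l\<close> has too small an order \<open>e\<close>, then modulo \<open>N = n\<^sub>l / e\<close> its torsion relation imposes no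
  condition on \<open>y \<delta>\<^sub>l\<close>, and a cocycle that does not vanish on \<open>\<delta>\<^sub>l\<^sup>e\<close> can be written down.\<close>

lemma small_order_cyclic:
  assumes U: "U \<in> open_normal" and l: "l < s" and e: "gen (Gen_delta l) [^] e = \<one>" "e * N = n l" "N \<ge> 2"
    and ord: "\<And>i. i < e \<Longrightarrow> gen (Gen_delta l) [^] i \<in> U \<Longrightarrow> i = 0" "e > 0"
  shows "r = 0 \<and> carrier (\<Delta> Mod U) = generate (\<Delta> Mod U) {U #> gen (Gen_delta l)}"
proof (rule ccontr)
  define Q where "Q = \<Delta> Mod U"
  define \<xi> where "\<xi> = (\<lambda>a. U #> gen a)"
  define d where "d = \<xi> (Gen_delta l)"
  interpret Q: F_marked Q \<xi> g r s unfolding Q_def \<xi>_def by (rule quotient_F_marked[OF U])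
  have dc: "d \<in> carrier Q" by (simp add: d_def)
  assume "\<not> ?thesis"
  then have nt: "r > 0 \<or> carrier Q \<noteq> generate Q {d}" by (auto simp: Q_def d_def \<xi>_def)
  have sub: "generate Q {d} \<subseteq> carrier Q" using dc by (intro Q.generate_incl) simp
  obtain q0 where q0: "q0 \<in> carrier Q" "r = 0 \<Longrightarrow> q0 \<notin> generate Q {d}"
    using nt sub dc by (cases "r = 0") auto
  \<comment> \<open>A point mass at the identity. Without punctures the surface relator can only be
    repaired when the total is zero, so a second mass is subtracted at \<open>q0\<close>, outside
    the powers of \<open>d\<close>, where it stays invisible in the derivative of powers of the
    generator at the identity.\<close>
  define f0 :: "'a set \<Rightarrow> int" where "f0 q = (if q = \<one>\<^bsub>Q\<^esub> then 1 else 0) - (if r = 0 \<and> q = q0 then 1 else 0)" for q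
  define y0 where "y0 a q = (if a = Gen_delta l then f0 q else 0)" for a q
  obtain u v where uv: "prod_word g r s = u @ [(True, Gen_delta l)] @ v"
    "Gen_delta l \<notin> snd ` set u" "Gen_delta l \<notin> snd ` set v"
    using Q.prod_word_split_delta[OF l] by blast
  have y0W: "fox Q \<xi> y0 (prod_word g r s) q = f0 (inv\<^bsub>Q\<^esub> ev Q \<xi> u \<otimes>\<^bsub>Q\<^esub> q)" if "q \<in> carrier Q" for q
    unfolding uv(1) by (subst Q.fox_single_gen[OF uv(2,3)]) (use that in \<open>auto simp: y0_def\<close>)
  have "(\<Sum>q\<in>carrier Q. - fox Q \<xi> y0 (prod_word g r s) q) = 0" if r: "r = 0"
  proof -
    have "(\<Sum>q\<in>carrier Q. fox Q \<xi> y0 (prod_word g r s) q) = (\<Sum>q\<in>carrier Q. f0 (inv\<^bsub>Q\<^esub> ev Q \<xi> u \<otimes>\<^bsub>Q\<^esub> q))"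
      using y0W by simp
    also have "\<dots> = (\<Sum>q\<in>carrier Q. f0 q)" by (rule Q.sum_translate) simp
    also have "\<dots> = 0" using r q0(1) Q.finite_Q by (simp add: f0_def sum_subtractf)
    finally show ?thesis by (simp add: sum_negf)
  qed
  then have "Q.attained UNIV (\<lambda>q. - fox Q \<xi> y0 (prod_word g r s) q)"
    by (intro Q.attained_sum_zero add_subgroup_UNIV) auto
  then obtain y1 where y1: "Q.good UNIV y1"
    "\<forall>q\<in>carrier Q. fox Q \<xi> y1 (prod_word g r s) q = - fox Q \<xi> y0 (prod_word g r s) q"
    unfolding Q.attained_def by blast
  define y where "y a q = y0 a q + y1 a q" for a q
  have y1_pow: "fox Q \<xi> y1 (replicate k (True, Gen_delta j)) q = 0"
    if j: "j < s" "\<xi> (Gen_delta j) [^]\<^bsub>Q\<^esub> k = \<one>\<^bsub>Q\<^esub>" "q \<in> carrier Q" for j k q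
  proof -
    obtain f where "\<forall>q\<in>carrier Q. y1 (Gen_delta j) q = f q - f (inv\<^bsub>Q\<^esub> \<xi> (Gen_delta j) \<otimes>\<^bsub>Q\<^esub> q)"
      using y1(1) j(1) unfolding Q.good_def by blast
    then show ?thesis by (intro Q.fox_replicate_difference[where f = f, OF _ j(2,3)]) blast
  qed
  have pow: "\<xi> (Gen_delta j) [^]\<^bsub>Q\<^esub> k = U #> (gen (Gen_delta j) [^] k)" for j and k :: nat
    unfolding \<xi>_def Q_def by (rule quotient_power[OF U]) simp
  have one: "U #> \<one> = \<one>\<^bsub>Q\<^esub>" using coset_eq_one_iff[OF U] subgroup.one_closed[OF open_normalD(2)[OF U]] by (simp add: Q_def)
  have de: "\<xi> (Gen_delta l) [^]\<^bsub>Q\<^esub> e = \<one>\<^bsub>Q\<^esub>" using e(1) by (simp add: pow one)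
  have dvd: "int N dvd fox Q \<xi> y w q" if w: "w \<in> F_words g r s n" and q: "q \<in> carrier Q" for w q
  proof (cases "w = prod_word g r s")
    case True
    then show ?thesis using y1(2) q by (simp add: y_def[abs_def] Q.fox_add)
  next
    case False
    then obtain j where j: "j < s" "w = pow_word n j" using w by (auto simp: F_words_def)
    have z1: "fox Q \<xi> y1 w q = 0"
      unfolding j(2) pow_word_def using delta_power_one[OF j(1)] j q by (intro y1_pow) (simp_all add: pow one)
    have "int N dvd fox Q \<xi> y0 w q"
    proof (cases "j = l")
      case True
      have "w = replicate (e * N) (True, Gen_delta l)" using j True e(2) by (simp add: pow_word_def)
      then have "fox Q \<xi> y0 w q = (\<Sum>i<N. fox Q \<xi> y0 (replicate e (True, Gen_delta l)) q)"
        using Q.fox_replicate_mult[where y = y0 and k = N, OF de q] by simp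
      then show ?thesis by simp
    next
      case False
      then show ?thesis using q by (subst Q.fox_zero) (auto simp: j(2) pow_word_def y0_def)
    qed
    then show ?thesis using z1 by (simp add: y_def[abs_def] Q.fox_add)
  qed
  have "int N > 0" using e(3) by simp
  from solution_cocycle[OF U this dvd[unfolded Q_def \<xi>_def]]
  obtain D V where D: "cocycle_context \<Delta> (\<Delta> Mod U) (\<lambda>x. U #> x) {x. int N dvd x} D"
    "\<forall>(w :: (bool \<times> F_gen) list). snd ` set w \<subseteq> gens \<longrightarrow> (\<forall>q\<in>carrier (\<Delta> Mod U).
      int N dvd D (ev \<Delta> gen w) q - fox (\<Delta> Mod U) (\<lambda>a. U #> gen a) y w q)"
    "V \<in> open_normal" "V \<subseteq> U" "\<forall>v\<in>V. \<forall>q\<in>carrier (\<Delta> Mod U). int N dvd D v q" .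
  interpret D: cocycle_context \<Delta> "\<Delta> Mod U" "\<lambda>x. U #> x" "{x. int N dvd x}" D by (rule D(1))
  let ?w = "replicate e (True, Gen_delta l)"
  have "ev \<Delta> gen ?w = \<one>" using e(1) by (simp add: ev_replicate)
  moreover have "snd ` set ?w \<subseteq> gens" using delta_in_gens[OF l] by auto
  ultimately have 1: "int N dvd D \<one> \<one>\<^bsub>Q\<^esub> - fox Q \<xi> y ?w \<one>\<^bsub>Q\<^esub>"
    using D(2)[folded Q_def \<xi>_def] Q.one_closed by metis
  have 2: "int N dvd D \<one> \<one>\<^bsub>Q\<^esub>" using D.D_one[folded Q_def] Q.one_closed by blast
  have "int N dvd fox Q \<xi> y ?w \<one>\<^bsub>Q\<^esub>" using dvd_diff[OF 2 1] by simp
  \<comment> \<open>Among the points visited by the norm of length \<open>e\<close> the identity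
    occurs exactly once, since \<open>e\<close> is the exact order in \<open>Q\<close>, and
    \<open>q0\<close> does not occur.\<close>
  moreover have "fox Q \<xi> y ?w \<one>\<^bsub>Q\<^esub> = 1"
  proof -
    have "fox Q \<xi> y ?w \<one>\<^bsub>Q\<^esub> = fox Q \<xi> y0 ?w \<one>\<^bsub>Q\<^esub>"
      using y1_pow[OF l de, of "\<one>\<^bsub>Q\<^esub>"] by (simp add: y_def[abs_def] Q.fox_add)
    also have "\<dots> = (\<Sum>i<e. f0 (inv\<^bsub>Q\<^esub> (d [^]\<^bsub>Q\<^esub> i)))"
      by (simp add: Q.fox_replicate y0_def d_def)
    also have "\<dots> = (\<Sum>i<e. if i = 0 then 1 else 0)"
    proof (intro sum.cong refl)
      fix i assume i: "i \<in> {..<e}"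
      have "d [^]\<^bsub>Q\<^esub> i \<in> generate Q {d}"
        by (rule Q.pow_in_generate[OF dc])
      then have "inv\<^bsub>Q\<^esub> (d [^]\<^bsub>Q\<^esub> i) \<in> generate Q {d}"
        using dc by (intro Q.generate_m_inv_closed) auto
      then have 1: "r = 0 \<Longrightarrow> inv\<^bsub>Q\<^esub> (d [^]\<^bsub>Q\<^esub> i) \<noteq> q0" using q0(2) by blast
      have "inv\<^bsub>Q\<^esub> (d [^]\<^bsub>Q\<^esub> i) = \<one>\<^bsub>Q\<^esub> \<longleftrightarrow> d [^]\<^bsub>Q\<^esub> i = \<one>\<^bsub>Q\<^esub>" using dc by simp
      also have "\<dots> \<longleftrightarrow> gen (Gen_delta l) [^] i \<in> U"
        unfolding d_def pow by (simp add: Q_def coset_eq_one_iff[OF U] del: one_FactGroup)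
      also have "\<dots> \<longleftrightarrow> i = 0"
        using ord(1)[of i] i subgroup.one_closed[OF open_normalD(2)[OF U]] by auto
      finally show "f0 (inv\<^bsub>Q\<^esub> (d [^]\<^bsub>Q\<^esub> i)) = (if i = 0 then 1 else 0)" using 1 by (auto simp: f0_def)
    qed
    also have "\<dots> = 1" using ord(2) by simp
    finally show ?thesis .
  qed
  ultimately show False using e(3) by simp
qed

text \<open>The image of \<open>S\<close> contains a generator of the cyclic quotient, hence is
  everything, and \<open>S\<close> contains the kernel \<open>V\<close>.\<close>

lemma cyclic_quotient_subgroup:
  assumes V: "V \<in> open_normal" and d: "d \<in> carrier \<Delta>"
    and cyc: "carrier (\<Delta> Mod V) = generate (\<Delta> Mod V) {V #> d}"
    and S: "subgroup S \<Delta>" "V \<subseteq> S" "d \<in> S"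
  shows "S = carrier \<Delta>"
proof
  show "S \<subseteq> carrier \<Delta>" using subgroup.subset[OF S(1)] .
  interpret \<psi>: group_hom \<Delta> "\<Delta> Mod V" "\<lambda>x. V #> x" by (rule quotient_marked(2)[OF V])
  have "subgroup ((\<lambda>x. V #> x) ` S) (\<Delta> Mod V)" by (rule \<psi>.subgroup_img_is_subgroup[OF S(1)])
  then have "generate (\<Delta> Mod V) {V #> d} \<subseteq> (\<lambda>x. V #> x) ` S"
    using S(3) by (intro \<psi>.H.generate_subgroup_incl) auto
  then have sub: "carrier (\<Delta> Mod V) \<subseteq> (\<lambda>x. V #> x) ` S" using cyc by simp
  show "carrier \<Delta> \<subseteq> S"
  proof
    fix x assume x: "x \<in> carrier \<Delta>"
    then have "V #> x \<in> (\<lambda>x. V #> x) ` S" using sub \<psi>.hom_closed by blast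
    then obtain y where y: "y \<in> S" "V #> x = V #> y" by blast
    have yc: "y \<in> carrier \<Delta>" using subgroup.mem_carrier[OF S(1) y(1)] .
    have "x \<in> V #> y" using rcos_self[OF x open_normalD(2)[OF V]] y(2) by simp
    then obtain v where "v \<in> V" "x = v \<otimes> y" unfolding r_coset_def by blast
    then show "x \<in> S" using S(2) y(1) subgroup.m_closed[OF S(1)] by blast
  qed
qed

text \<open>Torsion-freeness of \<open>U\<close> keeps the order of each elliptic generator
  unchanged in \<Delta> modulo \<open>V\<close> for all open normal \<open>V\<close> contained in
  \<open>U\<close>. If one order were too small, all these quotients would be generated by that
  element, and there would be no punctures. This is refuted by a homomorphism modulo 2 if the genus
  is positive, and otherwise by a crossed homomorphism modulo 3 that is nonzero on a
  commutator.\<close>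

lemma delta_order:
  assumes n2: "\<And>l. l < s \<Longrightarrow> n l \<ge> 2"
    and hyp: "2 - 2 * real g - real r - (\<Sum>l<s. 1 - 1 / real (n l)) < 0"
    and U: "U \<in> open_normal" "torsion_free_on \<Delta> U" "U \<noteq> carrier \<Delta>" and l: "l < s"
  shows "ord (gen (Gen_delta l)) = n l"
proof (rule ccontr)
  define e where "e j = ord (gen (Gen_delta j))" for j
  have e_dvd: "e j dvd n j" if "j < s" for j
    using delta_power_one[OF that] pow_eq_id[of "gen (Gen_delta j)" "n j"] by (simp add: e_def)
  have e_pos: "e j > 0" if "j < s" for j using e_dvd[OF that] n2[OF that] by (cases "e j") auto
  have tors: "gen (Gen_delta j) [^] i = \<one>" if "j < s" "gen (Gen_delta j) [^] i \<in> U" for j and i :: nat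
  proof -
    have "(gen (Gen_delta j) [^] i) [^] n j = (gen (Gen_delta j) [^] n j) [^] i"
      by (simp add: nat_pow_pow mult.commute)
    also have "\<dots> = \<one>" using delta_power_one[OF that(1)] by simp
    finally have "(gen (Gen_delta j) [^] i) [^] n j = \<one>" .
    moreover have "n j > 0" using n2[OF that(1)] by simp
    ultimately show ?thesis using U(2) that(2) unfolding torsion_free_on_def by blast
  qed
  have small: "r = 0 \<and> carrier (\<Delta> Mod V) = generate (\<Delta> Mod V) {V #> gen (Gen_delta j)}"
    if j: "j < s" "e j \<noteq> n j" and V: "V \<in> open_normal" "V \<subseteq> U" for j V
  proof -
    obtain N where N: "n j = e j * N" using e_dvd[OF j(1)] by (auto simp: dvd_def)
    have "N \<noteq> 0" "N \<noteq> 1" using N j(2) n2[OF j(1)] by (cases "N = 0"; simp)+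
    then have N2: "N \<ge> 2" by simp
    show ?thesis
    proof (rule small_order_cyclic[OF V(1) j(1) _ N[symmetric] N2 _ e_pos[OF j(1)]])
      show "gen (Gen_delta j) [^] e j = \<one>" by (simp add: e_def pow_ord_eq_1)
      fix i assume i: "i < e j" "gen (Gen_delta j) [^] i \<in> V"
      then have "gen (Gen_delta j) [^] i = \<one>" using V(2) tors[OF j(1)] by blast
      then have "e j dvd i" by (simp add: e_def pow_eq_id)
      then show "i = 0" using i(1) nat_dvd_not_less by blast
    qed
  qed
  assume "ord (gen (Gen_delta l)) \<noteq> n l"
  then have el: "e l \<noteq> n l" by (simp add: e_def)
  note sl = small[OF l el]
  have r: "r = 0" using sl[OF U(1)] by simp
  define Q where "Q = \<Delta> Mod U"
  define \<xi> where "\<xi> = (\<lambda>a. U #> gen a)"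
  interpret Q: F_marked Q \<xi> g r s unfolding Q_def \<xi>_def by (rule quotient_F_marked[OF U(1)])
  define d where "d = \<xi> (Gen_delta l)"
  have dc: "d \<in> carrier Q" by (simp add: d_def)
  have cyc: "carrier Q = generate Q {d}" using sl[OF U(1)] by (simp add: Q_def d_def \<xi>_def)
  have one: "U #> \<one> = \<one>\<^bsub>Q\<^esub>"
    using coset_eq_one_iff[OF U(1)] subgroup.one_closed[OF open_normalD(2)[OF U(1)]] by (simp add: Q_def)
  have pow: "\<xi> (Gen_delta j) [^]\<^bsub>Q\<^esub> k = U #> (gen (Gen_delta j) [^] k)" for j and k :: nat
    unfolding \<xi>_def Q_def by (rule quotient_power[OF U(1)]) simp
  show False
  proof (cases "g = 0")
    case False
    \<comment> \<open>Constant functions, so this is an ordinary homomorphism modulo 2 that counts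
      one handle generator. It vanishes on the supposed topological generator but not on the handle
      generator.\<close>
    define y :: "F_gen \<Rightarrow> 'a set \<Rightarrow> int" where "y a q = (if a = Gen_alpha 0 then 1 else 0)" for a q
    have c: "fox Q \<xi> y (concat (map comm_word is)) q = 0" if "q \<in> carrier Q" for "is" q
      using that
    proof (induction "is" arbitrary: q)
      case (Cons i "is")
      have "fox Q \<xi> y (comm_word i) q = 0" by (simp add: comm_word_def y_def)
      then show ?case using Cons by (simp add: Q.fox_append)
    qed simp
    have dvd: "2 dvd fox Q \<xi> y w q" if w: "w \<in> F_words g r s n" and q: "q \<in> carrier Q" for w q
    proof (cases "w = prod_word g r s")
      case True
      have "fox Q \<xi> y (map (\<lambda>l. (True, Gen_delta l)) [0..<s]) q = 0" if "q \<in> carrier Q" for q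
        using that by (intro Q.fox_zero) (auto simp: y_def)
      then show ?thesis using c q by (simp add: True prod_word_def r Q.fox_append)
    next
      case False
      then show ?thesis using w q by (subst Q.fox_zero) (auto simp: F_words_def pow_word_def y_def)
    qed
    have "(2::int) > 0" by simp
    from solution_cocycle[OF U(1) this dvd[unfolded Q_def \<xi>_def]]
    obtain D V where D: "cocycle_context \<Delta> (\<Delta> Mod U) (\<lambda>x. U #> x) {x. 2 dvd x} D"
      "\<forall>(w :: (bool \<times> F_gen) list). snd ` set w \<subseteq> gens \<longrightarrow> (\<forall>q\<in>carrier (\<Delta> Mod U).
        2 dvd D (ev \<Delta> gen w) q - fox (\<Delta> Mod U) (\<lambda>a. U #> gen a) y w q)"
      "V \<in> open_normal" "V \<subseteq> U" "\<forall>v\<in>V. \<forall>q\<in>carrier (\<Delta> Mod U). 2 dvd D v q" .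
    interpret D: cocycle_context \<Delta> "\<Delta> Mod U" "\<lambda>x. U #> x" "{x. 2 dvd x}" D by (rule D(1))
    have word: "2 dvd D (gen a) q - y a q" if "a \<in> gens" "q \<in> carrier Q" for a q
    proof -
      have "snd ` set [(True, a)] \<subseteq> gens" using that by simp
      from D(2)[rule_format, OF this that(2)[unfolded Q_def]] show ?thesis by simp
    qed
    let ?S = "{x \<in> carrier \<Delta>. \<forall>q\<in>carrier (\<Delta> Mod U). D x q \<in> {x. 2 dvd x}}"
    have "?S = carrier \<Delta>"
    proof (rule cyclic_quotient_subgroup[OF D(3) _ _ D.subgroup_cocycle_zero])
      show "carrier (\<Delta> Mod V) = generate (\<Delta> Mod V) {V #> gen (Gen_delta l)}"
        using sl[OF D(3,4)] by simp
      show "V \<subseteq> ?S" using D(5) subgroup.mem_carrier[OF open_normalD(2)[OF D(3)]] by blast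
      show "gen (Gen_delta l) \<in> ?S"
        using word[OF delta_in_gens[OF l]] by (simp add: y_def Q_def)
    qed simp
    then have "gen (Gen_alpha 0) \<in> ?S" by simp
    then have "2 dvd D (gen (Gen_alpha 0)) \<one>\<^bsub>Q\<^esub>" using Q.one_closed unfolding Q_def by blast
    moreover have "2 dvd D (gen (Gen_alpha 0)) \<one>\<^bsub>Q\<^esub> - 1"
      using word[of "Gen_alpha 0" "\<one>\<^bsub>Q\<^esub>"] False by (simp add: y_def F_gens_def)
    ultimately show False by (auto dest: dvd_diff)
  next
    case True
    have "(\<Sum>l<s. 1 - 1 / real (n l)) \<le> (\<Sum>l<s. 1)" by (intro sum_mono) simp
    then have s3: "s \<ge> 3" using hyp True r by simp
    \<comment> \<open>A generator trivial in \<open>Q\<close> lies in \<open>U\<close> and is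
      torsion, so it is trivial in \<Delta> and its order 1 is also too small. Then the trivial
      element would generate \<open>Q\<close>, whereas \<open>U\<close> is proper.\<close>
    have nt: "\<xi> (Gen_delta j) \<noteq> \<one>\<^bsub>Q\<^esub>" if j: "j < s" for j
    proof
      assume "\<xi> (Gen_delta j) = \<one>\<^bsub>Q\<^esub>"
      then have "gen (Gen_delta j) \<in> U" by (simp add: \<xi>_def Q_def coset_eq_one_iff[OF U(1)] del: one_FactGroup)
      then have g1: "gen (Gen_delta j) = \<one>" using tors[OF j, of 1] by simp
      then have "e j = 1" by (simp add: e_def)
      then have "e j \<noteq> n j" using n2[OF j] by simp
      from small[OF j this U(1)] g1 have cyc1: "carrier (\<Delta> Mod U) = generate (\<Delta> Mod U) {U #> \<one>}" by simp
      have "U = carrier \<Delta>"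
        by (rule cyclic_quotient_subgroup[OF U(1) _ cyc1 open_normalD(2)[OF U(1)]])
          (use subgroup.one_closed[OF open_normalD(2)[OF U(1)]] in auto)
      then show False using U(3) by simp
    qed
    obtain j j' where jj: "j < s" "j' < s" "j \<noteq> j'" "j \<noteq> l" "j' \<noteq> l"
    proof -
      have "card ({..<s} - {l}) \<ge> 2" using s3 l by simp
      then obtain j where j: "j \<in> {..<s} - {l}" by (metis card.empty ex_in_conv not_numeral_le_zero)
      have "card ({..<s} - {l} - {j}) \<ge> 1" using s3 l j by simp
      then obtain j' where "j' \<in> {..<s} - {l} - {j}" by (metis card.empty ex_in_conv not_one_le_zero)
      then show ?thesis using j that[of j j'] by auto
    qed
    define f :: "'a set \<Rightarrow> int" where "f q = (if q = \<one>\<^bsub>Q\<^esub> then 1 else 0)" for q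
    define z where "z = \<xi> (Gen_delta j')"
    have zc: "z \<in> carrier Q" by (simp add: z_def)
    \<comment> \<open>The difference of a point mass, placed on one elliptic generator, so that its
      torsion relator holds. The surface relator is then repaired by \<open>y1\<close> at
      \<open>Gen_delta l\<close>, whose image generates \<open>Q\<close>.\<close>
    define y0 where "y0 a q = (if a = Gen_delta j' then f q - f (inv\<^bsub>Q\<^esub> z \<otimes>\<^bsub>Q\<^esub> q) else 0)" for a q
    obtain u v where uv: "prod_word g r s = u @ [(True, Gen_delta l)] @ v"
      "Gen_delta l \<notin> snd ` set u" "Gen_delta l \<notin> snd ` set v"
      using Q.prod_word_split_delta[OF l] by blast
    define P where "P = ev Q \<xi> u"
    have Pc: "P \<in> carrier Q" by (simp add: P_def)
    define h where "h q = - fox Q \<xi> y0 (prod_word g r s) (P \<otimes>\<^bsub>Q\<^esub> q)" for q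
    define y1 where "y1 a q = (if a = Gen_delta l then h q else 0)" for a q
    define y where "y a q = y0 a q + y1 a q" for a q
    have S0: "(\<Sum>q\<in>carrier Q. y0 a q) = 0" for a
      using Q.sum_translate[of "inv\<^bsub>Q\<^esub> z" f] zc by (cases "a = Gen_delta j'") (simp_all add: y0_def sum_subtractf)
    have "(\<Sum>q\<in>carrier Q. fox Q \<xi> y0 (prod_word g r s) q) = 0"
      unfolding Q.sum_fox by (rule sum_list_zero_all) (auto simp: S0)
    then have Sh: "(\<Sum>q\<in>carrier Q. h q) = 0"
      using Q.sum_translate[OF Pc, of "fox Q \<xi> y0 (prod_word g r s)"] by (simp add: h_def sum_negf)
    have y1W: "fox Q \<xi> y1 (prod_word g r s) q = - fox Q \<xi> y0 (prod_word g r s) q" if q: "q \<in> carrier Q" for q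
    proof -
      have "fox Q \<xi> y1 (prod_word g r s) q = fox Q \<xi> y1 [(True, Gen_delta l)] (inv\<^bsub>Q\<^esub> P \<otimes>\<^bsub>Q\<^esub> q)"
        unfolding uv(1) P_def using uv(2,3) q by (intro Q.fox_single_gen) (auto simp: y1_def)
      also have "\<dots> = h (inv\<^bsub>Q\<^esub> P \<otimes>\<^bsub>Q\<^esub> q)" by (simp add: y1_def)
      also have "\<dots> = - fox Q \<xi> y0 (prod_word g r s) q"
        using q Pc by (simp add: h_def Q.m_assoc[symmetric])
      finally show ?thesis .
    qed
    have npow: "\<xi> (Gen_delta k) [^]\<^bsub>Q\<^esub> n k = \<one>\<^bsub>Q\<^esub>" if "k < s" for k
      using delta_power_one[OF that] by (simp add: pow one)
    \<comment> \<open>The norm of \<open>h\<close> along \<open>d\<close> is invariant under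
      \<open>d\<close>, hence constant because \<open>d\<close> generates \<open>Q\<close>. The
      constant is zero because \<open>h\<close> has sum zero.\<close>
    have y1pow: "fox Q \<xi> y1 (pow_word n l) q = 0" if q: "q \<in> carrier Q" for q
    proof -
      let ?F = "fox Q \<xi> y1 (pow_word n l)"
      have inv: "?F (inv\<^bsub>Q\<^esub> d \<otimes>\<^bsub>Q\<^esub> q) = ?F q" if "q \<in> carrier Q" for q
        unfolding pow_word_def d_def by (rule Q.fox_replicate_invariant[OF npow[OF l] that])
      have const: "?F q = ?F \<one>\<^bsub>Q\<^esub>" if "q \<in> carrier Q" for q
        using Q.invariant_generate[where f = ?F, OF dc inv, of q "\<one>\<^bsub>Q\<^esub>"] that cyc Q.one_closed by simp
      have "(\<Sum>q\<in>carrier Q. ?F q) = 0"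
        unfolding Q.sum_fox using Sh by (intro sum_list_zero_all) (auto simp: pow_word_def y1_def)
      moreover have "(\<Sum>q\<in>carrier Q. ?F q) = (\<Sum>q\<in>carrier Q. ?F \<one>\<^bsub>Q\<^esub>)" by (intro sum.cong refl const)
      ultimately have "int (card (carrier Q)) * ?F \<one>\<^bsub>Q\<^esub> = 0" by simp
      moreover have "card (carrier Q) > 0" using Q.finite_Q Q.one_closed by (auto simp: card_gt_0_iff)
      ultimately show ?thesis using const[OF q] by simp
    qed
    have zero: "fox Q \<xi> y w q = 0" if w: "w \<in> F_words g r s n" and q: "q \<in> carrier Q" for w q
    proof (cases "w = prod_word g r s")
      case True
      then show ?thesis using y1W[OF q] by (simp add: y_def[abs_def] Q.fox_add)
    next
      case False
      then obtain k where k: "k < s" "w = pow_word n k" using w by (auto simp: F_words_def)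
      have "fox Q \<xi> y1 w q = 0"
      proof (cases "k = l")
        case False
        then show ?thesis using q by (intro Q.fox_zero) (auto simp: k(2) pow_word_def y1_def)
      qed (use y1pow q k in simp)
      moreover have "fox Q \<xi> y0 w q = 0"
      proof (cases "k = j'")
        case True
        then show ?thesis
          using Q.fox_replicate_difference[where f = f, OF _ npow[OF k(1)] q, of y0]
          by (simp add: k(2) pow_word_def y0_def z_def)
      next
        case False
        then show ?thesis using q by (intro Q.fox_zero) (auto simp: k(2) pow_word_def y0_def)
      qed
      ultimately show ?thesis by (simp add: y_def[abs_def] Q.fox_add)
    qed
    \<comment> \<open>The derivative of the commutator below at the identity is -2 if the images of
      the two generators are inverse to each other and -1 otherwise. The modulus 3 divides
      neither.\<close>
    have dvd: "3 dvd fox Q \<xi> y w q" if "w \<in> F_words g r s n" "q \<in> carrier Q" for w q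
      using zero[OF that] by simp
    have "(3::int) > 0" by simp
    from solution_cocycle[OF U(1) this dvd[unfolded Q_def \<xi>_def]]
    obtain D V where D: "cocycle_context \<Delta> (\<Delta> Mod U) (\<lambda>x. U #> x) {x. 3 dvd x} D"
      "\<forall>(w :: (bool \<times> F_gen) list). snd ` set w \<subseteq> gens \<longrightarrow> (\<forall>q\<in>carrier (\<Delta> Mod U).
        3 dvd D (ev \<Delta> gen w) q - fox (\<Delta> Mod U) (\<lambda>a. U #> gen a) y w q)"
      "V \<in> open_normal" "V \<subseteq> U" "\<forall>v\<in>V. \<forall>q\<in>carrier (\<Delta> Mod U). 3 dvd D v q" .
    let ?w = "[(True, Gen_delta j), (True, Gen_delta j'), (False, Gen_delta j), (False, Gen_delta j')]"
    have "ev \<Delta> gen ?w \<in> V"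
    proof -
      interpret \<psi>: group_hom \<Delta> "\<Delta> Mod V" "\<lambda>x. V #> x" by (rule quotient_marked(2)[OF D(3)])
      let ?a = "V #> gen (Gen_delta j)" and ?b = "V #> gen (Gen_delta j')"
      have ab: "?a \<in> carrier (\<Delta> Mod V)" "?b \<in> carrier (\<Delta> Mod V)" using \<psi>.hom_closed by auto
      have "?a \<otimes>\<^bsub>\<Delta> Mod V\<^esub> ?b = ?b \<otimes>\<^bsub>\<Delta> Mod V\<^esub> ?a"
        by (rule \<psi>.H.cyclic_commute[OF \<psi>.hom_closed[OF gen_closed] conjunct2[OF sl[OF D(3,4)]] ab])
      then have "V #> (gen (Gen_delta j) \<otimes> gen (Gen_delta j')) = V #> (gen (Gen_delta j') \<otimes> gen (Gen_delta j))"
        using \<psi>.hom_mult[of "gen (Gen_delta j)" "gen (Gen_delta j')"] \<psi>.hom_mult[of "gen (Gen_delta j')" "gen (Gen_delta j)"]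
        by simp
      then have "gen (Gen_delta j) \<otimes> gen (Gen_delta j') \<in> V #> (gen (Gen_delta j') \<otimes> gen (Gen_delta j))"
        using rcos_self[OF _ open_normalD(2)[OF D(3)], of "gen (Gen_delta j) \<otimes> gen (Gen_delta j')"] by simp
      then obtain v where v: "v \<in> V" "gen (Gen_delta j) \<otimes> gen (Gen_delta j') = v \<otimes> (gen (Gen_delta j') \<otimes> gen (Gen_delta j))"
        unfolding r_coset_def by blast
      have vc: "v \<in> carrier \<Delta>" using subgroup.mem_carrier[OF open_normalD(2)[OF D(3)] v(1)] .
      have "ev \<Delta> gen ?w = (gen (Gen_delta j) \<otimes> gen (Gen_delta j')) \<otimes> inv (gen (Gen_delta j') \<otimes> gen (Gen_delta j))"
        by (simp add: m_assoc inv_mult_group)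
      also have "\<dots> = v" unfolding v(2) using vc by (simp add: m_assoc)
      finally show ?thesis using v(1) by simp
    qed
    then have 1: "3 dvd D (ev \<Delta> gen ?w) \<one>\<^bsub>Q\<^esub>" using D(5) Q.one_closed unfolding Q_def by blast
    have "snd ` set ?w \<subseteq> gens" using delta_in_gens jj by simp
    then have 2: "3 dvd D (ev \<Delta> gen ?w) \<one>\<^bsub>Q\<^esub> - fox Q \<xi> y ?w \<one>\<^bsub>Q\<^esub>"
      using D(2)[folded Q_def \<xi>_def] Q.one_closed by blast
    have 3: "3 dvd fox Q \<xi> y ?w \<one>\<^bsub>Q\<^esub>" using dvd_diff[OF 1 2] by simp
    define x where "x = \<xi> (Gen_delta j)"
    have xc: "x \<in> carrier Q" by (simp add: x_def)
    have comm: "a \<otimes>\<^bsub>Q\<^esub> b = b \<otimes>\<^bsub>Q\<^esub> a" if "a \<in> carrier Q" "b \<in> carrier Q" for a b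
      by (rule Q.cyclic_commute[OF dc cyc that])
    have yj: "y (Gen_delta j) q = 0" "y (Gen_delta j') q = f q - f (inv\<^bsub>Q\<^esub> z \<otimes>\<^bsub>Q\<^esub> q)" for q
      using jj by (auto simp: y_def y0_def y1_def)
    have "fox Q \<xi> y ?w \<one>\<^bsub>Q\<^esub> = f (inv\<^bsub>Q\<^esub> x) - f (inv\<^bsub>Q\<^esub> z \<otimes>\<^bsub>Q\<^esub> inv\<^bsub>Q\<^esub> x)
        - (f (z \<otimes>\<^bsub>Q\<^esub> (x \<otimes>\<^bsub>Q\<^esub> (inv\<^bsub>Q\<^esub> z \<otimes>\<^bsub>Q\<^esub> inv\<^bsub>Q\<^esub> x)))
          - f (inv\<^bsub>Q\<^esub> z \<otimes>\<^bsub>Q\<^esub> (z \<otimes>\<^bsub>Q\<^esub> (x \<otimes>\<^bsub>Q\<^esub> (inv\<^bsub>Q\<^esub> z \<otimes>\<^bsub>Q\<^esub> inv\<^bsub>Q\<^esub> x)))))"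
      using xc zc by (simp add: yj x_def[symmetric] z_def[symmetric])
    also have "z \<otimes>\<^bsub>Q\<^esub> (x \<otimes>\<^bsub>Q\<^esub> (inv\<^bsub>Q\<^esub> z \<otimes>\<^bsub>Q\<^esub> inv\<^bsub>Q\<^esub> x)) = (z \<otimes>\<^bsub>Q\<^esub> x) \<otimes>\<^bsub>Q\<^esub> inv\<^bsub>Q\<^esub> (x \<otimes>\<^bsub>Q\<^esub> z)"
      using xc zc by (simp add: Q.inv_mult_group Q.m_assoc)
    also have "\<dots> = \<one>\<^bsub>Q\<^esub>" using comm[OF xc zc] xc zc by simp
    also have "f (inv\<^bsub>Q\<^esub> x) = 0" using nt[OF jj(1)] xc by (simp add: f_def x_def)
    also have "f \<one>\<^bsub>Q\<^esub> = 1" by (simp add: f_def)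
    also have "inv\<^bsub>Q\<^esub> z \<otimes>\<^bsub>Q\<^esub> \<one>\<^bsub>Q\<^esub> = inv\<^bsub>Q\<^esub> z" using zc by simp
    also have "f (inv\<^bsub>Q\<^esub> z) = 0" using nt[OF jj(2)] zc by (simp add: f_def z_def)
    finally have "fox Q \<xi> y ?w \<one>\<^bsub>Q\<^esub> = - f (inv\<^bsub>Q\<^esub> z \<otimes>\<^bsub>Q\<^esub> inv\<^bsub>Q\<^esub> x) - 1" by simp
    then show False using 3 by (cases "inv\<^bsub>Q\<^esub> z \<otimes>\<^bsub>Q\<^esub> inv\<^bsub>Q\<^esub> x = \<one>\<^bsub>Q\<^esub>") (simp_all add: f_def)
  qed
qed

end

section \<open>The closed derived series\<close>

lemma (in group) hom_mod_kernel:
  fixes f :: "'a \<Rightarrow> 'c::ab_group_add"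
  assumes S: "subgroup S G" and L: "add_subgroup L"
    and f: "\<And>x y. x \<in> S \<Longrightarrow> y \<in> S \<Longrightarrow> f (x \<otimes> y) - (f x + f y) \<in> L"
  shows "subgroup {x \<in> S. f x \<in> L} G"
    and "\<And>x y. x \<in> S \<Longrightarrow> y \<in> S \<Longrightarrow> f (x \<otimes> y \<otimes> inv x \<otimes> inv y) \<in> L"
proof -
  note cl = subgroup.one_closed[OF S] subgroup.m_closed[OF S] subgroup.m_inv_closed[OF S] subgroup.mem_carrier[OF S]
  have one: "f \<one> \<in> L"
    using f[of \<one> \<one>] cl(1) add_subgroupD(3)[OF L, of "- f \<one>"] by simp
  have inv: "f (inv x) + f x \<in> L" if x: "x \<in> S" for x
  proof -
    have "f \<one> - (f (inv x) + f x) \<in> L" using f[of "inv x" x] cl x by simp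
    from add_subgroupD(2)[OF L one this] show ?thesis by (simp add: add.commute)
  qed
  have mult: "f (x \<otimes> y) \<in> L \<longleftrightarrow> f x + f y \<in> L" if "x \<in> S" "y \<in> S" for x y
    using add_subgroupD(4)[OF L f[OF that], of "f x + f y"] add_subgroupD(2)[OF L _ f[OF that], of "f (x \<otimes> y)"]
    by (auto simp: add.commute)
  show "subgroup {x \<in> S. f x \<in> L} G"
  proof (rule subgroupI)
    show "{x \<in> S. f x \<in> L} \<noteq> {}" using one cl(1) by blast
    fix x assume x: "x \<in> {x \<in> S. f x \<in> L}"
    then have "f (inv x) \<in> L" using add_subgroupD(2)[OF L inv[of x], of "f x"] by simp
    then show "inv x \<in> {x \<in> S. f x \<in> L}" using x cl by simp
    fix y assume "y \<in> {x \<in> S. f x \<in> L}"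
    then show "x \<otimes> y \<in> {x \<in> S. f x \<in> L}" using x cl add_subgroupD(4)[OF L] by (simp add: mult)
  qed (use cl in auto)
  fix x y assume xy: "x \<in> S" "y \<in> S"
  let ?c = "x \<otimes> y \<otimes> inv x \<otimes> inv y"
  have cS: "?c \<in> S" using xy cl by simp
  have eq: "?c \<otimes> (y \<otimes> x) = x \<otimes> y" using xy cl(4) by (simp add: m_assoc) (simp flip: m_assoc)
  have 1: "f (x \<otimes> y) - (f ?c + f (y \<otimes> x)) \<in> L" using f[of ?c "y \<otimes> x"] cS cl xy by (simp only: eq)
  have 2: "f (x \<otimes> y) - (f x + f y) \<in> L" "f (y \<otimes> x) - (f y + f x) \<in> L" using f xy by auto
  have "(f (x \<otimes> y) - (f x + f y)) - (f (y \<otimes> x) - (f y + f x)) - (f (x \<otimes> y) - (f ?c + f (y \<otimes> x))) \<in> L"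
    by (intro add_subgroupD(2)[OF L] 1 2)
  then show "f ?c \<in> L" by simp
qed

context cocycle_context
begin

lemma D_mult_kernel:
  assumes "u \<in> carrier G" "\<psi> u = \<one>\<^bsub>Q\<^esub>" "g \<in> carrier G" "q \<in> carrier Q"
  shows "D (u \<otimes> g) q - (D u q + D g q) \<in> L"
  using D_mult[OF assms(1,3,4)] assms by simp

text \<open>On the kernel of \<psi>, evaluating \<open>D\<close> at a point of \<open>Q\<close> is a
  homomorphism modulo \<open>L\<close>, and moving the point amounts to conjugating the argument.
  This is the dictionary of Shapiro's lemma, and it translates centrality into invariance of
  functions on \<open>Q\<close>.\<close>

lemma D_conj:
  assumes t: "t \<in> carrier G" and u: "u \<in> carrier G" "\<psi> u = \<one>\<^bsub>Q\<^esub>"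
  shows "D (inv t \<otimes> u \<otimes> t) \<one>\<^bsub>Q\<^esub> - D u (\<psi> t) \<in> L"
proof -
  let ?w = "inv t \<otimes> u \<otimes> t"
  have w: "?w \<in> carrier G" "t \<otimes> ?w = u \<otimes> t" using t u by (simp_all add: G.m_assoc[symmetric])
  have 1: "D (u \<otimes> t) (\<psi> t) - (D u (\<psi> t) + D t (\<psi> t)) \<in> L" using t u by (intro D_mult_kernel) auto
  have "D (t \<otimes> ?w) (\<psi> t) - (D t (\<psi> t) + D ?w (inv\<^bsub>Q\<^esub> \<psi> t \<otimes>\<^bsub>Q\<^esub> \<psi> t)) \<in> L"
    using t w by (intro D_mult) auto
  then have 2: "D (u \<otimes> t) (\<psi> t) - (D t (\<psi> t) + D ?w \<one>\<^bsub>Q\<^esub>) \<in> L" unfolding w(2) using t by simp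
  from add_subgroupD(2)[OF L 1 2] show ?thesis by (simp add: algebra_simps)
qed

end

context F_presentation
begin

lemma open_normal_mult:
  assumes V: "V \<in> open_normal" and C: "C \<lhd> \<Delta>"
  shows "V <#> C \<in> open_normal" "V \<subseteq> V <#> C" "C \<subseteq> V <#> C"
proof -
  note Vn = open_normalD[OF V] and Cs = normal_imp_subgroup[OF C]
  show VC: "V \<subseteq> V <#> C" "C \<subseteq> V <#> C"
    unfolding set_mult_def using subgroup.one_closed[OF Vn(2)] subgroup.one_closed[OF Cs]
      subgroup.mem_carrier[OF Vn(2)] subgroup.mem_carrier[OF Cs] by force+
  have "V <#> C \<lhd> \<Delta>"
  proof (rule normal_invI)
    show "subgroup (V <#> C) \<Delta>" by (rule mult_norm_subgroup[OF Vn(1) Cs])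
    fix x h assume x: "x \<in> carrier \<Delta>" and "h \<in> V <#> C"
    then obtain v c where vc: "v \<in> V" "c \<in> C" "h = v \<otimes> c" unfolding set_mult_def by blast
    have c': "v \<in> carrier \<Delta>" "c \<in> carrier \<Delta>"
      using vc subgroup.mem_carrier[OF Vn(2)] subgroup.mem_carrier[OF Cs] by auto
    have "x \<otimes> h \<otimes> inv x = (x \<otimes> v \<otimes> inv x) \<otimes> (x \<otimes> c \<otimes> inv x)"
      using x c' vc(3) by (simp add: m_assoc) (simp flip: m_assoc)
    moreover have "x \<otimes> v \<otimes> inv x \<in> V" "x \<otimes> c \<otimes> inv x \<in> C"
      using x vc normal.inv_op_closed2[OF Vn(1)] normal.inv_op_closed2[OF C] by auto
    ultimately show "x \<otimes> h \<otimes> inv x \<in> V <#> C" unfolding set_mult_def by blast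
  qed
  then show "V <#> C \<in> open_normal" using open_normal_mono[OF V VC(1)] by blast
qed

text \<open>Each \<open>V <#> S\<close> is a closed subgroup containing \<open>S\<close>.
  Conversely, a point outside the closure is separated from it by a coset of some open normal
  \<open>V\<close>.\<close>

lemma mem_closure_iff:
  assumes S: "subgroup S \<Delta>"
  shows "z \<in> T closure_of S \<longleftrightarrow> z \<in> carrier \<Delta> \<and> (\<forall>V\<in>open_normal. z \<in> V <#> S)"
proof (intro iffI conjI ballI)
  assume z: "z \<in> T closure_of S"
  then show "z \<in> carrier \<Delta>" using closure_of_subset_topspace[of T S] topspace_eq by blast
  fix V assume V: "V \<in> open_normal"
  note Vn = open_normalD[OF V]
  have sub: "subgroup (V <#> S) \<Delta>" by (rule mult_norm_subgroup[OF Vn(1) S])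
  have "V \<subseteq> V <#> S" "S \<subseteq> V <#> S"
    unfolding set_mult_def using subgroup.one_closed[OF Vn(2)] subgroup.one_closed[OF S]
      subgroup.mem_carrier[OF Vn(2)] subgroup.mem_carrier[OF S] by force+
  then have "T closure_of S \<subseteq> V <#> S"
    using closedin_if_contains_open_normal[OF V sub] by (intro closure_of_minimal) auto
  then show "z \<in> V <#> S" using z by blast
next
  assume *: "z \<in> carrier \<Delta> \<and> (\<forall>V\<in>open_normal. z \<in> V <#> S)"
  show "z \<in> T closure_of S"
  proof (rule ccontr)
    assume "z \<notin> T closure_of S"
    then obtain V where V: "V \<in> open_normal" "\<And>v. v \<in> V \<Longrightarrow> z \<otimes> v \<notin> T closure_of S"
      using separate_closed[OF closedin_closure_of, of z S] * by blast
    note Vn = open_normalD[OF V(1)]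
    have "z \<in> V <#> S" using * V(1) by blast
    then have "z \<in> S <#> V" using commut_normal[OF S Vn(1)] by simp
    then obtain x v where xv: "x \<in> S" "v \<in> V" "z = x \<otimes> v" unfolding set_mult_def by blast
    have "z \<otimes> inv v = x"
      using xv subgroup.mem_carrier[OF S] subgroup.mem_carrier[OF Vn(2)] by (simp add: m_assoc)
    moreover have "S \<subseteq> T closure_of S"
      using subgroup.subset[OF S] by (intro closure_of_subset) (simp add: topspace_eq)
    ultimately show False using V(2)[of "inv v"] xv subgroup.m_inv_closed[OF Vn(2)] by auto
  qed
qed

lemma closure_normal:
  assumes S: "S \<lhd> \<Delta>"
  shows "T closure_of S \<lhd> \<Delta>"
proof -
  note Ss = normal_imp_subgroup[OF S]
  note VS = open_normalD[OF open_normal_mult(1)[OF _ S]]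
  show ?thesis
  proof (rule normal_invI)
    show "subgroup (T closure_of S) \<Delta>"
    proof (rule subgroupI)
      show "T closure_of S \<noteq> {}"
        using subgroup.one_closed[OF VS(2)] mem_closure_iff[OF Ss, of \<one>] by blast
    qed (auto simp: mem_closure_iff[OF Ss] intro: subgroup.m_closed[OF VS(2)] subgroup.m_inv_closed[OF VS(2)])
    fix x h assume "x \<in> carrier \<Delta>" "h \<in> T closure_of S"
    then show "x \<otimes> h \<otimes> inv x \<in> T closure_of S"
      using normal.inv_op_closed2[OF VS(1)] by (auto simp: mem_closure_iff[OF Ss])
  qed
qed

lemma top_derived_normal: "top_derived \<Delta> T k \<lhd> \<Delta>"
proof (induction k)
  case 0
  show ?case by (simp add: normal_self)
next
  case (Suc k)
  show ?case using closure_normal[OF derived_is_normal[OF Suc.IH]] by simp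
qed

lemma top_derived_closed: "closedin T (top_derived \<Delta> T k)"
proof (cases k)
  case 0
  then show ?thesis using closedin_topspace[of T] by (simp add: topspace_eq)
qed simp

lemma top_derived_Suc_subset: "top_derived \<Delta> T (Suc k) \<subseteq> top_derived \<Delta> T k"
proof -
  have "derived \<Delta> (top_derived \<Delta> T k) \<subseteq> top_derived \<Delta> T k"
    unfolding derived_def
    using normal_imp_subgroup[OF top_derived_normal[of k]]
    by (intro generate_subgroup_incl)
      (auto intro!: subgroup.m_closed subgroup.m_inv_closed)
  then show ?thesis using closure_of_minimal[OF _ top_derived_closed] by simp
qed

lemma top_derived_antimono: "i \<le> j \<Longrightarrow> top_derived \<Delta> T j \<subseteq> top_derived \<Delta> T i"
  by (rule lift_Suc_antimono_le[of "top_derived \<Delta> T"]) (rule top_derived_Suc_subset)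

lemma derived_subset_closure: "derived \<Delta> (top_derived \<Delta> T k) \<subseteq> top_derived \<Delta> T (Suc k)"
proof -
  have "derived \<Delta> (top_derived \<Delta> T k) \<subseteq> topspace T"
    unfolding topspace_eq
    by (rule subgroup.subset[OF normal_imp_subgroup[OF derived_is_normal[OF top_derived_normal]]])
  then show ?thesis using closure_of_subset by simp
qed

lemma commutator_in_top_derived:
  assumes "x \<in> top_derived \<Delta> T k" "y \<in> top_derived \<Delta> T k"
  shows "x \<otimes> y \<otimes> inv x \<otimes> inv y \<in> top_derived \<Delta> T (Suc k)"
proof -
  have "x \<otimes> y \<otimes> inv x \<otimes> inv y \<in> derived \<Delta> (top_derived \<Delta> T k)"
    unfolding derived_def using assms by (intro generate.incl) blast
  then show ?thesis using derived_subset_closure by blast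
qed

text \<open>A homomorphism modulo \<open>L\<close> with open kernel is continuous, hence kills the closed derived group.\<close>

lemma top_derived_subset_kernel:
  fixes f :: "'a \<Rightarrow> 'c::ab_group_add"
  assumes S: "subgroup S \<Delta>" "top_derived \<Delta> T k \<subseteq> S" and L: "add_subgroup L"
    and f: "\<And>x y. x \<in> S \<Longrightarrow> y \<in> S \<Longrightarrow> f (x \<otimes> y) - (f x + f y) \<in> L"
    and V: "V \<in> open_normal" "V \<subseteq> S" "\<And>v. v \<in> V \<Longrightarrow> f v \<in> L"
    and x: "x \<in> top_derived \<Delta> T (Suc k)"
  shows "f x \<in> L"
proof -
  let ?Y = "{x \<in> S. f x \<in> L}"
  have Y: "subgroup ?Y \<Delta>" by (rule hom_mod_kernel(1)[OF S(1) L f])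
  have "closedin T ?Y"
    using V by (intro closedin_if_contains_open_normal[OF V(1) Y]) auto
  moreover have "derived \<Delta> (top_derived \<Delta> T k) \<subseteq> ?Y"
    unfolding derived_def
  proof (rule generate_subgroup_incl[OF _ Y], rule subsetI)
    fix c assume "c \<in> derived_set \<Delta> (top_derived \<Delta> T k)"
    then obtain a b where ab: "a \<in> top_derived \<Delta> T k" "b \<in> top_derived \<Delta> T k" "c = a \<otimes> b \<otimes> inv a \<otimes> inv b"
      by blast
    then have "a \<in> S" "b \<in> S" using S(2) by auto
    then show "c \<in> ?Y"
      using hom_mod_kernel(2)[OF S(1) L f, of a b] ab(3) subgroup.m_closed[OF S(1)] subgroup.m_inv_closed[OF S(1)] by simp
  qed
  ultimately have "top_derived \<Delta> T (Suc k) \<subseteq> ?Y"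
    using closure_of_minimal[of "derived \<Delta> (top_derived \<Delta> T k)" ?Y T] by simp
  then show ?thesis using x by blast
qed

lemma separate_top_derived:
  assumes z: "z \<in> carrier \<Delta>" "z \<notin> top_derived \<Delta> T k" and H: "H \<in> open_normal"
  obtains V where "V \<in> open_normal" "V \<subseteq> H" "z \<notin> V <#> top_derived \<Delta> T k"
proof -
  have "T closure_of top_derived \<Delta> T k = top_derived \<Delta> T k"
    using closure_of_closedin[OF top_derived_closed] .
  then have "z \<notin> T closure_of top_derived \<Delta> T k" using z(2) by simp
  then obtain V where V: "V \<in> open_normal" "z \<notin> V <#> top_derived \<Delta> T k"
    using mem_closure_iff[OF normal_imp_subgroup[OF top_derived_normal]] z(1) by blast
  have "(V \<inter> H) <#> top_derived \<Delta> T k \<subseteq> V <#> top_derived \<Delta> T k" unfolding set_mult_def by blast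
  then show ?thesis using that[OF open_normal_Int[OF V(1) H]] V(2) by blast
qed

lemma open_normal_mult_subset:
  assumes "V \<subseteq> H" "C \<subseteq> H" "subgroup H \<Delta>"
  shows "V <#> C \<subseteq> H"
  using assms subgroup.m_closed[OF assms(3)] unfolding set_mult_def by blast

text \<open>A torsion-free \<open>U\<close> meets the powers of an elliptic generator trivially, so
  its order survives in the quotient. The subgroup \<open>W\<close> is separate because the exact
  order is derived from a proper subgroup, whereas \<open>U\<close> may be all of \<Delta>.\<close>

lemma coset_delta_order:
  assumes n2: "\<And>l. l < s \<Longrightarrow> n l \<ge> 2"
    and hyp: "2 - 2 * real g - real r - (\<Sum>l<s. 1 - 1 / real (n l)) < 0"
    and W: "W \<in> open_normal" "torsion_free_on \<Delta> W" "W \<noteq> carrier \<Delta>"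
    and U: "U \<in> open_normal" "torsion_free_on \<Delta> U" and l: "l < s"
  shows "(U #> gen (Gen_delta l)) [^]\<^bsub>\<Delta> Mod U\<^esub> (i::nat) = \<one>\<^bsub>\<Delta> Mod U\<^esub> \<longleftrightarrow> n l dvd i"
proof -
  let ?d = "gen (Gen_delta l)"
  have o: "ord ?d = n l" by (rule delta_order[OF n2 hyp W l])
  have "?d [^] i = \<one>" if i: "?d [^] i \<in> U"
  proof -
    have "(?d [^] i) [^] n l = (?d [^] n l) [^] i" by (simp add: nat_pow_pow mult.commute)
    then have "(?d [^] i) [^] n l = \<one>" using delta_power_one[OF l] by simp
    moreover have "n l > 0" using n2[OF l] by simp
    ultimately show ?thesis using U(2) i unfolding torsion_free_on_def by blast
  qed
  then have "?d [^] i \<in> U \<longleftrightarrow> ?d [^] i = \<one>"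
    using subgroup.one_closed[OF open_normalD(2)[OF U(1)]] by auto
  then show ?thesis
    unfolding quotient_power[OF U(1) gen_closed]
    using coset_eq_one_iff[OF U(1), of "?d [^] i"] pow_eq_id[of ?d i] o by simp
qed

lemma torsion_free_mono: "torsion_free_on \<Delta> H \<Longrightarrow> U \<subseteq> H \<Longrightarrow> torsion_free_on \<Delta> U"
  unfolding torsion_free_on_def by blast

text \<open>The subgroup \<open>U\<close> below has more cocycles than coboundaries, so \<open>z\<close> would have to act nontrivially
  on the abelianization of \<open>U\<close>; but \<open>z\<close> is central modulo the closed derived group.\<close>

lemma central_imp_mem_previous:
  assumes n2: "\<And>l. l < s \<Longrightarrow> n l \<ge> 2"
    and hyp: "2 - 2 * real g - real r - (\<Sum>l<s. 1 - 1 / real (n l)) < 0"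
    and H: "H \<in> open_normal" "torsion_free_on \<Delta> H" "top_derived \<Delta> T j \<subseteq> H"
    and z: "z \<in> carrier \<Delta>"
    and central: "\<And>x. x \<in> carrier \<Delta> \<Longrightarrow> inv x \<otimes> inv z \<otimes> x \<otimes> z \<in> top_derived \<Delta> T (Suc j)"
  shows "z \<in> top_derived \<Delta> T j"
proof (rule ccontr)
  assume nz: "z \<notin> top_derived \<Delta> T j"
  obtain V0 where V0: "V0 \<in> open_normal" "V0 \<subseteq> H" "z \<notin> V0 <#> top_derived \<Delta> T j"
    by (rule separate_top_derived[OF z nz H(1)])
  define U where "U = V0 <#> top_derived \<Delta> T j"
  have U: "U \<in> open_normal" "top_derived \<Delta> T j \<subseteq> U"
    using open_normal_mult[OF V0(1) top_derived_normal] by (auto simp: U_def)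
  have UH: "U \<subseteq> H" unfolding U_def by (rule open_normal_mult_subset[OF V0(2) H(3) open_normalD(2)[OF H(1)]])
  have zU: "z \<notin> U" using V0(3) by (simp add: U_def)
  have tU: "torsion_free_on \<Delta> U" by (rule torsion_free_mono[OF H(2) UH])
  have Uc: "U \<noteq> carrier \<Delta>" using zU z by blast
  note Un = open_normalD[OF U(1)]
  define Q where "Q = \<Delta> Mod U"
  define \<psi> where "\<psi> = (\<lambda>x. U #> x)"
  define \<xi> where "\<xi> = (\<lambda>a. U #> gen a)"
  interpret Q: F_marked Q \<xi> g r s unfolding Q_def \<xi>_def by (rule quotient_F_marked[OF U(1)])
  have \<psi>1: "\<psi> u = \<one>\<^bsub>Q\<^esub> \<longleftrightarrow> u \<in> U" if "u \<in> carrier \<Delta>" for u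
    using coset_eq_one_iff[OF U(1) that] by (simp add: \<psi>_def Q_def)
  have \<psi>h: "group_hom \<Delta> Q \<psi>" using quotient_marked(2)[OF U(1)] by (simp add: \<psi>_def Q_def)
  interpret \<psi>: group_hom \<Delta> Q \<psi> by (rule \<psi>h)
  define \<zeta> where "\<zeta> = \<psi> z"
  have \<zeta>c: "\<zeta> \<in> carrier Q" using z by (simp add: \<zeta>_def)
  \<comment> \<open>As \<open>z\<close> lies outside \<open>U\<close> this subgroup is nontrivial.
    Zero-sum functions are taken with respect to its cosets.\<close>
  define K where "K = generate Q {\<zeta>}"
  have K: "subgroup K Q" unfolding K_def using \<zeta>c by (intro Q.generate_is_subgroup) simp
  have finK: "finite K" using Q.finite_Q subgroup.subset[OF K] finite_subset by blast
  have "\<zeta> \<noteq> \<one>\<^bsub>Q\<^esub>" using \<psi>1[OF z] zU by (simp add: \<zeta>_def)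
  moreover have "{\<one>\<^bsub>Q\<^esub>, \<zeta>} \<subseteq> K" by (auto simp: K_def intro: generate.one generate.incl)
  ultimately have K2: "card K \<ge> 2" using card_mono[OF finK, of "{\<one>\<^bsub>Q\<^esub>, \<zeta>}"] by simp
  define N where "N = int (card K) + 1"
  have ordQ: "group.ord Q (\<xi> (Gen_delta l)) = n l" if l: "l < s" for l
  proof (rule dvd_antisym)
    have *: "\<xi> (Gen_delta l) [^]\<^bsub>Q\<^esub> (i::nat) = \<one>\<^bsub>Q\<^esub> \<longleftrightarrow> n l dvd i" for i
      unfolding \<xi>_def Q_def by (rule coset_delta_order[OF n2 hyp U(1) tU Uc U(1) tU l])
    show "group.ord Q (\<xi> (Gen_delta l)) dvd n l" using *[of "n l"] Q.pow_eq_id[of "\<xi> (Gen_delta l)" "n l"] by simp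
    show "n l dvd group.ord Q (\<xi> (Gen_delta l))"
      using *[of "group.ord Q (\<xi> (Gen_delta l))"] Q.pow_ord_eq_1[of "\<xi> (Gen_delta l)"] by simp
  qed
  obtain y where y: "\<And>a q. a \<in> gens \<Longrightarrow> q \<in> carrier Q \<Longrightarrow> N dvd Q.coset_sum K (y a) q"
    "\<And>w q. w \<in> F_words g r s n \<Longrightarrow> q \<in> carrier Q \<Longrightarrow> N dvd fox Q \<xi> y w q"
    "\<And>m. (\<And>q. q \<in> carrier Q \<Longrightarrow> N dvd Q.coset_sum K m q) \<Longrightarrow>
      \<exists>a\<in>gens. \<exists>q\<in>carrier Q. \<not> N dvd y a q - (m q - m (inv\<^bsub>Q\<^esub> \<xi> a \<otimes>\<^bsub>Q\<^esub> q))"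
    using Q.noncoboundary_solution[OF K K2 ordQ hyp] unfolding N_def by metis
  have N0: "N > 0" by (simp add: N_def)
  from solution_cocycle[OF U(1) N0 y(2)[unfolded Q_def \<xi>_def]]
  obtain D V where D: "cocycle_context \<Delta> (\<Delta> Mod U) (\<lambda>x. U #> x) {x. N dvd x} D"
    "\<forall>(w :: (bool \<times> F_gen) list). snd ` set w \<subseteq> gens \<longrightarrow> (\<forall>q\<in>carrier (\<Delta> Mod U).
      N dvd D (ev \<Delta> gen w) q - fox (\<Delta> Mod U) (\<lambda>a. U #> gen a) y w q)"
    "V \<in> open_normal" "V \<subseteq> U" "\<forall>v\<in>V. \<forall>q\<in>carrier (\<Delta> Mod U). N dvd D v q" .
  let ?L = "{x::int. N dvd x}"
  note Lg = add_subgroup_multiples[of N]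
  interpret D: cocycle_context \<Delta> Q \<psi> ?L D using D(1) by (simp add: Q_def \<psi>_def)
  have Uc': "u \<in> carrier \<Delta>" "\<psi> u = \<one>\<^bsub>Q\<^esub>" if "u \<in> U" for u
    using subgroup.mem_carrier[OF Un(2) that] \<psi>1 that by auto
  have homU: "D (u \<otimes> v) q - (D u q + D v q) \<in> ?L" if "u \<in> U" "v \<in> carrier \<Delta>" "q \<in> carrier Q" for u v q
    using D.D_mult_kernel[OF Uc'[OF that(1)] that(2,3)] .
  have DN: "N dvd D x \<one>\<^bsub>Q\<^esub>" if x: "x \<in> top_derived \<Delta> T (Suc j)" for x
  proof -
    have "D x \<one>\<^bsub>Q\<^esub> \<in> ?L"
    proof (rule top_derived_subset_kernel[where f = "\<lambda>x. D x \<one>\<^bsub>Q\<^esub>", OF Un(2) U(2) Lg _ D(3,4) _ x])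
      show "D (u \<otimes> v) \<one>\<^bsub>Q\<^esub> - (D u \<one>\<^bsub>Q\<^esub> + D v \<one>\<^bsub>Q\<^esub>) \<in> ?L" if "u \<in> U" "v \<in> U" for u v
        by (rule homU[OF that(1) Uc'(1)[OF that(2)] Q.one_closed])
      show "D v \<one>\<^bsub>Q\<^esub> \<in> ?L" if "v \<in> V" for v using D(5)[folded Q_def] that Q.one_closed by blast
    qed
    then show ?thesis by simp
  qed
  have surj: "\<exists>t. t \<in> carrier \<Delta> \<and> \<psi> t = q" if "q \<in> carrier Q" for q
    using that by (auto simp: Q_def \<psi>_def elim!: coset_surj)
  \<comment> \<open>Passing from the point \<open>q\<close> to \<open>q\<close> times \<zeta> means
    conjugating by \<open>z\<close> as well. By centrality the difference is a value of
    \<open>D\<close> on the next closed derived group, where \<open>D\<close> vanishes modulo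
    \<open>N\<close>.\<close>
  have inv\<zeta>: "N dvd D u (q \<otimes>\<^bsub>Q\<^esub> \<zeta>) - D u q" if u: "u \<in> U" and q: "q \<in> carrier Q" for u q
  proof -
    obtain t where t: "t \<in> carrier \<Delta>" "\<psi> t = q" using surj[OF q] by blast
    note uc = Uc'[OF u]
    define u' where "u' = inv t \<otimes> u \<otimes> t"
    have u'U: "u' \<in> U" unfolding u'_def using normal.inv_op_closed1[OF Un(1) t(1) u] .
    note u'c = Uc'[OF u'U]
    define c where "c = inv u' \<otimes> inv z \<otimes> u' \<otimes> z"
    have cT: "c \<in> top_derived \<Delta> T (Suc j)" unfolding c_def by (rule central[OF u'c(1)])
    have cc: "c \<in> carrier \<Delta>" using u'c z by (simp add: c_def)
    have "inv (t \<otimes> z) \<otimes> u \<otimes> (t \<otimes> z) = u' \<otimes> c"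
      using t z uc(1) by (simp add: u'_def c_def inv_mult_group m_assoc) (simp flip: m_assoc)
    then have 1: "D (u' \<otimes> c) \<one>\<^bsub>Q\<^esub> - D u (\<psi> (t \<otimes> z)) \<in> ?L"
      using D.D_conj[of "t \<otimes> z" u] t z uc by simp
    have 2: "D u' \<one>\<^bsub>Q\<^esub> - D u (\<psi> t) \<in> ?L" unfolding u'_def by (rule D.D_conj[OF t(1) uc])
    have 3: "D (u' \<otimes> c) \<one>\<^bsub>Q\<^esub> - (D u' \<one>\<^bsub>Q\<^esub> + D c \<one>\<^bsub>Q\<^esub>) \<in> ?L"
      by (rule homU[OF u'U cc Q.one_closed])
    have "(D (u' \<otimes> c) \<one>\<^bsub>Q\<^esub> - (D u' \<one>\<^bsub>Q\<^esub> + D c \<one>\<^bsub>Q\<^esub>)) + D c \<one>\<^bsub>Q\<^esub>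
        + (D u' \<one>\<^bsub>Q\<^esub> - D u (\<psi> t)) - (D (u' \<otimes> c) \<one>\<^bsub>Q\<^esub> - D u (\<psi> (t \<otimes> z))) \<in> ?L"
      using DN[OF cT] by (intro add_subgroupD(2,4)[OF Lg] 1 2 3) simp
    moreover have "\<psi> (t \<otimes> z) = q \<otimes>\<^bsub>Q\<^esub> \<zeta>" using t z by (simp add: \<zeta>_def)
    ultimately show ?thesis using t(2) by simp
  qed
  have invK: "N dvd D u (q \<otimes>\<^bsub>Q\<^esub> k) - D u q" if u: "u \<in> U" and q: "q \<in> carrier Q" and k: "k \<in> K" for u q k
  proof -
    let ?S = "{k \<in> carrier Q. \<forall>q\<in>carrier Q. N dvd D u (q \<otimes>\<^bsub>Q\<^esub> k) - D u q}"
    have "subgroup ?S Q"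
    proof (rule Q.subgroupI)
      have "\<one>\<^bsub>Q\<^esub> \<in> ?S" by simp
      then show "?S \<noteq> {}" by blast
      fix a assume a: "a \<in> ?S"
      show "inv\<^bsub>Q\<^esub> a \<in> ?S"
      proof (intro CollectI conjI ballI)
        fix q assume q: "q \<in> carrier Q"
        have "N dvd D u (q \<otimes>\<^bsub>Q\<^esub> inv\<^bsub>Q\<^esub> a \<otimes>\<^bsub>Q\<^esub> a) - D u (q \<otimes>\<^bsub>Q\<^esub> inv\<^bsub>Q\<^esub> a)" using a q by simp
        moreover have "q \<otimes>\<^bsub>Q\<^esub> inv\<^bsub>Q\<^esub> a \<otimes>\<^bsub>Q\<^esub> a = q" using a q by (simp add: Q.m_assoc)
        ultimately have "N dvd D u q - D u (q \<otimes>\<^bsub>Q\<^esub> inv\<^bsub>Q\<^esub> a)" by simp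
        then show "N dvd D u (q \<otimes>\<^bsub>Q\<^esub> inv\<^bsub>Q\<^esub> a) - D u q" by (simp add: dvd_diff_commute)
      qed (use a in simp)
      fix b assume b: "b \<in> ?S"
      show "a \<otimes>\<^bsub>Q\<^esub> b \<in> ?S"
      proof (intro CollectI conjI ballI)
        fix q assume q: "q \<in> carrier Q"
        have "N dvd (D u (q \<otimes>\<^bsub>Q\<^esub> a \<otimes>\<^bsub>Q\<^esub> b) - D u (q \<otimes>\<^bsub>Q\<^esub> a)) + (D u (q \<otimes>\<^bsub>Q\<^esub> a) - D u q)"
          using a b q by (intro dvd_add) auto
        then show "N dvd D u (q \<otimes>\<^bsub>Q\<^esub> (a \<otimes>\<^bsub>Q\<^esub> b)) - D u q" using a b q by (simp add: Q.m_assoc)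
      qed (use a b in simp)
    qed blast
    moreover have "{\<zeta>} \<subseteq> ?S" using inv\<zeta>[OF u] \<zeta>c by simp
    ultimately have "K \<subseteq> ?S" unfolding K_def by (intro Q.generate_subgroup_incl)
    then show ?thesis using k q by blast
  qed
  \<comment> \<open>\<open>E\<close> is the sum over \<open>K\<close> of the differences between
    \<open>D\<close> and its right translates. Each difference vanishes on \<open>U\<close> by
    invariance, so modulo \<open>N\<close> the crossed homomorphism \<open>E\<close> comes from
    \<open>Q\<close>.\<close>
  define E where "E x q = Q.coset_sum K (D x) q - int (card K) * D x q" for x q
  have E_sum: "E x q = (\<Sum>k\<in>K. D x (q \<otimes>\<^bsub>Q\<^esub> k) - D x q)" for x q
    by (simp add: E_def Q.coset_sum_def sum_subtractf)
  have EU: "N dvd E u q" if "u \<in> U" "q \<in> carrier Q" for u q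
    unfolding E_sum using invK[OF that] by (intro dvd_sum)
  have Emult: "N dvd E (x \<otimes> x') q - (E x q + E x' (inv\<^bsub>Q\<^esub> \<psi> x \<otimes>\<^bsub>Q\<^esub> q))"
    if x: "x \<in> carrier \<Delta>" "x' \<in> carrier \<Delta>" and q: "q \<in> carrier Q" for x x' q
  proof -
    let ?R = "\<lambda>q. D (x \<otimes> x') q - (D x q + D x' (inv\<^bsub>Q\<^esub> \<psi> x \<otimes>\<^bsub>Q\<^esub> q))"
    have R: "N dvd ?R q" if "q \<in> carrier Q" for q using D.D_mult[OF x that] by simp
    have "N dvd (\<Sum>k\<in>K. ?R (q \<otimes>\<^bsub>Q\<^esub> k) - ?R q)"
      using R q subgroup.mem_carrier[OF K] by (intro dvd_sum, rule_tac dvd_diff) auto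
    also have "(\<Sum>k\<in>K. ?R (q \<otimes>\<^bsub>Q\<^esub> k) - ?R q)
        = (\<Sum>k\<in>K. (D (x \<otimes> x') (q \<otimes>\<^bsub>Q\<^esub> k) - D (x \<otimes> x') q) - ((D x (q \<otimes>\<^bsub>Q\<^esub> k) - D x q)
          + (D x' (inv\<^bsub>Q\<^esub> \<psi> x \<otimes>\<^bsub>Q\<^esub> q \<otimes>\<^bsub>Q\<^esub> k) - D x' (inv\<^bsub>Q\<^esub> \<psi> x \<otimes>\<^bsub>Q\<^esub> q))))"
      using x q subgroup.mem_carrier[OF K] by (intro sum.cong refl) (simp add: Q.m_assoc)
    also have "\<dots> = E (x \<otimes> x') q - (E x q + E x' (inv\<^bsub>Q\<^esub> \<psi> x \<otimes>\<^bsub>Q\<^esub> q))"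
      by (simp only: E_sum sum_subtractf sum.distrib)
    finally show ?thesis .
  qed
  define t where "t q = (SOME t. t \<in> carrier \<Delta> \<and> \<psi> t = q)" for q
  have t: "t q \<in> carrier \<Delta>" "\<psi> (t q) = q" if "q \<in> carrier Q" for q
    using someI_ex[OF surj[OF that]] by (auto simp: t_def)
  \<comment> \<open>Functions on \<open>Q\<close> form an induced module, so crossed homomorphisms
    of \<open>Q\<close> with these values are coboundaries. Evaluating \<open>E\<close> on a section
    gives an explicit primitive.\<close>
  define m where "m q = E (t q) q" for q
  have mE: "N dvd m q - (E x q + m (inv\<^bsub>Q\<^esub> \<psi> x \<otimes>\<^bsub>Q\<^esub> q))" if x: "x \<in> carrier \<Delta>" and q: "q \<in> carrier Q" for x q
  proof -
    define q' where "q' = inv\<^bsub>Q\<^esub> \<psi> x \<otimes>\<^bsub>Q\<^esub> q"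
    have q': "q' \<in> carrier Q" using x q by (simp add: q'_def)
    define u where "u = inv (t q') \<otimes> (inv x \<otimes> t q)"
    have uc: "u \<in> carrier \<Delta>" using t(1)[OF q] t(1)[OF q'] x by (simp add: u_def)
    have "\<psi> u = inv\<^bsub>Q\<^esub> q' \<otimes>\<^bsub>Q\<^esub> (inv\<^bsub>Q\<^esub> \<psi> x \<otimes>\<^bsub>Q\<^esub> q)"
      using t[OF q] t[OF q'] x by (simp add: u_def)
    also have "\<dots> = \<one>\<^bsub>Q\<^esub>" using q' by (simp flip: q'_def)
    finally have uU: "u \<in> U" using \<psi>1[OF uc] by simp
    have tu: "t q' \<otimes> u = inv x \<otimes> t q" "x \<otimes> (t q' \<otimes> u) = t q"
      using t(1)[OF q] t(1)[OF q'] x by (simp_all add: u_def flip: m_assoc)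
    have "N dvd E (x \<otimes> (t q' \<otimes> u)) q - (E x q + E (t q' \<otimes> u) q')"
      unfolding q'_def using x q t(1)[OF q'] uc by (intro Emult) (auto simp: q'_def)
    moreover have "N dvd E (t q' \<otimes> u) q' - (E (t q') q' + E u (inv\<^bsub>Q\<^esub> \<psi> (t q') \<otimes>\<^bsub>Q\<^esub> q'))"
      using t(1)[OF q'] uc q' by (intro Emult)
    moreover have "N dvd E u (inv\<^bsub>Q\<^esub> \<psi> (t q') \<otimes>\<^bsub>Q\<^esub> q')" using EU[OF uU] t[OF q'] q' by simp
    ultimately have "N dvd (E (x \<otimes> (t q' \<otimes> u)) q - (E x q + E (t q' \<otimes> u) q'))
        + ((E (t q' \<otimes> u) q' - (E (t q') q' + E u (inv\<^bsub>Q\<^esub> \<psi> (t q') \<otimes>\<^bsub>Q\<^esub> q')))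
        + E u (inv\<^bsub>Q\<^esub> \<psi> (t q') \<otimes>\<^bsub>Q\<^esub> q'))"
      by (intro dvd_add)
    then show ?thesis by (simp add: tu(2) m_def algebra_simps flip: q'_def)
  qed
  have Dy: "N dvd D (gen a) q - y a q" if "a \<in> gens" "q \<in> carrier Q" for a q
  proof -
    have "snd ` set [(True, a)] \<subseteq> gens" using that by simp
    from D(2)[rule_format, OF this that(2)[unfolded Q_def]] show ?thesis by simp
  qed
  have ym: "N dvd y a q - (m q - m (inv\<^bsub>Q\<^esub> \<xi> a \<otimes>\<^bsub>Q\<^esub> q))" if a: "a \<in> gens" and q: "q \<in> carrier Q" for a q
  proof -
    have 1: "N dvd m q - (E (gen a) q + m (inv\<^bsub>Q\<^esub> \<xi> a \<otimes>\<^bsub>Q\<^esub> q))"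
      using mE[OF gen_closed q, of a] by (simp add: \<psi>_def \<xi>_def)
    have "N dvd (\<Sum>k\<in>K. D (gen a) (q \<otimes>\<^bsub>Q\<^esub> k) - y a (q \<otimes>\<^bsub>Q\<^esub> k))"
      using Dy[OF a] q subgroup.mem_carrier[OF K] by (intro dvd_sum) auto
    then have 2: "N dvd Q.coset_sum K (D (gen a)) q - Q.coset_sum K (y a) q"
      by (simp add: Q.coset_sum_def sum_subtractf)
    have 3: "N dvd Q.coset_sum K (y a) q" by (rule y(1)[OF a q])
    have 4: "N dvd D (gen a) q - y a q" by (rule Dy[OF a q])
    \<comment> \<open>Since \<open>y a\<close> has zero coset sums and \<open>D\<close> agrees with
      it on the generator, \<open>E\<close> at the generator is \<open>- card K\<close> times
      \<open>y a\<close>, which is \<open>y a\<close> modulo \<open>N\<close>.\<close>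
    have "N dvd (D (gen a) q * N - (D (gen a) q - y a q)) - (m q - (E (gen a) q + m (inv\<^bsub>Q\<^esub> \<xi> a \<otimes>\<^bsub>Q\<^esub> q)))
        - (Q.coset_sum K (D (gen a)) q - Q.coset_sum K (y a) q) - Q.coset_sum K (y a) q"
      by (intro dvd_diff[OF dvd_diff[OF dvd_diff[OF dvd_diff[OF _ 4] 1] 2] 3]) simp
    also have "(D (gen a) q * N - (D (gen a) q - y a q)) - (m q - (E (gen a) q + m (inv\<^bsub>Q\<^esub> \<xi> a \<otimes>\<^bsub>Q\<^esub> q)))
        - (Q.coset_sum K (D (gen a)) q - Q.coset_sum K (y a) q) - Q.coset_sum K (y a) q
        = y a q - (m q - m (inv\<^bsub>Q\<^esub> \<xi> a \<otimes>\<^bsub>Q\<^esub> q))"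
      by (simp add: E_def N_def algebra_simps)
    finally show ?thesis .
  qed
  \<comment> \<open>Adding the coset sums makes the function zero-sum modulo \<open>N\<close>. Its
    coboundary does not change modulo \<open>N\<close>: the coset sums of \<open>m\<close> have as
    coboundary those of \<open>y a\<close>, and these vanish.\<close>
  define m' where "m' q = m q + Q.coset_sum K m q" for q
  have "N dvd Q.coset_sum K m' q" if q: "q \<in> carrier Q" for q
  proof -
    have "Q.coset_sum K (Q.coset_sum K m) q = int (card K) * Q.coset_sum K m q"
      by (rule Q.coset_sum_const[OF K]) (rule Q.coset_sum_shift[OF K _ q])
    then have "Q.coset_sum K m' q = N * Q.coset_sum K m q"
      by (simp add: m'_def[abs_def] Q.coset_sum_add N_def algebra_simps)
    then show ?thesis by simp
  qed
  from y(3)[OF this] obtain a q where aq: "a \<in> gens" "q \<in> carrier Q"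
    "\<not> N dvd y a q - (m' q - m' (inv\<^bsub>Q\<^esub> \<xi> a \<otimes>\<^bsub>Q\<^esub> q))" by blast
  have "N dvd (\<Sum>k\<in>K. y a (q \<otimes>\<^bsub>Q\<^esub> k) - (m (q \<otimes>\<^bsub>Q\<^esub> k) - m (inv\<^bsub>Q\<^esub> \<xi> a \<otimes>\<^bsub>Q\<^esub> (q \<otimes>\<^bsub>Q\<^esub> k))))"
    using ym[OF aq(1)] aq(2) subgroup.mem_carrier[OF K] by (intro dvd_sum) auto
  also have "(\<Sum>k\<in>K. y a (q \<otimes>\<^bsub>Q\<^esub> k) - (m (q \<otimes>\<^bsub>Q\<^esub> k) - m (inv\<^bsub>Q\<^esub> \<xi> a \<otimes>\<^bsub>Q\<^esub> (q \<otimes>\<^bsub>Q\<^esub> k))))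
      = (\<Sum>k\<in>K. y a (q \<otimes>\<^bsub>Q\<^esub> k) - (m (q \<otimes>\<^bsub>Q\<^esub> k) - m (inv\<^bsub>Q\<^esub> \<xi> a \<otimes>\<^bsub>Q\<^esub> q \<otimes>\<^bsub>Q\<^esub> k)))"
    using aq(2) subgroup.mem_carrier[OF K] by (intro sum.cong refl) (simp add: Q.m_assoc)
  also have "\<dots> = Q.coset_sum K (y a) q - (Q.coset_sum K m q - Q.coset_sum K m (inv\<^bsub>Q\<^esub> \<xi> a \<otimes>\<^bsub>Q\<^esub> q))"
    by (simp add: Q.coset_sum_def sum_subtractf)
  finally have A: "N dvd Q.coset_sum K (y a) q - (Q.coset_sum K m q - Q.coset_sum K m (inv\<^bsub>Q\<^esub> \<xi> a \<otimes>\<^bsub>Q\<^esub> q))" .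
  have "N dvd (y a q - (m q - m (inv\<^bsub>Q\<^esub> \<xi> a \<otimes>\<^bsub>Q\<^esub> q)))
      + (Q.coset_sum K (y a) q - (Q.coset_sum K m q - Q.coset_sum K m (inv\<^bsub>Q\<^esub> \<xi> a \<otimes>\<^bsub>Q\<^esub> q)))
      - Q.coset_sum K (y a) q"
    by (rule dvd_diff[OF dvd_add[OF ym[OF aq(1,2)] A] y(1)[OF aq(1,2)]])
  also have "\<dots> = y a q - (m' q - m' (inv\<^bsub>Q\<^esub> \<xi> a \<otimes>\<^bsub>Q\<^esub> q))"
    by (simp add: m'_def)
  finally show False using aq(3) by simp
qed

end

section \<open>Integral lifts and the transfer\<close>

lemma fox_apply:
  fixes y :: "'x \<Rightarrow> 'q \<Rightarrow> 'b \<Rightarrow> 'c::ab_group_add"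
  shows "fox Q \<xi> y w q b = fox Q \<xi> (\<lambda>a q. y a q b) w q"
  by (induction w arbitrary: q) (auto simp: fun_Compl_def)

lemma sum_const_fun_apply: "(\<Sum>i<(k::nat). c :: 'b \<Rightarrow> int) b = int k * c b"
  by (induction k) (simp_all add: algebra_simps)

lemma torsion_free_fun:
  fixes c :: "'b \<Rightarrow> int"
  assumes "(k::nat) > 0" "(\<Sum>i<k. c) = 0"
  shows "c = 0"
proof
  fix b
  have "int k * c b = 0" using assms(2) sum_const_fun_apply[of c k b] by simp
  then show "c b = 0 b" using assms(1) by simp
qed

text \<open>The canonical surjection onto \<open>B\<close> from the free abelian group on the
  elements of \<open>B\<close>; values of \<open>f\<close> outside the carrier are ignored. Its
  kernel is the lattice modulo which values in \<open>B\<close> are represented by integer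
  vectors.\<close>

definition evaluate :: "('b, 'd) monoid_scheme \<Rightarrow> ('b \<Rightarrow> int) \<Rightarrow> 'b" where
  "evaluate B f = finprod B (\<lambda>b. b [^]\<^bsub>B\<^esub> f b) (carrier B)"

definition unit_vector :: "'b \<Rightarrow> 'b \<Rightarrow> int" where
  "unit_vector b = (\<lambda>x. if b = x then 1 else 0)"

context comm_group
begin

lemma evaluate_closed: "evaluate G f \<in> carrier G"
  unfolding evaluate_def by (rule finprod_closed) simp

lemma evaluate_add: "evaluate G (f + f') = evaluate G f \<otimes> evaluate G f'"
proof -
  have "evaluate G (f + f') = finprod G (\<lambda>b. b [^] f b \<otimes> b [^] f' b) (carrier G)"
    unfolding evaluate_def by (rule finprod_cong') (auto simp: int_pow_mult)
  also have "\<dots> = evaluate G f \<otimes> evaluate G f'"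
    unfolding evaluate_def by (rule finprod_multf) auto
  finally show ?thesis .
qed

lemma evaluate_eq_one:
  assumes "finite (carrier G)" "\<And>b. b \<in> carrier G \<Longrightarrow> int (card (carrier G)) dvd f b"
  shows "evaluate G f = \<one>"
  unfolding evaluate_def
proof (rule finprod_one_eqI)
  fix b assume b: "b \<in> carrier G"
  then obtain k where k: "f b = int (card (carrier G)) * k" using assms(2) by blast
  have "b [^] int (card (carrier G)) = \<one>"
    using pow_order_eq_1[OF b] by (simp add: int_pow_int Coset.order_def)
  then show "b [^] f b = \<one>" using b by (simp add: k flip: int_pow_pow)
qed

lemma evaluate_unit_vector:
  assumes "finite (carrier G)" "b \<in> carrier G"
  shows "evaluate G (unit_vector b) = b"
proof -
  have "evaluate G (unit_vector b) = finprod G (\<lambda>x. if b = x then x else \<one>) (carrier G)"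
    unfolding evaluate_def by (rule finprod_cong') (use assms in \<open>auto simp: unit_vector_def\<close>)
  also have "\<dots> = b" using assms by (intro finprod_singleton) auto
  finally show ?thesis .
qed

lemma evaluate_diff_iff: "evaluate G (f - f') = \<one> \<longleftrightarrow> evaluate G f = evaluate G f'"
proof -
  have "evaluate G f = evaluate G (f - f') \<otimes> evaluate G f'"
    using evaluate_add[of "f - f'" f'] by simp
  then show ?thesis using evaluate_closed[of "f - f'"] evaluate_closed[of f'] by (auto simp: r_cancel_one)
qed

lemma add_subgroup_evaluate: "add_subgroup {f. evaluate G f = \<one>}"
proof -
  have "evaluate G 0 = \<one>" unfolding evaluate_def by (rule finprod_one_eqI) auto
  then show ?thesis by (auto simp: add_subgroup_def evaluate_diff_iff)
qed

end

section \<open>Transfer and descent to the next derived group\<close>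

context F_presentation
begin

lemma finite_open_normal_Int:
  assumes "finite I" "\<forall>i\<in>I. V i \<in> open_normal" "U \<in> open_normal"
  shows "\<exists>W\<in>open_normal. W \<subseteq> U \<and> (\<forall>i\<in>I. W \<subseteq> V i)"
  using assms
proof (induction I rule: finite_induct)
  case (insert i I)
  then obtain W where W: "W \<in> open_normal" "W \<subseteq> U" "\<forall>i\<in>I. W \<subseteq> V i" by auto
  have "W \<inter> V i \<in> open_normal" using W(1) insert.prems(1) by (intro open_normal_Int) auto
  then show ?case using W by (intro bexI[of _ "W \<inter> V i"]) auto
qed auto

text \<open>Transfer to \<open>H\<close>: on an element that is central modulo the next derived group it is multiplication by
  the index, while it vanishes on the closed derived group of \<open>H\<close>.\<close>

lemma transfer_divides:
  fixes N0 :: nat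
  assumes H: "H \<in> open_normal" "top_derived \<Delta> T k \<subseteq> H"
    and U: "U \<in> open_normal" "U \<subseteq> H" "top_derived \<Delta> T j \<subseteq> U"
    and kj: "k < j" and z: "z \<in> top_derived \<Delta> T j"
    and central: "\<And>x. x \<in> carrier \<Delta> \<Longrightarrow> inv x \<otimes> inv z \<otimes> x \<otimes> z \<in> top_derived \<Delta> T (Suc j)"
    and N: "N = int (card ((\<lambda>x. U #> x) ` H) * N0)"
    and D: "cocycle_context \<Delta> (\<Delta> Mod U) (\<lambda>x. U #> x) {x. N dvd x} D"
    and V: "V \<in> open_normal" "V \<subseteq> U" "\<forall>v\<in>V. \<forall>q\<in>carrier (\<Delta> Mod U). N dvd D v q"
  shows "int N0 dvd D z \<one>\<^bsub>\<Delta> Mod U\<^esub>"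
proof -
  define Q where "Q = \<Delta> Mod U"
  define \<psi> where "\<psi> = (\<lambda>x. U #> x)"
  let ?L = "{x::int. N dvd x}"
  note Lg = add_subgroup_multiples[of N]
  interpret D: cocycle_context \<Delta> Q \<psi> ?L D using D by (simp add: Q_def \<psi>_def)
  note Hn = open_normalD[OF H(1)] and Un = open_normalD[OF U(1)]
  have V': "N dvd D v q" if "v \<in> V" "q \<in> carrier Q" for v q using V(3) that by (simp add: Q_def)
  have finQ: "finite (carrier Q)" unfolding Q_def by (rule open_normal_finite_index[OF U(1)])
  have Uc: "u \<in> carrier \<Delta>" "\<psi> u = \<one>\<^bsub>Q\<^esub>" if "u \<in> U" for u
    using subgroup.mem_carrier[OF Un(2) that] coset_eq_one_iff[OF U(1), of u] that by (auto simp: \<psi>_def Q_def)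
  have zU: "z \<in> U" using z U(3) by blast
  note zc = Uc[OF zU]
  have DN: "N dvd D x \<one>\<^bsub>Q\<^esub>" if x: "x \<in> top_derived \<Delta> T (Suc j)" for x
  proof -
    have "D x \<one>\<^bsub>Q\<^esub> \<in> ?L"
    proof (rule top_derived_subset_kernel[where f = "\<lambda>x. D x \<one>\<^bsub>Q\<^esub>", OF Un(2) U(3) Lg _ V(1,2) _ x])
      show "D (u \<otimes> v) \<one>\<^bsub>Q\<^esub> - (D u \<one>\<^bsub>Q\<^esub> + D v \<one>\<^bsub>Q\<^esub>) \<in> ?L" if "u \<in> U" "v \<in> U" for u v
        by (rule D.D_mult_kernel[OF Uc[OF that(1)] Uc(1)[OF that(2)] D.H.one_closed])
      show "D v \<one>\<^bsub>Q\<^esub> \<in> ?L" if "v \<in> V" for v using V'[OF that D.H.one_closed] by simp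
    qed
    then show ?thesis by simp
  qed
  \<comment> \<open>Evaluation at another point conjugates \<open>z\<close>, which changes it by an
    element of the next closed derived group; \<open>D\<close> vanishes there modulo
    \<open>N\<close>.\<close>
  have const: "N dvd D z q - D z \<one>\<^bsub>Q\<^esub>" if q: "q \<in> carrier Q" for q
  proof -
    obtain t where t: "t \<in> carrier \<Delta>" "\<psi> t = q" using q by (auto simp: Q_def \<psi>_def elim!: coset_surj)
    define c where "c = inv z \<otimes> inv t \<otimes> z \<otimes> t"
    have "inv (inv t \<otimes> inv z \<otimes> t \<otimes> z) \<in> top_derived \<Delta> T (Suc j)"
      by (rule subgroup.m_inv_closed[OF normal_imp_subgroup[OF top_derived_normal] central[OF t(1)]])
    also have "inv (inv t \<otimes> inv z \<otimes> t \<otimes> z) = c" using t(1) zc(1) by (simp add: c_def inv_mult_group m_assoc)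
    finally have cT: "c \<in> top_derived \<Delta> T (Suc j)" .
    have cc: "c \<in> carrier \<Delta>" using t(1) zc(1) by (simp add: c_def)
    have eq: "inv t \<otimes> z \<otimes> t = z \<otimes> c" using t(1) zc(1) by (simp add: c_def flip: m_assoc)
    have 1: "N dvd D (z \<otimes> c) \<one>\<^bsub>Q\<^esub> - D z q" using D.D_conj[OF t(1) zc] by (simp add: eq t(2))
    have 2: "N dvd D (z \<otimes> c) \<one>\<^bsub>Q\<^esub> - (D z \<one>\<^bsub>Q\<^esub> + D c \<one>\<^bsub>Q\<^esub>)"
      using D.D_mult_kernel[OF zc cc D.H.one_closed] by simp
    have "N dvd (D (z \<otimes> c) \<one>\<^bsub>Q\<^esub> - (D z \<one>\<^bsub>Q\<^esub> + D c \<one>\<^bsub>Q\<^esub>)) + D c \<one>\<^bsub>Q\<^esub>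
        - (D (z \<otimes> c) \<one>\<^bsub>Q\<^esub> - D z q)"
      by (rule dvd_diff[OF dvd_add[OF 2 DN[OF cT]] 1])
    then show ?thesis by simp
  qed
  define P where "P = \<psi> ` H"
  have P: "subgroup P Q" unfolding P_def by (rule D.subgroup_img_is_subgroup[OF Hn(2)])
  have finP: "finite P" using finite_subset[OF subgroup.subset[OF P] finQ] .
  note Pc = subgroup.mem_carrier[OF P]
  \<comment> \<open>The transfer: the sum of \<open>D\<close> over the cosets of \<open>U\<close> in
    \<open>H\<close>. An element of \<open>H\<close> permutes these cosets, so this is a
    homomorphism on \<open>H\<close> modulo \<open>N\<close>.\<close>
  define \<tau> where "\<tau> h = (\<Sum>q\<in>P. D h q)" for h
  have "\<tau> z \<in> ?L"
  proof (rule top_derived_subset_kernel[where f = \<tau>, OF Hn(2) H(2) Lg _ V(1)])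
    show "V \<subseteq> H" using V(2) U(2) by blast
    show "\<tau> v \<in> ?L" if "v \<in> V" for v unfolding \<tau>_def using V'[OF that] Pc by (intro add_subgroup_sum[OF Lg]) simp
    show "z \<in> top_derived \<Delta> T (Suc k)" using z top_derived_antimono[of "Suc k" j] kj by auto
    show "\<tau> (x \<otimes> x') - (\<tau> x + \<tau> x') \<in> ?L" if x: "x \<in> H" "x' \<in> H" for x x'
    proof -
      have xc: "x \<in> carrier \<Delta>" "x' \<in> carrier \<Delta>" using subgroup.mem_carrier[OF Hn(2)] x by auto
      have xP: "\<psi> x \<in> P" using x by (simp add: P_def)
      have i: "\<psi> x \<otimes>\<^bsub>Q\<^esub> (inv\<^bsub>Q\<^esub> \<psi> x \<otimes>\<^bsub>Q\<^esub> q) = q" "inv\<^bsub>Q\<^esub> \<psi> x \<otimes>\<^bsub>Q\<^esub> (\<psi> x \<otimes>\<^bsub>Q\<^esub> q) = q" if "q \<in> P" for q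
        using Pc[OF that] Pc[OF xP] by (simp_all flip: D.H.m_assoc)
      have "(\<Sum>q\<in>P. D x' (inv\<^bsub>Q\<^esub> \<psi> x \<otimes>\<^bsub>Q\<^esub> q)) = \<tau> x'"
        unfolding \<tau>_def
        by (rule sum.reindex_bij_witness[of _ "\<lambda>q. \<psi> x \<otimes>\<^bsub>Q\<^esub> q" "\<lambda>q. inv\<^bsub>Q\<^esub> \<psi> x \<otimes>\<^bsub>Q\<^esub> q"])
          (use i xP in \<open>simp_all add: subgroup.m_closed[OF P] subgroup.m_inv_closed[OF P]\<close>)
      then have "\<tau> (x \<otimes> x') - (\<tau> x + \<tau> x')
          = (\<Sum>q\<in>P. D (x \<otimes> x') q - (D x q + D x' (inv\<^bsub>Q\<^esub> \<psi> x \<otimes>\<^bsub>Q\<^esub> q)))"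
        by (simp add: \<tau>_def sum_subtractf sum.distrib)
      also have "\<dots> \<in> ?L" using D.D_mult[OF xc] Pc by (intro add_subgroup_sum[OF Lg]) auto
      finally show ?thesis .
    qed
  qed
  then have 1: "N dvd \<tau> z" by simp
  have 2: "N dvd (\<Sum>q\<in>P. D z q - D z \<one>\<^bsub>Q\<^esub>)" using const Pc by (intro dvd_sum) auto
  have "(\<Sum>q\<in>P. D z q - D z \<one>\<^bsub>Q\<^esub>) = \<tau> z - int (card P) * D z \<one>\<^bsub>Q\<^esub>"
    by (simp add: \<tau>_def sum_subtractf)
  with dvd_diff[OF 1 2] have "N dvd int (card P) * D z \<one>\<^bsub>Q\<^esub>" by simp
  then have "int (card P) * int N0 dvd int (card P) * D z \<one>\<^bsub>Q\<^esub>" by (simp add: N P_def \<psi>_def)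
  moreover have "card P > 0" using finP subgroup.one_closed[OF P] by (auto simp: card_gt_0_iff)
  ultimately show ?thesis by (simp add: Q_def)
qed

text \<open>A homomorphism from \<open>U\<close> to a finite abelian group \<open>B\<close> is turned into a crossed homomorphism on
  \<open>\<Delta>\<close> (Shapiro's lemma), which lifts to one with values in the free abelian group on \<open>B\<close>; so \<open>U\<close>
  has torsion-free abelianization, and the transfer argument applies.\<close>

lemma central_imp_mem_next:
  assumes n2: "\<And>l. l < s \<Longrightarrow> n l \<ge> 2"
    and hyp: "2 - 2 * real g - real r - (\<Sum>l<s. 1 - 1 / real (n l)) < 0"
    and H: "H \<in> open_normal" "torsion_free_on \<Delta> H" "top_derived \<Delta> T k \<subseteq> H"
    and kj: "k < j" and z: "z \<in> top_derived \<Delta> T j"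
    and central: "\<And>x. x \<in> carrier \<Delta> \<Longrightarrow> inv x \<otimes> inv z \<otimes> x \<otimes> z \<in> top_derived \<Delta> T (Suc j)"
  shows "z \<in> top_derived \<Delta> T (Suc j)"
proof (rule ccontr)
  assume nz: "z \<notin> top_derived \<Delta> T (Suc j)"
  have zc: "z \<in> carrier \<Delta>" using z subgroup.mem_carrier[OF normal_imp_subgroup[OF top_derived_normal]] by blast
  obtain V0 where V0: "V0 \<in> open_normal" "V0 \<subseteq> H" "z \<notin> V0 <#> top_derived \<Delta> T (Suc j)"
    by (rule separate_top_derived[OF zc nz H(1)])
  \<comment> \<open>\<open>Y\<close> and \<open>U\<close> are built from the same \<open>V0\<close>,
    so that the quotient of \<open>U\<close> by \<open>Y\<close> is abelian, \<open>z\<close> lies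
    in \<open>U\<close>, and its class there is nontrivial.\<close>
  define Y where "Y = V0 <#> top_derived \<Delta> T (Suc j)"
  define U where "U = V0 <#> top_derived \<Delta> T j"
  have Y: "Y \<in> open_normal" "V0 \<subseteq> Y" "top_derived \<Delta> T (Suc j) \<subseteq> Y"
    unfolding Y_def by (rule open_normal_mult[OF V0(1) top_derived_normal])+
  have U: "U \<in> open_normal" "V0 \<subseteq> U" "top_derived \<Delta> T j \<subseteq> U"
    unfolding U_def by (rule open_normal_mult[OF V0(1) top_derived_normal])+
  have TH: "top_derived \<Delta> T j \<subseteq> H" using H(3) top_derived_antimono[of k j] kj by auto
  have UH: "U \<subseteq> H" unfolding U_def by (rule open_normal_mult_subset[OF V0(2) TH open_normalD(2)[OF H(1)]])
  have YU: "Y \<subseteq> U" unfolding Y_def U_def set_mult_def using top_derived_Suc_subset[of j] by blast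
  have zY: "z \<notin> Y" using V0(3) by (simp add: Y_def)
  have zU: "z \<in> U" using z U(3) by blast
  note Un = open_normalD[OF U(1)] and Yn = open_normalD[OF Y(1)]
  define Q where "Q = \<Delta> Mod U"
  define \<psi> where "\<psi> = (\<lambda>x. U #> x)"
  define \<xi> where "\<xi> = (\<lambda>a. U #> gen a)"
  interpret Q: F_marked Q \<xi> g r s unfolding Q_def \<xi>_def by (rule quotient_F_marked[OF U(1)])
  interpret \<psi>: group_hom \<Delta> Q \<psi> using quotient_marked(2)[OF U(1)] by (simp add: \<psi>_def Q_def)
  have \<psi>1: "\<psi> u = \<one>\<^bsub>Q\<^esub> \<longleftrightarrow> u \<in> U" if "u \<in> carrier \<Delta>" for u
    using coset_eq_one_iff[OF U(1) that] by (simp add: \<psi>_def Q_def)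
  define E where "E = \<Delta> Mod Y"
  define \<phi> where "\<phi> = (\<lambda>x. Y #> x)"
  interpret \<phi>: group_hom \<Delta> E \<phi> using quotient_marked(2)[OF Y(1)] by (simp add: \<phi>_def E_def)
  have \<phi>1: "\<phi> u = \<one>\<^bsub>E\<^esub> \<longleftrightarrow> u \<in> Y" if "u \<in> carrier \<Delta>" for u
    using coset_eq_one_iff[OF Y(1) that] by (simp add: \<phi>_def E_def)
  define B where "B = E\<lparr>carrier := \<phi> ` U\<rparr>"
  have sB: "subgroup (\<phi> ` U) E" by (rule \<phi>.subgroup_img_is_subgroup[OF Un(2)])
  have Uc: "u \<in> carrier \<Delta>" if "u \<in> U" for u using subgroup.mem_carrier[OF Un(2) that] .
  have comm: "\<phi> u \<otimes>\<^bsub>E\<^esub> \<phi> u' = \<phi> u' \<otimes>\<^bsub>E\<^esub> \<phi> u" if u: "u \<in> U" "u' \<in> U" for u u'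
  proof -
    have red: "\<exists>d\<in>top_derived \<Delta> T j. d \<in> carrier \<Delta> \<and> \<phi> u = \<phi> d" if "u \<in> U" for u
    proof -
      obtain v d where vd: "v \<in> V0" "d \<in> top_derived \<Delta> T j" "u = v \<otimes> d"
        using \<open>u \<in> U\<close> unfolding U_def set_mult_def by blast
      have c: "v \<in> carrier \<Delta>" "d \<in> carrier \<Delta>" using vd U(2,3) Uc by auto
      have "\<phi> v = \<one>\<^bsub>E\<^esub>" using \<phi>1[OF c(1)] vd(1) Y(2) by blast
      then have "\<phi> u = \<phi> d" using c vd(3) by simp
      then show ?thesis using vd(2) c by blast
    qed
    obtain d d' where d: "d \<in> top_derived \<Delta> T j" "d \<in> carrier \<Delta>" "\<phi> u = \<phi> d"
      "d' \<in> top_derived \<Delta> T j" "d' \<in> carrier \<Delta>" "\<phi> u' = \<phi> d'" using red[OF u(1)] red[OF u(2)] by blast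
    let ?c = "d \<otimes> d' \<otimes> inv d \<otimes> inv d'"
    have "?c \<in> Y" using commutator_in_top_derived[OF d(1,4)] Y(3) by blast
    then have "\<phi> ?c = \<one>\<^bsub>E\<^esub>" using \<phi>1[of ?c] d(2,5) by simp
    moreover have "d \<otimes> d' = ?c \<otimes> (d' \<otimes> d)" using d(2,5) by (simp add: m_assoc) (simp flip: m_assoc)
    moreover have "\<phi> (?c \<otimes> (d' \<otimes> d)) = \<phi> ?c \<otimes>\<^bsub>E\<^esub> \<phi> (d' \<otimes> d)" by (rule \<phi>.hom_mult) (use d(2,5) in simp_all)
    moreover have "\<one>\<^bsub>E\<^esub> \<otimes>\<^bsub>E\<^esub> \<phi> (d' \<otimes> d) = \<phi> (d' \<otimes> d)" by (rule \<phi>.H.l_one) (use d(2,5) in simp)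
    ultimately have "\<phi> (d \<otimes> d') = \<phi> (d' \<otimes> d)" by metis
    then have "\<phi> d \<otimes>\<^bsub>E\<^esub> \<phi> d' = \<phi> d' \<otimes>\<^bsub>E\<^esub> \<phi> d" by (simp only: \<phi>.hom_mult d(2,5))
    then show ?thesis by (simp only: d(3,6))
  qed
  have gB: "group B" unfolding B_def by (rule \<phi>.H.subgroup_imp_group[OF sB])
  interpret B: comm_group B
    by (rule group.group_comm_groupI[OF gB]) (use comm in \<open>auto simp: B_def\<close>)
  have finB: "finite (carrier B)"
  proof -
    have "finite (carrier E)" unfolding E_def by (rule open_normal_finite_index[OF Y(1)])
    then show ?thesis using finite_subset[OF subgroup.subset[OF sB]] by (simp add: B_def)
  qed
  have \<phi>B: "\<phi> u \<in> carrier B" if "u \<in> U" for u using that by (simp add: B_def)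
  have \<phi>mult: "\<phi> (u \<otimes> v) = \<phi> u \<otimes>\<^bsub>B\<^esub> \<phi> v" if "u \<in> U" "v \<in> U" for u v
    using Uc that by (simp add: B_def)
  have \<phi>oneB: "\<phi> u = \<one>\<^bsub>B\<^esub> \<longleftrightarrow> u \<in> Y" if "u \<in> U" for u using \<phi>1[OF Uc[OF that]] by (simp add: B_def)
  define L where "L = {f :: 'a set \<Rightarrow> int. evaluate B f = \<one>\<^bsub>B\<^esub>}"
  have L: "add_subgroup L" unfolding L_def by (rule B.add_subgroup_evaluate)
  have ev_ind: "evaluate B (unit_vector (\<phi> u)) = \<phi> u" if "u \<in> U" for u
    by (rule B.evaluate_unit_vector[OF finB \<phi>B[OF that]])
  have indL: "unit_vector (\<phi> u) \<in> L \<longleftrightarrow> u \<in> Y" if "u \<in> U" for u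
    using ev_ind[OF that] \<phi>oneB[OF that] by (simp add: L_def)
  \<comment> \<open>A section of \<psi>, normalised at the identity so that the crossed homomorphism
    built from it returns \<open>z\<close> itself when evaluated at \<open>z\<close> and the
    identity.\<close>
  define t where "t q = (if q = \<one>\<^bsub>Q\<^esub> then \<one> else SOME x. x \<in> carrier \<Delta> \<and> \<psi> x = q)" for q
  have t: "t q \<in> carrier \<Delta>" "\<psi> (t q) = q" if q: "q \<in> carrier Q" for q
  proof -
    have "\<exists>x. x \<in> carrier \<Delta> \<and> \<psi> x = q" using q by (auto simp: Q_def \<psi>_def elim!: coset_surj)
    from someI_ex[OF this] show "t q \<in> carrier \<Delta>" "\<psi> (t q) = q" by (auto simp: t_def)
  qed
  define w where "w x q = inv (t q) \<otimes> x \<otimes> t (inv\<^bsub>Q\<^esub> \<psi> x \<otimes>\<^bsub>Q\<^esub> q)" for x q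
  have wU: "w x q \<in> U" if x: "x \<in> carrier \<Delta>" and q: "q \<in> carrier Q" for x q
  proof -
    have q': "inv\<^bsub>Q\<^esub> \<psi> x \<otimes>\<^bsub>Q\<^esub> q \<in> carrier Q" using x q by simp
    have "\<psi> (w x q) = inv\<^bsub>Q\<^esub> q \<otimes>\<^bsub>Q\<^esub> \<psi> x \<otimes>\<^bsub>Q\<^esub> (inv\<^bsub>Q\<^esub> \<psi> x \<otimes>\<^bsub>Q\<^esub> q)"
      using t[OF q] t[OF q'] x by (simp add: w_def)
    also have "\<dots> = \<one>\<^bsub>Q\<^esub>" using x q by (simp add: Q.m_assoc) (simp flip: Q.m_assoc)
    finally show ?thesis using \<psi>1[of "w x q"] t(1)[OF q] t(1)[OF q'] x by (simp add: w_def)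
  qed
  \<comment> \<open>The values in \<open>B\<close> are represented by basis vectors of the free
    abelian group. This satisfies the cocycle identity only modulo the lattice \<open>L\<close>,
    which is what the lifting of solutions requires.\<close>
  define Dt where "Dt x q = unit_vector (\<phi> (w x q))" for x q
  have Dt_cocycle: "cocycle_mod \<Delta> Q \<psi> L Dt"
    unfolding cocycle_mod_def
  proof (intro ballI)
    fix x x' q assume x: "x \<in> carrier \<Delta>" "x' \<in> carrier \<Delta>" and q: "q \<in> carrier Q"
    define q' where "q' = inv\<^bsub>Q\<^esub> \<psi> x \<otimes>\<^bsub>Q\<^esub> q"
    have q': "q' \<in> carrier Q" using x q by (simp add: q'_def)
    define q'' where "q'' = inv\<^bsub>Q\<^esub> \<psi> x' \<otimes>\<^bsub>Q\<^esub> q'"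
    have q'': "q'' \<in> carrier Q" using x q' by (simp add: q''_def)
    have "inv\<^bsub>Q\<^esub> \<psi> (x \<otimes> x') \<otimes>\<^bsub>Q\<^esub> q = q''" using x q by (simp add: q''_def q'_def Q.inv_mult_assoc)
    then have w_mult: "w (x \<otimes> x') q = w x q \<otimes> w x' q'"
      using x t(1)[OF q] t(1)[OF q'] t(1)[OF q''] by (simp add: w_def m_assoc flip: q'_def q''_def)
        (simp flip: m_assoc)
    then have "w x q \<otimes> w x' q' \<in> U" using wU[of "x \<otimes> x'" q] x q by simp
    from ev_ind[OF this] have "evaluate B (Dt (x \<otimes> x') q) = evaluate B (Dt x q) \<otimes>\<^bsub>B\<^esub> evaluate B (Dt x' q')"
      using ev_ind[OF wU[OF x(1) q]] ev_ind[OF wU[OF x(2) q']] \<phi>mult[OF wU[OF x(1) q] wU[OF x(2) q']] w_mult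
      by (simp only: Dt_def)
    then have "evaluate B (Dt (x \<otimes> x') q - (Dt x q + Dt x' q')) = \<one>\<^bsub>B\<^esub>"
      by (simp only: B.evaluate_diff_iff B.evaluate_add)
    then show "Dt (x \<otimes> x') q - Dt x q - Dt x' (inv\<^bsub>Q\<^esub> \<psi> x \<otimes>\<^bsub>Q\<^esub> q) \<in> L"
      by (simp add: L_def diff_diff_eq flip: q'_def)
  qed
  interpret Dt: cocycle_context \<Delta> Q \<psi> L Dt
    by (intro cocycle_context.intro \<psi>.group_hom_axioms cocycle_context_axioms.intro L Dt_cocycle)
  have foxL: "fox Q \<xi> (\<lambda>a. Dt (gen a)) v q \<in> L" if v: "v \<in> F_words g r s n" and q: "q \<in> carrier Q" for v q
  proof -
    have "Dt (ev \<Delta> gen v) q - fox Q (\<lambda>a. \<psi> (gen a)) (\<lambda>a. Dt (gen a)) v q \<in> L"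
      by (rule Dt.D_word) (use q in auto)
    then have "Dt \<one> q - fox Q \<xi> (\<lambda>a. Dt (gen a)) v q \<in> L" by (simp add: relator_one[OF v] \<psi>_def \<xi>_def)
    from add_subgroupD(2)[OF L Dt.D_one[OF q] this] show ?thesis by simp
  qed
  have tU: "torsion_free_on \<Delta> U" "torsion_free_on \<Delta> Y"
    using torsion_free_mono[OF H(2)] UH YU by auto
  have Ync: "Y \<noteq> carrier \<Delta>" using zY zc by blast
  have ordQ: "\<xi> (Gen_delta l) [^]\<^bsub>Q\<^esub> (i::nat) = \<one>\<^bsub>Q\<^esub> \<longleftrightarrow> n l dvd i" if l: "l < s" for l i
    unfolding \<xi>_def Q_def by (rule coset_delta_order[OF n2 hyp Y(1) tU(2) Ync U(1) tU(1) l])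
  have npos: "n l > 0" if "l < s" for l using n2[OF that] by simp
  have "\<exists>y'. (\<forall>a. \<forall>q\<in>carrier Q. y' a q - Dt (gen a) q \<in> L) \<and>
      (\<forall>v\<in>F_words g r s n. \<forall>q\<in>carrier Q. fox Q \<xi> y' v q = 0)"
    by (rule Q.lift_solution[OF L torsion_free_fun ordQ npos foxL]) blast+
  then obtain y' where y': "\<And>a q. q \<in> carrier Q \<Longrightarrow> y' a q - Dt (gen a) q \<in> L"
    "\<And>v q. v \<in> F_words g r s n \<Longrightarrow> q \<in> carrier Q \<Longrightarrow> fox Q \<xi> y' v q = 0" by blast
  define N0 where "N0 = card (carrier B)"
  have N0: "N0 > 0" using finB B.one_closed by (auto simp: N0_def card_gt_0_iff)
  \<comment> \<open>The first factor is the index of \<open>U\<close> in \<open>H\<close>, which the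
    transfer cancels. The remaining factor, the order of \<open>B\<close>, suffices because a vector
    with all coordinates divisible by it evaluates to the identity.\<close>
  define N where "N = int (card (\<psi> ` H) * N0)"
  have finQ: "finite (carrier Q)" by (rule Q.finite_Q)
  have "\<psi> ` H \<subseteq> carrier Q" using subgroup.subset[OF open_normalD(2)[OF H(1)]] by auto
  then have "finite (\<psi> ` H)" using finQ finite_subset by blast
  then have "card (\<psi> ` H) > 0" using subgroup.one_closed[OF open_normalD(2)[OF H(1)]] by (auto simp: card_gt_0_iff)
  then have Npos: "N > 0" using N0 by (simp add: N_def)
  have N0N: "int N0 dvd N" by (simp add: N_def)
  \<comment> \<open>The lifted solution satisfies the Fox equations exactly in every coordinate
    \<open>b\<close>, so each coordinate yields an integral cocycle modulo the same
    \<open>N\<close>.\<close>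
  have "\<exists>D V. cocycle_context \<Delta> Q \<psi> {x. N dvd x} D \<and>
      (\<forall>a\<in>gens. \<forall>q\<in>carrier Q. N dvd D (gen a) q - y' a q b) \<and>
      V \<in> open_normal \<and> V \<subseteq> U \<and> (\<forall>v\<in>V. \<forall>q\<in>carrier Q. N dvd D v q)" for b
  proof -
    have "N dvd fox Q \<xi> (\<lambda>a q. y' a q b) v q" if "v \<in> F_words g r s n" "q \<in> carrier Q" for v q
      using fox_apply[of Q \<xi> y' v q b] y'(2)[OF that] by simp
    from solution_cocycle[OF U(1) Npos this[unfolded Q_def \<xi>_def]]
    obtain D V where D: "cocycle_context \<Delta> (\<Delta> Mod U) (\<lambda>x. U #> x) {x. N dvd x} D"
      "\<forall>(w :: (bool \<times> F_gen) list). snd ` set w \<subseteq> gens \<longrightarrow> (\<forall>q\<in>carrier (\<Delta> Mod U).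
        N dvd D (ev \<Delta> gen w) q - fox (\<Delta> Mod U) (\<lambda>a. U #> gen a) (\<lambda>a q. y' a q b) w q)"
      "V \<in> open_normal" "V \<subseteq> U" "\<forall>v\<in>V. \<forall>q\<in>carrier (\<Delta> Mod U). N dvd D v q" .
    have "N dvd D (gen a) q - y' a q b" if "a \<in> gens" "q \<in> carrier Q" for a q
    proof -
      have "snd ` set [(True, a)] \<subseteq> gens" using that by simp
      from D(2)[rule_format, OF this that(2)[unfolded Q_def]] show ?thesis by simp
    qed
    then show ?thesis using D(1,3-5) unfolding Q_def \<psi>_def by blast
  qed
  then obtain D V where D: "\<And>b. cocycle_context \<Delta> Q \<psi> {x. N dvd x} (D b)"
    "\<And>b a q. a \<in> gens \<Longrightarrow> q \<in> carrier Q \<Longrightarrow> N dvd D b (gen a) q - y' a q b"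
    "\<And>b. V b \<in> open_normal" "\<And>b. V b \<subseteq> U" "\<And>b v q. v \<in> V b \<Longrightarrow> q \<in> carrier Q \<Longrightarrow> N dvd D b v q"
    by metis
  define Dc where "Dc x q = (\<lambda>b. if b \<in> carrier B then D b x q else 0)" for x q
  have memL: "f \<in> L" if "\<And>b. b \<in> carrier B \<Longrightarrow> int N0 dvd f b" for f
    using B.evaluate_eq_one[OF finB] that by (simp add: L_def N0_def)
  \<comment> \<open>The lifted cocycle and the original one agree modulo \<open>L\<close> on the
    generators and on a small open normal subgroup. The zero set of their difference is a subgroup,
    hence everything.\<close>
  define F where "F x q = Dc x q - Dt x q" for x q
  have "cocycle_mod \<Delta> Q \<psi> L F"
    unfolding cocycle_mod_def
  proof (intro ballI)
    fix x x' q assume x: "x \<in> carrier \<Delta>" "x' \<in> carrier \<Delta>" and q: "q \<in> carrier Q"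
    let ?q = "inv\<^bsub>Q\<^esub> \<psi> x \<otimes>\<^bsub>Q\<^esub> q"
    have "Dc (x \<otimes> x') q - (Dc x q + Dc x' ?q) \<in> L"
    proof (rule memL)
      fix b assume "b \<in> carrier B"
      have "N dvd D b (x \<otimes> x') q - (D b x q + D b x' ?q)"
        using cocycle_context.D_mult[OF D(1) x q] by simp
      then show "int N0 dvd (Dc (x \<otimes> x') q - (Dc x q + Dc x' ?q)) b"
        using dvd_trans[OF N0N] \<open>b \<in> carrier B\<close> by (simp add: Dc_def)
    qed
    moreover have "Dt (x \<otimes> x') q - (Dt x q + Dt x' ?q) \<in> L" by (rule Dt.D_mult[OF x q])
    ultimately have "(Dc (x \<otimes> x') q - (Dc x q + Dc x' ?q)) - (Dt (x \<otimes> x') q - (Dt x q + Dt x' ?q)) \<in> L"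
      by (rule add_subgroupD(2)[OF L])
    then show "F (x \<otimes> x') q - F x q - F x' ?q \<in> L" by (simp add: F_def algebra_simps)
  qed
  then interpret F: cocycle_context \<Delta> Q \<psi> L F
    by (intro cocycle_context.intro \<psi>.group_hom_axioms cocycle_context_axioms.intro L)
  obtain W where W: "W \<in> open_normal" "W \<subseteq> Y" "\<forall>b\<in>carrier B. W \<subseteq> V b"
    using finite_open_normal_Int[OF finB, of V Y] D(3) Y(1) by blast
  let ?S = "{x \<in> carrier \<Delta>. \<forall>q\<in>carrier Q. F x q \<in> L}"
  have "?S = carrier \<Delta>"
  proof (rule generated_by_gens[OF W(1) F.subgroup_cocycle_zero])
    show "W \<subseteq> ?S"
    proof
      fix v assume v: "v \<in> W"
      have vY: "v \<in> Y" and vU: "v \<in> U" using v W(2) YU by auto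
      have "F v q \<in> L" if q: "q \<in> carrier Q" for q
      proof -
        have "Dc v q \<in> L"
        proof (rule memL)
          fix b assume b: "b \<in> carrier B"
          then have "N dvd D b v q" using D(5) W(3) v q by blast
          then show "int N0 dvd Dc v q b" using dvd_trans[OF N0N] b by (simp add: Dc_def)
        qed
        moreover have "\<psi> v = \<one>\<^bsub>Q\<^esub>" using \<psi>1[OF Uc[OF vU]] vU by simp
        then have "w v q = inv (t q) \<otimes> v \<otimes> t q" using q by (simp add: w_def)
        then have "w v q \<in> Y" using normal.inv_op_closed1[OF Yn(1) t(1)[OF q] vY] by simp
        then have "Dt v q \<in> L" using indL[OF wU[OF Uc[OF vU] q]] by (simp add: Dt_def)
        ultimately show ?thesis unfolding F_def by (rule add_subgroupD(2)[OF L])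
      qed
      then show "v \<in> ?S" using Uc[OF vU] by simp
    qed
    fix a assume a: "a \<in> gens"
    have "F (gen a) q \<in> L" if q: "q \<in> carrier Q" for q
    proof -
      have "Dc (gen a) q - y' a q \<in> L"
      proof (rule memL)
        fix b assume b: "b \<in> carrier B"
        show "int N0 dvd (Dc (gen a) q - y' a q) b"
          using dvd_trans[OF N0N D(2)[OF a q, of b]] b by (simp add: Dc_def)
      qed
      then show ?thesis unfolding F_def using y'(1)[OF q, of a] by (rule add_subgroup_diff_trans[OF L])
    qed
    then show "gen a \<in> ?S" by simp
  qed
  then have Fz: "F z \<one>\<^bsub>Q\<^esub> \<in> L" using zc Q.one_closed by blast
  have "Dc z \<one>\<^bsub>Q\<^esub> \<in> L"
  proof (rule memL)
    fix b assume b: "b \<in> carrier B"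
    have "int N0 dvd D b z \<one>\<^bsub>Q\<^esub>"
      unfolding Q_def
    proof (rule transfer_divides[OF H(1,3) U(1) UH U(3) kj z central])
      show "N = int (card ((\<lambda>x. U #> x) ` H) * N0)" by (simp add: N_def \<psi>_def)
      show "cocycle_context \<Delta> (\<Delta> Mod U) (\<lambda>x. U #> x) {x. N dvd x} (D b)" using D(1) by (simp add: Q_def \<psi>_def)
      show "V b \<in> open_normal" "V b \<subseteq> U" using D(3,4) by auto
      show "\<forall>v\<in>V b. \<forall>q\<in>carrier (\<Delta> Mod U). N dvd D b v q" using D(5) by (simp add: Q_def)
    qed
    then show "int N0 dvd Dc z \<one>\<^bsub>Q\<^esub> b" using b by (simp add: Dc_def)
  qed
  from add_subgroupD(2)[OF L this Fz] have "Dt z \<one>\<^bsub>Q\<^esub> \<in> L" by (simp add: F_def)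
  then have "w z \<one>\<^bsub>Q\<^esub> \<in> Y" using indL[OF wU[OF zc Q.one_closed]] by (simp add: Dt_def)
  moreover have "\<psi> z = \<one>\<^bsub>Q\<^esub>" using \<psi>1[OF zc] zU by simp
  then have "w z \<one>\<^bsub>Q\<^esub> = z" using zc by (simp add: w_def t_def)
  ultimately show False using zY by simp
qed

end

section \<open>Triviality of the center\<close>

text \<open>A finite \<open>m\<close> excludes the level \<infinity>, so the defining set is
  nonempty, and by well-ordering its infimum is attained.\<close>

lemma torsion_free_level_plus_2_le:
  assumes "enat m \<ge> torsion_free_level G T + 2"
  obtains k H where "k + 2 \<le> m" "H \<lhd> G" "openin T H" "torsion_free_on G H" "top_derived G T k \<subseteq> H"
proof -
  let ?S = "{enat k | k. \<exists>H. H \<lhd> G \<and> openin T H \<and> torsion_free_on G H \<and> top_derived G T k \<subseteq> H}"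
  have ne: "?S \<noteq> {}"
  proof
    assume "?S = {}"
    then have "torsion_free_level G T = \<infinity>" by (simp add: torsion_free_level_def Inf_enat_def)
    then show False using assms by simp
  qed
  then have "torsion_free_level G T \<in> ?S" unfolding torsion_free_level_def by (rule wellorder_InfI[OF ex_in_conv[THEN iffD2, THEN someI_ex]])
  then obtain k H where "torsion_free_level G T = enat k"
    and H: "H \<lhd> G" "openin T H" "torsion_free_on G H" "top_derived G T k \<subseteq> H" by blast
  then have "enat k + 2 \<le> enat m" using assms by simp
  then have "k + 2 \<le> m" by (simp add: numeral_eq_enat)
  from that[OF this H] show ?thesis .
qed

lemma center_free_quotient:
  assumes "N \<lhd> G"
    and "\<And>z. z \<in> carrier G \<Longrightarrow>
      (\<And>x. x \<in> carrier G \<Longrightarrow> inv\<^bsub>G\<^esub> x \<otimes>\<^bsub>G\<^esub> inv\<^bsub>G\<^esub> z \<otimes>\<^bsub>G\<^esub> x \<otimes>\<^bsub>G\<^esub> z \<in> N) \<Longrightarrow> z \<in> N"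
  shows "center_free (G Mod N)"
proof -
  interpret normal N G by (rule assms(1))
  interpret Q: group "G Mod N" by (rule factorgroup_is_group)
  interpret h: group_hom G "G Mod N" "\<lambda>x. N #>\<^bsub>G\<^esub> x"
    by (intro group_hom.intro group_hom_axioms.intro is_group factorgroup_is_group r_coset_hom_Mod)
  have one: "N #>\<^bsub>G\<^esub> u = \<one>\<^bsub>G Mod N\<^esub> \<longleftrightarrow> u \<in> N" if "u \<in> carrier G" for u
    using coset_join1[OF _ that subgroup_axioms] coset_join2[OF that subgroup_axioms] subset by auto
  have "c = \<one>\<^bsub>G Mod N\<^esub>" if c: "c \<in> center (G Mod N)" for c
  proof -
    obtain z where z: "z \<in> carrier G" "c = N #>\<^bsub>G\<^esub> z" using c by (auto simp: center_def carrier_FactGroup)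
    have "inv\<^bsub>G\<^esub> x \<otimes>\<^bsub>G\<^esub> inv\<^bsub>G\<^esub> z \<otimes>\<^bsub>G\<^esub> x \<otimes>\<^bsub>G\<^esub> z \<in> N" if x: "x \<in> carrier G" for x
    proof -
      let ?h = "\<lambda>x. N #>\<^bsub>G\<^esub> x"
      have "?h z \<otimes>\<^bsub>G Mod N\<^esub> ?h x = ?h x \<otimes>\<^bsub>G Mod N\<^esub> ?h z"
        using c x z by (simp add: center_def)
      then have "?h (z \<otimes>\<^bsub>G\<^esub> x) = ?h (x \<otimes>\<^bsub>G\<^esub> z)" using x z by simp
      moreover have "?h (inv\<^bsub>G\<^esub> (z \<otimes>\<^bsub>G\<^esub> x) \<otimes>\<^bsub>G\<^esub> (x \<otimes>\<^bsub>G\<^esub> z))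
          = inv\<^bsub>G Mod N\<^esub> ?h (z \<otimes>\<^bsub>G\<^esub> x) \<otimes>\<^bsub>G Mod N\<^esub> ?h (x \<otimes>\<^bsub>G\<^esub> z)"
        using x z by (simp only: h.hom_mult h.hom_inv inv_closed m_closed)
      moreover have "inv\<^bsub>G Mod N\<^esub> ?h (x \<otimes>\<^bsub>G\<^esub> z) \<otimes>\<^bsub>G Mod N\<^esub> ?h (x \<otimes>\<^bsub>G\<^esub> z) = \<one>\<^bsub>G Mod N\<^esub>"
        by (rule Q.l_inv[OF h.hom_closed]) (use x z in simp)
      ultimately have "?h (inv\<^bsub>G\<^esub> (z \<otimes>\<^bsub>G\<^esub> x) \<otimes>\<^bsub>G\<^esub> (x \<otimes>\<^bsub>G\<^esub> z)) = \<one>\<^bsub>G Mod N\<^esub>" by simp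
      then show ?thesis using one[of "inv\<^bsub>G\<^esub> (z \<otimes>\<^bsub>G\<^esub> x) \<otimes>\<^bsub>G\<^esub> (x \<otimes>\<^bsub>G\<^esub> z)"] x z
        by (simp add: inv_mult_group m_assoc)
    qed
    then show ?thesis using assms(2)[OF z(1)] one[OF z(1)] z(2) by blast
  qed
  moreover have "\<one>\<^bsub>G Mod N\<^esub> \<in> center (G Mod N)" unfolding center_def using Q.one_closed Q.l_one Q.r_one by simp
  ultimately show ?thesis unfolding center_free_def by blast
qed

theorem proposition2p23:
  fixes \<Delta> :: "('a, 'b) monoid_scheme" and T :: "'a topology" and m :: nat
  assumes "hyperbolic_profinite_F_group \<Delta> T"
    and "enat m \<ge> torsion_free_level \<Delta> T + 2"
  shows "center_free (max_solvable_quotient \<Delta> T m)"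
proof -
  obtain g r s n where pres: "has_F_presentation \<Delta> T g r s n"
    and hyp: "2 - 2 * real g - real r - (\<Sum>l<s. 1 - 1 / real (n l)) < 0"
    and prof: "profinite_group \<Delta> T"
    using assms(1) unfolding hyperbolic_profinite_F_group_def profinite_F_group_def by blast
  have n2: "\<And>l. l < s \<Longrightarrow> n l \<ge> 2" using pres by (simp add: has_F_presentation_def)
  obtain p where p: "p \<in> hom (free_profinite (F_gens g r s)) \<Delta>"
    "continuous_map (free_profinite_topology (F_gens g r s)) T p"
    "p ` carrier (free_profinite (F_gens g r s)) = carrier \<Delta>"
    "kernel (free_profinite (F_gens g r s)) \<Delta> p
      = closed_normal_closure (free_profinite (F_gens g r s)) (free_profinite_topology (F_gens g r s))
          (F_relators (free_profinite (F_gens g r s)) (free_gen (F_gens g r s)) g r s n)"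
    using pres unfolding has_F_presentation_def has_topological_presentation_def by blast
  interpret F_presentation \<Delta> T g r s n p
    by (intro F_presentation.intro F_presentation_axioms.intro prof p)
  obtain k H where k: "k + 2 \<le> m" and H: "H \<lhd> \<Delta>" "openin T H" "torsion_free_on \<Delta> H" "top_derived \<Delta> T k \<subseteq> H"
    using torsion_free_level_plus_2_le[OF assms(2)] .
  \<comment> \<open>One of the two extra steps passes from \<open>m\<close> to
    \<open>j = m - 1\<close>; the other makes \<open>j\<close> exceed \<open>k\<close> strictly, so
    that the \<open>j\<close>-th derived group lies in the closed derived group of
    \<open>H\<close>.\<close>
  define j where "j = m - 1"
  have j: "m = Suc j" "k < j" using k by (auto simp: j_def)
  have Ho: "H \<in> open_normal" using H(1,2) by (rule open_normal_if_openin)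
  have jH: "top_derived \<Delta> T j \<subseteq> H" using top_derived_antimono[of k j] j(2) H(4) by auto
  show ?thesis
    unfolding max_solvable_quotient_def j(1)
  proof (rule center_free_quotient[OF top_derived_normal])
    fix z assume z: "z \<in> carrier \<Delta>"
      and central: "\<And>x. x \<in> carrier \<Delta> \<Longrightarrow> inv\<^bsub>\<Delta>\<^esub> x \<otimes>\<^bsub>\<Delta>\<^esub> inv\<^bsub>\<Delta>\<^esub> z \<otimes>\<^bsub>\<Delta>\<^esub> x \<otimes>\<^bsub>\<Delta>\<^esub> z \<in> top_derived \<Delta> T (Suc j)"
    have zj: "z \<in> top_derived \<Delta> T j"
      by (rule central_imp_mem_previous[OF n2 hyp Ho H(3) jH z central])
    show "z \<in> top_derived \<Delta> T (Suc j)"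
      by (rule central_imp_mem_next[OF n2 hyp Ho H(3,4) j(2) zj central])
  qed
qed

end
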